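(* Let $n\ge 2$, $m\ge 1$, and let $\Omega\subset\mathbb{C}^n$ be a bounded $m$-convex domain with Dini-smooth boundary. Let $0<c_2<\frac{1}{12m^2-8m}$. Then there exists a constant $c_1>0$ such that for all $x,y\in\Omega$ and every Kobayashi geodesic $[x,y]$ joining $x$ and $y$ in $\Omega$, $$l_d([x,y])\le c_1|x-y|^{c_2}.$$ If, in addition, $(\Omega,K_\Omega)$ is Gromov hyperbolic, then for every $\lambda\ge 1$ there exists a constant $c_1'>0$ such that for all $x,y\in\Omega$ and every Kobayashi $\lambda$-quasi-geodesic $\gamma$ connecting $x$ and $y$, $$l_d(\gamma)\le c_1'|x-y|^{c_2}.$$
   Context: Notation: $|\cdot|$ is the Euclidean norm on $\mathbb{C}^n$ and $l_d$ denotes Euclidean length of curves. For an open set $\Omega\subsetneq\mathbb{C}^n$, $\delta_\Omega(z)$ is the Euclidean distance from $z\in\Omega$ to $\partial\Omega$, and for $v\in\mathbb{C}^n\setminus\{0\}$, $\delta_\Omega(z;v)=\inf\{|z-\xi|:\xi\in\partial\Omega\cap(z+\mathbb{C}v)\}$. $m$-convex: a bounded convex domain $\Omega\subset\mathbb{C}^n$ ($n\ge2$) is $m$-convex ($m\ge1$) if there exists $C>0$ such that $\delta_\Omega(z;v)\le C\,\delta_\Omega(z)^{1/m}$ for all $z\in\Omega$ and all $v\in\mathbb{C}^n\setminus\{0\}$. Dini-smooth boundary: $\partial\Omega$ is $C^1$-smooth and each $p\in\partial\Omega$ has a neighborhood $U$ such that $\int_0^1\frac{\omega(t)}{t}\,dt<\infty$,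 where $\omega(t)=\sup\{|\mathbf{n}_x-\mathbf{n}_y|:|x-y|<t,\ x,y\in\partial\Omega\cap U\}$ and $\mathbf{n}$ is the inner unit normal to $\partial\Omega$. Kobayashi metric: $k_\Omega(x;v)=\inf\{|\xi|: f:\mathbb{D}\to\Omega \text{ holomorphic},\ f(0)=x,\ d(f)_0(\xi)=v\}$, and the Kobayashi distance $K_\Omega(x,y)$ is the infimum of $\int_a^b k_\Omega(\sigma(t);\sigma'(t))\,dt$ over absolutely continuous curves $\sigma:[a,b]\to\Omega$ joining $x$ to $y$. A Kobayashi geodesic is a map $\sigma:I\to\Omega$ ($I\subset\mathbb{R}$ an interval) with $K_\Omega(\sigma(s),\sigma(t))=|t-s|$ for all $s,t\in I$; a Kobayashi $\lambda$-quasi-geodesic is a curve $\sigma:I\to\Omega$ with $\frac1\lambda|t-s|\le K_\Omega(\sigma(s),\sigma(t))\le\lambda|t-s|$ for all $s,t\in I$. Gromov hyperbolic: a proper geodesic metric space $(X,\rho)$ is Gromov hyperbolic if there is $\delta\ge0$ such that $(x|y)_o\ge\min\{(x|z)_o,(z|y)_o\}-\delta$ for all $o,x,y,z\in X$, where $(x|y)_o=\frac12(\rho(x,o)+\rho(o,y)-\rho(x,y))$. *)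

theory Defs
  imports "HOL-Analysis.Analysis"
begin

text \<open>Complex \<open>n\<close>-space is \<open>complex ^ 'n\<close> with \<open>n = CARD('n)\<close>; its \<open>norm\<close>, \<open>dist\<close> and real inner
  product are the Euclidean ones, and \<open>c *s v\<close> is multiplication by the complex scalar \<open>c\<close>.\<close>

definition bdist :: "(complex ^ 'n) set \<Rightarrow> complex ^ 'n \<Rightarrow> real" where
  "bdist \<Omega> z = infdist z (frontier \<Omega>)"

text \<open>For bounded open \<open>\<Omega>\<close>, \<open>z \<in> \<Omega>\<close> and \<open>v \<noteq> 0\<close> the complex line always meets the frontier, so the
  convention \<open>infdist z {} = 0\<close> is never used.\<close>

definition bdist_dir :: "(complex ^ 'n) set \<Rightarrow> complex ^ 'n \<Rightarrow> complex ^ 'n \<Rightarrow> real" where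
  "bdist_dir \<Omega> z v = infdist z (frontier \<Omega> \<inter> range (\<lambda>c. z + c *s v))"

definition m_convex :: "real \<Rightarrow> (complex ^ 'n) set \<Rightarrow> bool" where
  "m_convex m \<Omega> \<longleftrightarrow>
     open \<Omega> \<and> \<Omega> \<noteq> {} \<and> bounded \<Omega> \<and> convex \<Omega> \<and>
     (\<exists>C>0. \<forall>z\<in>\<Omega>. \<forall>v. v \<noteq> 0 \<longrightarrow> bdist_dir \<Omega> z v \<le> C * bdist \<Omega> z powr (1 / m))"

text \<open>\<open>r\<close> is a \<open>C\<^sup>1\<close> defining function of \<open>\<Omega>\<close> on the neighbourhood \<open>U\<close> of \<open>p\<close>, with gradient \<open>g\<close>.
  As \<open>g\<close> does not vanish, \<open>frontier \<Omega> \<inter> U\<close> is exactly the zero set of \<open>r\<close> in \<open>U\<close>.\<close>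

definition local_defining ::
  "(complex ^ 'n) set \<Rightarrow> complex ^ 'n \<Rightarrow> (complex ^ 'n) set \<Rightarrow>
   (complex ^ 'n \<Rightarrow> real) \<Rightarrow> (complex ^ 'n \<Rightarrow> complex ^ 'n) \<Rightarrow> bool" where
  "local_defining \<Omega> p U r g \<longleftrightarrow>
     open U \<and> p \<in> U \<and> continuous_on U g \<and>
     (\<forall>x\<in>U. GDERIV r x :> g x \<and> g x \<noteq> 0) \<and>
     \<Omega> \<inter> U = {x \<in> U. r x < 0}"

definition C1_boundary :: "(complex ^ 'n) set \<Rightarrow> bool" where
  "C1_boundary \<Omega> \<longleftrightarrow> (\<forall>p\<in>frontier \<Omega>. \<exists>U r g. local_defining \<Omega> p U r g)"

text \<open>At a boundary point the vector described here does not depend on the defining function.\<close>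

definition inner_normal :: "(complex ^ 'n) set \<Rightarrow> complex ^ 'n \<Rightarrow> complex ^ 'n" where
  "inner_normal \<Omega> x = (THE \<nu>. \<exists>U r g. local_defining \<Omega> x U r g \<and> \<nu> = - (g x /\<^sub>R norm (g x)))"

definition normal_modulus :: "(complex ^ 'n) set \<Rightarrow> (complex ^ 'n) set \<Rightarrow> real \<Rightarrow> real" where
  "normal_modulus \<Omega> U t =
     Sup {norm (inner_normal \<Omega> x - inner_normal \<Omega> y) | x y.
            x \<in> frontier \<Omega> \<inter> U \<and> y \<in> frontier \<Omega> \<inter> U \<and> norm (x - y) < t}"

definition Dini_smooth_boundary :: "(complex ^ 'n) set \<Rightarrow> bool" where
  "Dini_smooth_boundary \<Omega> \<longleftrightarrow>
     C1_boundary \<Omega> \<and>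
     (\<forall>p\<in>frontier \<Omega>. \<exists>U. open U \<and> p \<in> U \<and>
        (\<integral>\<^sup>+t\<in>{0<..1}. ennreal (normal_modulus \<Omega> U t / t) \<partial>lborel) < \<infinity>)"

text \<open>A map into \<open>complex ^ 'n\<close> is holomorphic iff its components are, and its differential at \<open>0\<close>
  sends \<open>\<xi>\<close> to the vector with components \<open>deriv (\<lambda>\<zeta>. f \<zeta> $ i) 0 * \<xi>\<close>.\<close>

definition kobayashi_metric :: "(complex ^ 'n) set \<Rightarrow> complex ^ 'n \<Rightarrow> complex ^ 'n \<Rightarrow> real" where
  "kobayashi_metric \<Omega> x v =
     Inf {norm \<xi> | \<xi> f.
            (\<forall>i. (\<lambda>\<zeta>. f \<zeta> $ i) holomorphic_on ball 0 1) \<and> f ` ball 0 1 \<subseteq> \<Omega> \<and> f 0 = x \<and>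
            (\<chi> i. deriv (\<lambda>\<zeta>. f \<zeta> $ i) 0 * \<xi>) = v}"

definition abs_cont_on :: "real \<Rightarrow> real \<Rightarrow> (real \<Rightarrow> 'a::real_normed_vector) \<Rightarrow> bool" where
  "abs_cont_on a b \<sigma> \<longleftrightarrow>
     (\<forall>\<epsilon>>0. \<exists>\<delta>>0. \<forall>(N::nat) s t.
        (\<forall>k<N. a \<le> s k \<and> s k \<le> t k \<and> t k \<le> b) \<and>
        disjoint_family_on (\<lambda>k. {s k<..<t k}) {..<N} \<and>
        (\<Sum>k<N. t k - s k) < \<delta>
        \<longrightarrow> (\<Sum>k<N. norm (\<sigma> (t k) - \<sigma> (s k))) < \<epsilon>)"

text \<open>An absolutely continuous curve is differentiable almost everywhere; the value of
  \<open>vector_derivative\<close> on the remaining null set does not affect the integral.\<close>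

definition kobayashi_length ::
  "(complex ^ 'n) set \<Rightarrow> real \<Rightarrow> real \<Rightarrow> (real \<Rightarrow> complex ^ 'n) \<Rightarrow> ennreal" where
  "kobayashi_length \<Omega> a b \<sigma> =
     (\<integral>\<^sup>+t\<in>{a..b}. ennreal (kobayashi_metric \<Omega> (\<sigma> t) (vector_derivative \<sigma> (at t))) \<partial>lebesgue)"

definition kobayashi_dist :: "(complex ^ 'n) set \<Rightarrow> complex ^ 'n \<Rightarrow> complex ^ 'n \<Rightarrow> real" where
  "kobayashi_dist \<Omega> x y =
     enn2real (Inf {kobayashi_length \<Omega> a b \<sigma> | a b \<sigma>.
                      a \<le> b \<and> abs_cont_on a b \<sigma> \<and> \<sigma> ` {a..b} \<subseteq> \<Omega> \<and> \<sigma> a = x \<and> \<sigma> b = y})"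

definition metric_geodesic :: "'a set \<Rightarrow> ('a \<Rightarrow> 'a \<Rightarrow> real) \<Rightarrow> real set \<Rightarrow> (real \<Rightarrow> 'a) \<Rightarrow> bool" where
  "metric_geodesic X \<rho> I \<sigma> \<longleftrightarrow>
     is_interval I \<and> \<sigma> ` I \<subseteq> X \<and> (\<forall>s\<in>I. \<forall>t\<in>I. \<rho> (\<sigma> s) (\<sigma> t) = \<bar>t - s\<bar>)"

definition kobayashi_geodesic ::
  "(complex ^ 'n) set \<Rightarrow> real set \<Rightarrow> (real \<Rightarrow> complex ^ 'n) \<Rightarrow> bool" where
  "kobayashi_geodesic \<Omega> I \<sigma> \<longleftrightarrow> metric_geodesic \<Omega> (kobayashi_dist \<Omega>) I \<sigma>"

definition kobayashi_quasi_geodesic ::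
  "real \<Rightarrow> (complex ^ 'n) set \<Rightarrow> real set \<Rightarrow> (real \<Rightarrow> complex ^ 'n) \<Rightarrow> bool" where
  "kobayashi_quasi_geodesic L \<Omega> I \<sigma> \<longleftrightarrow>
     is_interval I \<and> \<sigma> ` I \<subseteq> \<Omega> \<and> continuous_on I \<sigma> \<and>
     (\<forall>s\<in>I. \<forall>t\<in>I. 1 / L * \<bar>t - s\<bar> \<le> kobayashi_dist \<Omega> (\<sigma> s) (\<sigma> t) \<and>
                    kobayashi_dist \<Omega> (\<sigma> s) (\<sigma> t) \<le> L * \<bar>t - s\<bar>)"

definition joins :: "real \<Rightarrow> real \<Rightarrow> (real \<Rightarrow> 'a) \<Rightarrow> 'a \<Rightarrow> 'a \<Rightarrow> bool" where
  "joins a b \<sigma> x y \<longleftrightarrow> a \<le> b \<and> \<sigma> a = x \<and> \<sigma> b = y"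

definition euclidean_length :: "real \<Rightarrow> real \<Rightarrow> (real \<Rightarrow> complex ^ 'n) \<Rightarrow> ennreal" where
  "euclidean_length a b \<sigma> =
     Sup {\<Sum>k<N. ennreal (norm (\<sigma> (t (Suc k)) - \<sigma> (t k))) | (N::nat) t.
            mono_on {..N} t \<and> t ` {..N} \<subseteq> {a..b}}"

definition gromov_product :: "('a \<Rightarrow> 'a \<Rightarrow> real) \<Rightarrow> 'a \<Rightarrow> 'a \<Rightarrow> 'a \<Rightarrow> real" where
  "gromov_product \<rho> w x y = (\<rho> x w + \<rho> w y - \<rho> x y) / 2"

definition proper_geodesic_space :: "'a set \<Rightarrow> ('a \<Rightarrow> 'a \<Rightarrow> real) \<Rightarrow> bool" where
  "proper_geodesic_space X \<rho> \<longleftrightarrow>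
     Metric_space X \<rho> \<and>
     (\<forall>x\<in>X. \<forall>R. compactin (Metric_space.mtopology X \<rho>) (Metric_space.mcball X \<rho> x R)) \<and>
     (\<forall>x\<in>X. \<forall>y\<in>X. \<exists>a b \<sigma>. metric_geodesic X \<rho> {a..b} \<sigma> \<and> joins a b \<sigma> x y)"

definition gromov_hyperbolic :: "'a set \<Rightarrow> ('a \<Rightarrow> 'a \<Rightarrow> real) \<Rightarrow> bool" where
  "gromov_hyperbolic X \<rho> \<longleftrightarrow>
     proper_geodesic_space X \<rho> \<and>
     (\<exists>\<delta>\<ge>0. \<forall>w\<in>X. \<forall>x\<in>X. \<forall>y\<in>X. \<forall>z\<in>X.
        gromov_product \<rho> w x y \<ge> min (gromov_product \<rho> w x z) (gromov_product \<rho> w z y) - \<delta>)"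

end

theory Submission
  imports Defs "HOL-Complex_Analysis.Complex_Analysis"
begin

text \<open>
  Write \<open>\<delta>\<close> for the boundary distance and \<open>K\<close> for the Kobayashi distance. Convexity gives
  \<open>K(x, y) \<ge> \<bar>log (\<delta>(x) / \<delta>(y))\<bar> / 2\<close> by comparison with supporting half spaces, and
  \<open>m\<close>-convexity bounds the Euclidean speed of a quasi-geodesic by a multiple of \<open>\<delta>\<^sup>1\<^sup>/\<^sup>m\<close>.
  Since the boundary is \<open>C\<^sup>1\<close>, uniform interior cones of almost full opening give, for every \<open>A > 1\<close>,
  an upper bound \<open>K(x, y) \<le> A/2 (log (h / \<delta>(x)) + log (h / \<delta>(y))) + B\<close> at each scale
  \<open>h \<ge> \<bar>x - y\<bar>, \<delta>(x), \<delta>(y)\<close>.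

  At scale \<open>h = 1\<close> the upper bound makes \<open>\<delta>\<close> decay exponentially away from the highest point of a
  quasi-geodesic, so its length is at most a multiple of \<open>H\<^sup>1\<^sup>/\<^sup>2\<^sup>m\<close>, where \<open>H\<close> is the largest value
  of \<open>\<delta>\<close>. Let \<open>r = \<bar>x - y\<bar>\<close> and cut the curve at the first and the last time at which
  \<open>\<delta> \<ge> r\<^sup>2\<^sup>m\<close>: the outer pieces have length \<open>O(r)\<close>, and on the middle piece the upper bound at scale
  \<open>O(r)\<close> against the lower bound through the highest point gives \<open>H = O(r\<^sup>1\<^sup>/\<^sup>2)\<close> for \<open>A\<close> close to \<open>1\<close>.
  The exponent obtained is \<open>1 / (4 m)\<close>, which is at least \<open>1 / (12 m\<^sup>2 - 8 m)\<close>. For geodesics \<open>K\<close> is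
  additive along the curve; for quasi-geodesics in the hyperbolic case it is additive up to an error
  logarithmic in the length, which is absorbed because exact additivity would even give
  \<open>H = O(r\<^sup>s)\<close> with \<open>s = 1/2 + 1 / (4 m)\<close>.
\<close>

section \<open>Absolutely continuous functions\<close>

text \<open>The lossy constant \<open>A\<close> dictates the height of the cut. Cones narrower than
  a half space only give \<open>A > 1\<close>, and the excess \<open>A - 1\<close> is charged on
  \<open>log (1 / \<delta>)\<close> at the endpoints, which has no bound near the boundary. Above
  the cut this logarithm is at most \<open>2 * m * log (1 / r)\<close>, so the loss is a controlled
  fraction of \<open>log (1 / r)\<close>. The cut also bounds the parameter length of the middle
  piece by a multiple of \<open>log (1 / r)\<close>; hence an additivity error that is linear in the
  parameter with a small slope does no harm.

  The Kobayashi distance is an infimum over absolutely continuous curves, and their length only sees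
  the derivative almost everywhere. A lower bound has to recover an increment from that derivative,
  which is the purpose of the measure theory; upper bounds come from explicit curves. The Euclidean
  length of a quasi-geodesic is a supremum of polygonal sums and is bounded by a scalar function
  whose increments dominate those of the curve.\<close>

definition abs_cont :: "(real \<Rightarrow> real) \<Rightarrow> bool" where
  "abs_cont F \<longleftrightarrow>
     (\<forall>\<epsilon>>0. \<exists>\<delta>>0. \<forall>(N::nat) s t.
        (\<forall>k<N. s k \<le> t k) \<and> disjoint_family_on (\<lambda>k. {s k<..<t k}) {..<N} \<and>
        (\<Sum>k<N. t k - s k) < \<delta> \<longrightarrow> (\<Sum>k<N. \<bar>F (t k) - F (s k)\<bar>) < \<epsilon>)"

definition interval_family :: "real set \<Rightarrow> nat \<Rightarrow> (nat \<Rightarrow> real) \<Rightarrow> (nat \<Rightarrow> real) \<Rightarrow> bool" where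
  "interval_family A N s t \<longleftrightarrow>
     (\<forall>k<N. s k \<le> t k \<and> {s k<..<t k} \<subseteq> A) \<and> disjoint_family_on (\<lambda>k. {s k<..<t k}) {..<N}"

text \<open>Finite disjoint families replace the partitions of the usual total variation. This makes
  sense on any set, and concatenating families gives superadditivity on disjoint sets. Only the open
  intervals have to lie in the set, so neighbours may share endpoints. Values in
  \<open>ennreal\<close> postpone the question of finiteness.\<close>

definition variation_on :: "(real \<Rightarrow> real) \<Rightarrow> real set \<Rightarrow> ennreal" where
  "variation_on F A =
     (SUP (N, s, t) \<in> {(N, s, t). interval_family A N s t}. ennreal (\<Sum>k<N. \<bar>F (t k) - F (s k)\<bar>))"

lemma variation_on_upper:
  "interval_family A N s t \<Longrightarrow> ennreal (\<Sum>k<N. \<bar>F (t k) - F (s k)\<bar>) \<le> variation_on F A"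
  unfolding variation_on_def by (rule SUP_upper2[of "(N, s, t)"]) auto

lemma variation_on_least:
  assumes "\<And>N s t. interval_family A N s t \<Longrightarrow> ennreal (\<Sum>k<N. \<bar>F (t k) - F (s k)\<bar>) \<le> c"
  shows "variation_on F A \<le> c"
  unfolding variation_on_def by (rule SUP_least) (use assms in auto)

lemma interval_family_0: "interval_family A 0 s t"
  by (simp add: interval_family_def disjoint_family_on_def)

lemma sum_lessThan_append:
  fixes f g :: "nat \<Rightarrow> 'a::comm_monoid_add"
  shows "(\<Sum>k<N + M. if k < N then f k else g (k - N)) = (\<Sum>k<N. f k) + (\<Sum>k<M. g k)"
  by (induction M) (auto simp: add.assoc[symmetric])

lemma interval_family_append:
  assumes "interval_family A N s t" "interval_family B M s' t'" "A \<inter> B = {}"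
  shows "interval_family (A \<union> B) (N + M)
           (\<lambda>k. if k < N then s k else s' (k - N)) (\<lambda>k. if k < N then t k else t' (k - N))"
proof -
  let ?I = "\<lambda>k. {(if k < N then s k else s' (k - N))<..<(if k < N then t k else t' (k - N))}"
  have 1: "?I k \<subseteq> A" if "k < N" for k
    using assms(1) that by (auto simp: interval_family_def)
  have 2: "?I k \<subseteq> B" if "\<not> k < N" "k < N + M" for k
    using assms(2) that by (auto simp: interval_family_def)
  have "?I i \<inter> ?I j = {}" if "i < N + M" "j < N + M" "i \<noteq> j" for i j
  proof (cases "i < N"; cases "j < N")
    assume "i < N" "j < N"
    with that assms(1) show ?thesis
      by (auto simp: interval_family_def disjoint_family_on_def)
  next
    assume "i < N" "\<not> j < N"
    with that 1[of i] 2[of j] assms(3) show ?thesis by blast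
  next
    assume "\<not> i < N" "j < N"
    with that 1[of j] 2[of i] assms(3) show ?thesis by blast
  next
    assume *: "\<not> i < N" "\<not> j < N"
    then have "i - N \<noteq> j - N" "i - N < M" "j - N < M" using that by auto
    with * assms(2) show ?thesis
      by (auto simp: interval_family_def disjoint_family_on_def)
  qed
  moreover have "(if k < N then s k else s' (k - N)) \<le> (if k < N then t k else t' (k - N)) \<and> ?I k \<subseteq> A \<union> B"
    if "k < N + M" for k
  proof (cases "k < N")
    case True
    then show ?thesis using 1[of k] assms(1) by (auto simp: interval_family_def)
  next
    case False
    then have "k - N < M" using that by auto
    then show ?thesis using False 2[of k] that assms(2) by (auto simp: interval_family_def)
  qed
  ultimately show ?thesis
    unfolding interval_family_def disjoint_family_on_def by (intro conjI allI impI ballI) auto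
qed

lemma variation_on_superadd:
  assumes "A \<inter> B = {}"
  shows "variation_on F A + variation_on F B \<le> variation_on F (A \<union> B)"
proof -
  \<comment> \<open>Taking a supremum out of an \<open>ennreal\<close> sum requires a nonempty index
    set; the empty family supplies one.\<close>
  have ne: "{(N, s, t). interval_family C N s t} \<noteq> {}" for C
    using interval_family_0[of C] by blast
  have *: "ennreal (\<Sum>k<N. \<bar>F (t k) - F (s k)\<bar>) + ennreal (\<Sum>k<M. \<bar>F (t' k) - F (s' k)\<bar>) \<le> variation_on F (A \<union> B)"
    if "interval_family A N s t" "interval_family B M s' t'" for N s t M s' t'
  proof -
    have "(\<Sum>k<N + M. \<bar>F (if k < N then t k else t' (k - N)) - F (if k < N then s k else s' (k - N))\<bar>)
       = (\<Sum>k<N + M. if k < N then \<bar>F (t k) - F (s k)\<bar> else \<bar>F (t' (k - N)) - F (s' (k - N))\<bar>)"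
      by (intro sum.cong) auto
    also have "\<dots> = (\<Sum>k<N. \<bar>F (t k) - F (s k)\<bar>) + (\<Sum>k<M. \<bar>F (t' k) - F (s' k)\<bar>)"
      by (rule sum_lessThan_append)
    finally show ?thesis
      using variation_on_upper[OF interval_family_append[OF that assms], of F]
      by (simp add: sum_nonneg flip: ennreal_plus)
  qed
  have "variation_on F A + ennreal (\<Sum>k<M. \<bar>F (t' k) - F (s' k)\<bar>) \<le> variation_on F (A \<union> B)"
    if "interval_family B M s' t'" for M s' t'
    unfolding variation_on_def[of F A] using ne[of A] * that
    by (subst ennreal_SUP_add_left[symmetric]) (auto intro!: SUP_least)
  then show ?thesis
    unfolding variation_on_def[of F B] add.commute[of "variation_on F A"] using ne[of B]
    by (subst ennreal_SUP_add_left[symmetric]) (auto intro!: SUP_least simp: add.commute)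
qed

text \<open>Each interval is cut at \<open>u\<close> by clamping its endpoints with
  \<open>min\<close> and \<open>max\<close>. An interval on one side of \<open>u\<close> becomes
  degenerate on the other and contributes zero there.\<close>

lemma variation_on_split:
  "variation_on F {p<..<q} \<le> variation_on F {p<..<u} + variation_on F {u<..<q}"
proof (rule variation_on_least)
  fix N s t assume f: "interval_family {p<..<q} N s t"
  have sub: "{s k<..<t k} \<subseteq> {p<..<q}" "s k \<le> t k" if "k < N" for k
    using f that by (auto simp: interval_family_def)
  have dj: "disjoint_family_on (\<lambda>k. {s k<..<t k}) {..<N}"
    using f by (auto simp: interval_family_def)
  have 1: "interval_family {p<..<u} N (\<lambda>k. min (s k) u) (\<lambda>k. min (t k) u)"
    unfolding interval_family_def
  proof (intro conjI allI impI)
    fix k assume k: "k < N"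
    show "min (s k) u \<le> min (t k) u" using sub[OF k] by auto
    show "{min (s k) u<..<min (t k) u} \<subseteq> {p<..<u}"
      using sub[OF k] by (auto simp: min_def subset_iff split: if_splits)
  next
    show "disjoint_family_on (\<lambda>k. {min (s k) u<..<min (t k) u}) {..<N}"
    proof (rule disjoint_family_on_bisimulation[OF dj])
      fix m n assume d: "{s m<..<t m} \<inter> {s n<..<t n} = {}"
      have "{min (s k) u<..<min (t k) u} \<subseteq> {s k<..<t k}" for k
        by (auto simp: min_def split: if_splits)
      then show "{min (s m) u<..<min (t m) u} \<inter> {min (s n) u<..<min (t n) u} = {}"
        using d by blast
    qed
  qed
  have 2: "interval_family {u<..<q} N (\<lambda>k. max (s k) u) (\<lambda>k. max (t k) u)"
    unfolding interval_family_def
  proof (intro conjI allI impI)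
    fix k assume k: "k < N"
    show "max (s k) u \<le> max (t k) u" using sub[OF k] by auto
    show "{max (s k) u<..<max (t k) u} \<subseteq> {u<..<q}"
      using sub[OF k] by (auto simp: max_def subset_iff split: if_splits)
  next
    show "disjoint_family_on (\<lambda>k. {max (s k) u<..<max (t k) u}) {..<N}"
    proof (rule disjoint_family_on_bisimulation[OF dj])
      fix m n assume d: "{s m<..<t m} \<inter> {s n<..<t n} = {}"
      have "{max (s k) u<..<max (t k) u} \<subseteq> {s k<..<t k}" for k
        by (auto simp: max_def split: if_splits)
      then show "{max (s m) u<..<max (t m) u} \<inter> {max (s n) u<..<max (t n) u} = {}"
        using d by blast
    qed
  qed
  have "(\<Sum>k<N. \<bar>F (t k) - F (s k)\<bar>) \<le>
     (\<Sum>k<N. \<bar>F (min (t k) u) - F (min (s k) u)\<bar> + \<bar>F (max (t k) u) - F (max (s k) u)\<bar>)"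
    by (intro sum_mono) (use sub in \<open>auto simp: min_def max_def\<close>)
  then have "ennreal (\<Sum>k<N. \<bar>F (t k) - F (s k)\<bar>)
      \<le> ennreal ((\<Sum>k<N. \<bar>F (min (t k) u) - F (min (s k) u)\<bar>) + (\<Sum>k<N. \<bar>F (max (t k) u) - F (max (s k) u)\<bar>))"
    by (intro ennreal_leI) (simp add: sum.distrib)
  also have "\<dots> = ennreal (\<Sum>k<N. \<bar>F (min (t k) u) - F (min (s k) u)\<bar>) + ennreal (\<Sum>k<N. \<bar>F (max (t k) u) - F (max (s k) u)\<bar>)"
    by (intro ennreal_plus sum_nonneg) auto
  also have "\<dots> \<le> variation_on F {p<..<u} + variation_on F {u<..<q}"
    by (intro add_mono variation_on_upper 1 2)
  finally show "ennreal (\<Sum>k<N. \<bar>F (t k) - F (s k)\<bar>) \<le> variation_on F {p<..<u} + variation_on F {u<..<q}" .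
qed

lemma variation_on_mono: "A \<subseteq> B \<Longrightarrow> variation_on F A \<le> variation_on F B"
  by (rule variation_on_least, rule variation_on_upper) (auto simp: interval_family_def)

lemma abs_le_variation_on: "s \<le> t \<Longrightarrow> ennreal \<bar>F t - F s\<bar> \<le> variation_on F {s<..<t}"
  using variation_on_upper[of "{s<..<t}" "Suc 0" "\<lambda>_. s" "\<lambda>_. t" F]
  by (auto simp: interval_family_def disjoint_family_on_def)

lemma variation_on_UN_superadd:
  "disjoint_family_on A {..<N::nat} \<Longrightarrow> (\<Sum>k<N. variation_on F (A k)) \<le> variation_on F (\<Union>k<N. A k)"
proof (induction N)
  case (Suc N)
  have "A k \<inter> A N = {}" if "k < N" for k
    using Suc.prems that by (simp add: disjoint_family_on_def)
  then have dj: "(\<Union>k<N. A k) \<inter> A N = {}" by blast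
  have "(\<Sum>k<Suc N. variation_on F (A k)) = (\<Sum>k<N. variation_on F (A k)) + variation_on F (A N)"
    by simp
  also have "\<dots> \<le> variation_on F (\<Union>k<N. A k) + variation_on F (A N)"
    using Suc.prems by (intro add_right_mono Suc.IH) (simp add: disjoint_family_on_def)
  also have "\<dots> \<le> variation_on F ((\<Union>k<N. A k) \<union> A N)"
    by (rule variation_on_superadd[OF dj])
  also have "(\<Union>k<N. A k) \<union> A N = (\<Union>k<Suc N. A k)"
    by (auto simp: lessThan_Suc)
  finally show ?case .
qed simp

text \<open>Lebesgue measure settles this: it is additive on the disjoint intervals and subadditive
  on the covering ones, which may overlap.\<close>

lemma interval_family_length_le:
  fixes M :: nat
  assumes f: "interval_family (\<Union>k<M. {p k<..<q k}) N s t" and pq: "\<And>k. k < M \<Longrightarrow> p k \<le> q k"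
  shows "(\<Sum>k<N. t k - s k) \<le> (\<Sum>k<M. q k - p k)"
proof -
  have dj: "disjoint_family_on (\<lambda>k. {s k<..<t k}) {..<N}" and st: "\<And>k. k < N \<Longrightarrow> s k \<le> t k"
    and sub: "(\<Union>k<N. {s k<..<t k}) \<subseteq> (\<Union>k<M. {p k<..<q k})"
    using f by (auto simp: interval_family_def)
  have "ennreal (\<Sum>k<N. t k - s k) = (\<Sum>k<N. emeasure lborel {s k<..<t k})"
    using st by (subst sum_ennreal[symmetric]) (auto intro!: sum.cong)
  also have "\<dots> = emeasure lborel (\<Union>k<N. {s k<..<t k})"
    by (rule sum_emeasure) (use dj in auto)
  also have "\<dots> \<le> emeasure lborel (\<Union>k<M. {p k<..<q k})"
    by (rule emeasure_mono[OF sub]) (auto intro!: borel_open)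
  also have "\<dots> \<le> (\<Sum>k<M. emeasure lborel {p k<..<q k})"
    by (rule emeasure_subadditive_finite) (auto intro: finite_lessThan)
  also have "\<dots> = ennreal (\<Sum>k<M. q k - p k)"
    using pq by (subst sum_ennreal[symmetric]) (auto intro!: sum.cong)
  finally show ?thesis
    by (subst (asm) ennreal_le_iff) (use pq in \<open>auto intro!: sum_nonneg\<close>)
qed

text \<open>The \<open>\<delta>\<close> of absolute continuity controls every disjoint family of
  small total length, hence all families inside a small union at once. This turns a bound for
  increments of \<open>F\<close> into a bound for its variation.\<close>

lemma abs_cont_variation_small:
  assumes "abs_cont F" "\<epsilon> > 0"
  obtains \<delta> where "\<delta> > 0"
    "\<And>(M::nat) p q. (\<And>k. k < M \<Longrightarrow> p k \<le> q k) \<Longrightarrow> (\<Sum>k<M. q k - p k) < \<delta>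
        \<Longrightarrow> variation_on F (\<Union>k<M. {p k<..<q k}) \<le> ennreal \<epsilon>"
proof -
  from assms obtain \<delta> where d: "\<delta> > 0" "\<And>(N::nat) s t.
        (\<forall>k<N. s k \<le> t k) \<and> disjoint_family_on (\<lambda>k. {s k<..<t k}) {..<N} \<and>
        (\<Sum>k<N. t k - s k) < \<delta> \<Longrightarrow> (\<Sum>k<N. \<bar>F (t k) - F (s k)\<bar>) < \<epsilon>"
    unfolding abs_cont_def by meson
  show ?thesis
  proof (rule that[OF d(1)])
    fix M :: nat and p q
    assume pq: "\<And>k. k < M \<Longrightarrow> p k \<le> q k" "(\<Sum>k<M. q k - p k) < \<delta>"
    show "variation_on F (\<Union>k<M. {p k<..<q k}) \<le> ennreal \<epsilon>"
    proof (rule variation_on_least)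
      fix N s t assume f: "interval_family (\<Union>k<M. {p k<..<q k}) N s t"
      have "(\<Sum>k<N. t k - s k) < \<delta>"
        using interval_family_length_le[OF f pq(1)] pq(2) by simp
      then show "ennreal (\<Sum>k<N. \<bar>F (t k) - F (s k)\<bar>) \<le> ennreal \<epsilon>"
        using d(2)[of N s t] f by (intro ennreal_leI less_imp_le) (auto simp: interval_family_def)
    qed
  qed
qed

text \<open>Pieces of length \<open>\<delta> / 2\<close>, with the \<open>\<delta>\<close> that
  belongs to \<open>\<epsilon> = 1\<close>, have variation at most \<open>1\<close>, and finitely
  many of them cover the interval.\<close>

lemma abs_cont_variation_finite:
  assumes "abs_cont F"
  shows "variation_on F {p<..<q} < top"
proof -
  obtain \<delta> where d: "\<delta> > 0" "\<And>(M::nat) p q. (\<And>k. k < M \<Longrightarrow> p k \<le> q k) \<Longrightarrow> (\<Sum>k<M. q k - p k) < \<delta>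
        \<Longrightarrow> variation_on F (\<Union>k<M. {p k<..<q k}) \<le> ennreal 1"
    using abs_cont_variation_small[OF assms zero_less_one] by blast
  have step: "variation_on F {s<..<t} \<le> 1" if "s \<le> t" "t - s < \<delta>" for s t
    using d(2)[of "Suc 0" "\<lambda>_. s" "\<lambda>_. t"] that by (simp add: lessThan_Suc)
  have "variation_on F {p<..<p + n * (\<delta>/2)} \<le> of_nat n" for n :: nat
  proof (induction n)
    case 0
    have "interval_family {} N s t \<Longrightarrow> (\<Sum>k<N. \<bar>F (t k) - F (s k)\<bar>) = 0" for N s t
      by (intro sum.neutral) (auto simp: interval_family_def)
    then show ?case using variation_on_least[of "{}" F 0] by simp
  next
    case (Suc n)
    have "variation_on F {p + n * (\<delta>/2)<..<p + Suc n * (\<delta>/2)} \<le> 1"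
      by (rule step) (use d(1) in \<open>auto simp: field_simps\<close>)
    with Suc variation_on_split[of F p "p + Suc n * (\<delta>/2)" "p + n * (\<delta>/2)"]
    have "variation_on F {p<..<p + Suc n * (\<delta>/2)} \<le> of_nat n + 1"
      by (meson add_mono order_trans)
    then show ?case by (simp add: add.commute)
  qed
  moreover obtain n :: nat where "(q - p) / (\<delta>/2) < n" using reals_Archimedean2 by blast
  then have "q < p + n * (\<delta>/2)" using d(1) by (simp add: field_simps)
  then have "variation_on F {p<..<q} \<le> variation_on F {p<..<p + n * (\<delta>/2)}"
    by (intro variation_on_mono) auto
  ultimately have "variation_on F {p<..<q} \<le> of_nat n" by (meson order_trans)
  then show ?thesis using le_less_trans of_nat_less_top by blast
qed

text \<open>Prepares the Jordan decomposition, in which \<open>V\<close> and \<open>V - F\<close>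
  are nondecreasing and absolutely continuous. The variation is finite, so \<open>enn2real\<close>
  loses nothing.\<close>

lemma abs_cont_variation_function:
  fixes a :: real
  assumes "abs_cont F"
  defines "V \<equiv> (\<lambda>t. enn2real (variation_on F {a<..<t}))"
  shows "mono V" "abs_cont V" "\<And>s t. a \<le> s \<Longrightarrow> s \<le> t \<Longrightarrow> \<bar>F t - F s\<bar> \<le> V t - V s"
proof -
  have fin: "variation_on F {s<..<t} < top" for s t
    by (rule abs_cont_variation_finite[OF assms(1)])
  show m: "mono V"
    unfolding V_def by (intro monoI enn2real_mono variation_on_mono fin) auto
  show "\<bar>F t - F s\<bar> \<le> V t - V s" if "a \<le> s" "s \<le> t" for s t
  proof -
    have "ennreal (V s + \<bar>F t - F s\<bar>) \<le> variation_on F {a<..<s} + variation_on F {s<..<t}"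
      using abs_le_variation_on[OF that(2), of F] fin[of a s]
      by (simp add: V_def add_left_mono)
    also have "\<dots> \<le> variation_on F ({a<..<s} \<union> {s<..<t})"
      by (rule variation_on_superadd) auto
    also have "\<dots> \<le> variation_on F {a<..<t}"
      by (rule variation_on_mono) (use that in auto)
    also have "\<dots> = ennreal (V t)"
      using fin[of a t] by (simp add: V_def)
    finally show ?thesis
      by (subst (asm) ennreal_le_iff) (auto simp: V_def)
  qed
  have inc: "ennreal (V t - V s) \<le> variation_on F {s<..<t}" for s t
  proof -
    have "ennreal (V t) \<le> ennreal (V s) + variation_on F {s<..<t}"
      using variation_on_split[of F a t s] fin[of a s] fin[of a t] by (simp add: V_def)
    also have "\<dots> = ennreal (V s + enn2real (variation_on F {s<..<t}))"
      using fin[of s t] by (simp add: V_def)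
    finally have "V t - V s \<le> enn2real (variation_on F {s<..<t})"
      by (subst (asm) ennreal_le_iff) (auto simp: V_def)
    then show ?thesis
      using fin[of s t] by (metis ennreal_enn2real ennreal_leI)
  qed
  show "abs_cont V"
    unfolding abs_cont_def
  proof (intro allI impI)
    fix \<epsilon> :: real assume "\<epsilon> > 0"
    then have "\<epsilon>/2 > 0" by simp
    from abs_cont_variation_small[OF assms(1) this] obtain \<delta> where d: "\<delta> > 0"
      "\<And>(M::nat) p q. (\<And>k. k < M \<Longrightarrow> p k \<le> q k) \<Longrightarrow> (\<Sum>k<M. q k - p k) < \<delta>
        \<Longrightarrow> variation_on F (\<Union>k<M. {p k<..<q k}) \<le> ennreal (\<epsilon>/2)" by blast
    show "\<exists>\<delta>>0. \<forall>(N::nat) s t.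
        (\<forall>k<N. s k \<le> t k) \<and> disjoint_family_on (\<lambda>k. {s k<..<t k}) {..<N} \<and>
        (\<Sum>k<N. t k - s k) < \<delta> \<longrightarrow> (\<Sum>k<N. \<bar>V (t k) - V (s k)\<bar>) < \<epsilon>"
    proof (intro exI[of _ \<delta>] conjI allI impI d(1))
      fix N :: nat and s t
      assume *: "(\<forall>k<N. s k \<le> t k) \<and> disjoint_family_on (\<lambda>k. {s k<..<t k}) {..<N} \<and>
        (\<Sum>k<N. t k - s k) < \<delta>"
      have "ennreal (\<Sum>k<N. \<bar>V (t k) - V (s k)\<bar>) = (\<Sum>k<N. ennreal (V (t k) - V (s k)))"
        using * m by (subst sum_ennreal[symmetric]) (auto intro!: sum.cong simp: mono_def abs_of_nonneg)
      also have "\<dots> \<le> (\<Sum>k<N. variation_on F {s k<..<t k})"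
        by (intro sum_mono inc)
      also have "\<dots> \<le> variation_on F (\<Union>k<N. {s k<..<t k})"
        by (rule variation_on_UN_superadd) (use * in auto)
      also have "\<dots> \<le> ennreal (\<epsilon>/2)"
        by (rule d(2)) (use * in auto)
      finally show "(\<Sum>k<N. \<bar>V (t k) - V (s k)\<bar>) < \<epsilon>"
        using \<open>\<epsilon> > 0\<close> by (subst (asm) ennreal_le_iff) auto
    qed
  qed
qed

lemma abs_cont_diff:
  assumes "abs_cont F" "abs_cont G"
  shows "abs_cont (\<lambda>t. F t - G t)"
  unfolding abs_cont_def
proof (intro allI impI)
  fix \<epsilon> :: real assume "\<epsilon> > 0"
  then have e2: "\<epsilon>/2 > 0" by simp
  obtain d1 where d1: "d1 > 0" "\<And>(N::nat) s t.
        (\<forall>k<N. s k \<le> t k) \<and> disjoint_family_on (\<lambda>k. {s k<..<t k}) {..<N} \<and>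
        (\<Sum>k<N. t k - s k) < d1 \<Longrightarrow> (\<Sum>k<N. \<bar>F (t k) - F (s k)\<bar>) < \<epsilon>/2"
    using assms(1) e2 unfolding abs_cont_def by meson
  obtain d2 where d2: "d2 > 0" "\<And>(N::nat) s t.
        (\<forall>k<N. s k \<le> t k) \<and> disjoint_family_on (\<lambda>k. {s k<..<t k}) {..<N} \<and>
        (\<Sum>k<N. t k - s k) < d2 \<Longrightarrow> (\<Sum>k<N. \<bar>G (t k) - G (s k)\<bar>) < \<epsilon>/2"
    using assms(2) e2 unfolding abs_cont_def by meson
  show "\<exists>\<delta>>0. \<forall>(N::nat) s t.
        (\<forall>k<N. s k \<le> t k) \<and> disjoint_family_on (\<lambda>k. {s k<..<t k}) {..<N} \<and>
        (\<Sum>k<N. t k - s k) < \<delta> \<longrightarrow> (\<Sum>k<N. \<bar>(F (t k) - G (t k)) - (F (s k) - G (s k))\<bar>) < \<epsilon>"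
  proof (intro exI[of _ "min d1 d2"] conjI allI impI)
    fix N :: nat and s t
    assume *: "(\<forall>k<N. s k \<le> t k) \<and> disjoint_family_on (\<lambda>k. {s k<..<t k}) {..<N} \<and>
        (\<Sum>k<N. t k - s k) < min d1 d2"
    have "(\<Sum>k<N. \<bar>(F (t k) - G (t k)) - (F (s k) - G (s k))\<bar>)
       \<le> (\<Sum>k<N. \<bar>F (t k) - F (s k)\<bar> + \<bar>G (t k) - G (s k)\<bar>)"
      by (intro sum_mono) auto
    also have "\<dots> < \<epsilon>/2 + \<epsilon>/2"
      unfolding sum.distrib by (intro add_strict_mono d1(2) d2(2)) (use * in auto)
    finally show "(\<Sum>k<N. \<bar>(F (t k) - G (t k)) - (F (s k) - G (s k))\<bar>) < \<epsilon>" by simp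
  qed (use d1 d2 in auto)
qed

section \<open>Stieltjes measures of monotone absolutely continuous functions\<close>

lemma abs_cont_continuous:
  assumes "abs_cont F"
  shows "continuous_on UNIV F"
  unfolding continuous_on_iff
proof (intro ballI allI impI)
  fix x e :: real assume "e > 0"
  then obtain d where d: "d > 0" "\<And>(N::nat) s t.
        (\<forall>k<N. s k \<le> t k) \<and> disjoint_family_on (\<lambda>k. {s k<..<t k}) {..<N} \<and>
        (\<Sum>k<N. t k - s k) < d \<Longrightarrow> (\<Sum>k<N. \<bar>F (t k) - F (s k)\<bar>) < e"
    using assms unfolding abs_cont_def by meson
  have "\<bar>F y - F x\<bar> < e" if "\<bar>y - x\<bar> < d" for y
    using d(2)[of "Suc 0" "\<lambda>_. min x y" "\<lambda>_. max x y"] that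
    by (cases "x \<le> y") (auto simp: disjoint_family_on_def)
  then show "\<exists>d>0. \<forall>x'\<in>UNIV. dist x' x < d \<longrightarrow> dist (F x') (F x) < e"
    using d(1) by (auto simp: dist_real_def)
qed

text \<open>A gauge covering, as used for null sets below, yields a set of closed intervals with
  disjoint interiors; absolute continuity is recast in that shape.\<close>

lemma abs_cont_finite_sum:
  assumes "abs_cont F" "\<epsilon> > 0"
  obtains \<delta> where "\<delta> > 0"
    "\<And>\<K>. finite \<K> \<Longrightarrow> (\<And>K. K \<in> \<K> \<Longrightarrow> \<exists>c d. c \<le> d \<and> K = {c..d}) \<Longrightarrow>
       pairwise (\<lambda>A B. interior A \<inter> interior B = {}) \<K> \<Longrightarrow>
       (\<Sum>K\<in>\<K>. Sup K - Inf K) < \<delta> \<Longrightarrow> (\<Sum>K\<in>\<K>. \<bar>F (Sup K) - F (Inf K)\<bar>) < \<epsilon>"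
proof -
  obtain d where d: "d > 0" "\<And>(N::nat) s t.
        (\<forall>k<N. s k \<le> t k) \<and> disjoint_family_on (\<lambda>k. {s k<..<t k}) {..<N} \<and>
        (\<Sum>k<N. t k - s k) < d \<Longrightarrow> (\<Sum>k<N. \<bar>F (t k) - F (s k)\<bar>) < \<epsilon>"
    using assms unfolding abs_cont_def by meson
  show ?thesis
  proof (rule that[OF d(1)])
    fix \<K> :: "real set set"
    assume fin: "finite \<K>" and ivl: "\<And>K. K \<in> \<K> \<Longrightarrow> \<exists>c d. c \<le> d \<and> K = {c..d}"
      and pw: "pairwise (\<lambda>A B. interior A \<inter> interior B = {}) \<K>"
      and len: "(\<Sum>K\<in>\<K>. Sup K - Inf K) < d"
    from ex_bij_betw_nat_finite[OF fin] obtain h where h: "bij_betw h {..<card \<K>} \<K>"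
      by (auto simp: atLeast0LessThan)
    have int: "interior K = {Inf K<..<Sup K}" "Inf K \<le> Sup K" if "K \<in> \<K>" for K
      using ivl[OF that] by auto
    have "(\<Sum>k<card \<K>. \<bar>F (Sup (h k)) - F (Inf (h k))\<bar>) < \<epsilon>"
    proof (rule d(2), intro conjI allI impI)
      show "Inf (h k) \<le> Sup (h k)" if "k < card \<K>" for k
        by (rule int(2)) (use h that in \<open>auto simp: bij_betw_def\<close>)
      show "disjoint_family_on (\<lambda>k. {Inf (h k)<..<Sup (h k)}) {..<card \<K>}"
        unfolding disjoint_family_on_def
      proof (intro ballI impI)
        fix i j assume ij: "i \<in> {..<card \<K>}" "j \<in> {..<card \<K>}" "i \<noteq> j"
        then have "h i \<in> \<K>" "h j \<in> \<K>" "h i \<noteq> h j"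
          using h by (auto simp: bij_betw_def inj_on_def)
        with pw int show "{Inf (h i)<..<Sup (h i)} \<inter> {Inf (h j)<..<Sup (h j)} = {}"
          by (auto simp: pairwise_def)
      qed
      show "(\<Sum>k<card \<K>. Sup (h k) - Inf (h k)) < d"
        using len sum.reindex_bij_betw[OF h, of "\<lambda>K. Sup K - Inf K"] by simp
    qed
    then show "(\<Sum>K\<in>\<K>. \<bar>F (Sup K) - F (Inf K)\<bar>) < \<epsilon>"
      using sum.reindex_bij_betw[OF h, of "\<lambda>K. \<bar>F (Sup K) - F (Inf K)\<bar>"] by simp
  qed
qed

text \<open>An open \<open>U \<supseteq> N\<close> of Lebesgue measure below \<open>\<delta>\<close>
  contains countably many nonoverlapping closed intervals that cover \<open>N\<close>. Finitely many
  of them have \<open>G\<close>-mass at most \<open>\<epsilon>\<close> by absolute continuity, and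
  continuity from below passes to all of them.\<close>

lemma mono_abs_cont_interval_measure_null:
  assumes "mono G" "abs_cont G" and N: "N \<in> null_sets lborel" "N \<subseteq> {-c<..<c}"
  shows "emeasure (interval_measure G) N = 0"
proof -
  let ?\<mu> = "interval_measure G"
  have cont: "continuous_on UNIV G" by (rule abs_cont_continuous[OF assms(2)])
  have Icc: "emeasure ?\<mu> {p..q} = ennreal (G q - G p)" if "p \<le> q" for p q
    by (rule emeasure_interval_measure_Icc[OF that])
       (use assms(1) cont in \<open>auto simp: mono_def intro: continuous_on_subset\<close>)
  have "emeasure ?\<mu> N \<le> ennreal \<epsilon>" if "\<epsilon> > 0" for \<epsilon>
  proof (cases "N = {}")
    case False
    then have c: "c > 0" using N(2) by force
    from abs_cont_finite_sum[OF assms(2) that] obtain \<delta> where d: "\<delta> > 0"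
      "\<And>\<K>. finite \<K> \<Longrightarrow> (\<And>K. K \<in> \<K> \<Longrightarrow> \<exists>c d. c \<le> d \<and> K = {c..d}) \<Longrightarrow>
       pairwise (\<lambda>A B. interior A \<inter> interior B = {}) \<K> \<Longrightarrow>
       (\<Sum>K\<in>\<K>. Sup K - Inf K) < \<delta> \<Longrightarrow> (\<Sum>K\<in>\<K>. \<bar>G (Sup K) - G (Inf K)\<bar>) < \<epsilon>" by blast
    have "N \<in> sets borel" using N(1) by auto
    from outer_regular_lborel[OF this d(1)] obtain U where
      U: "open U" "N \<subseteq> U" "emeasure lborel (U - N) < \<delta>" by blast
    have "emeasure lborel U \<le> emeasure lborel N + emeasure lborel (U - N)"
      using U(2) N(1) U(1) emeasure_subadditive[of N lborel "U - N"]
      by (metis Un_Diff_cancel Un_absorb1 \<open>N \<in> sets borel\<close> borel_open sets.Diff sets_lborel)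
    then have U\<delta>: "emeasure lborel U < \<delta>"
      using N(1) U(3) by (auto simp: null_sets_def)
    \<comment> \<open>The gauge forces every covering interval into \<open>U\<close>, because the
      interval lies in the gauge set of one of its points in \<open>N\<close>.\<close>
    define g where "g = (\<lambda>x. if x \<in> U then U else (UNIV :: real set))"
    have "gauge g" using U(1) by (auto simp: gauge_def g_def)
    have "N \<subseteq> cbox (-c) c" "box (-c) c \<noteq> {}"
      using N(2) c by (auto simp: box_real)
    from this obtain \<D> where D: "countable \<D>" "\<Union>\<D> \<subseteq> cbox (-c) c"
      "\<And>K. K \<in> \<D> \<Longrightarrow> interior K \<noteq> {} \<and> (\<exists>c d. K = cbox c d)"
      "pairwise (\<lambda>A B. interior A \<inter> interior B = {}) \<D>"
      "\<And>K. K \<in> \<D> \<Longrightarrow> \<exists>x \<in> N \<inter> K. K \<subseteq> g x"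
      "\<And>u v. cbox u v \<in> \<D> \<Longrightarrow> \<exists>n. \<forall>i \<in> Basis. v \<bullet> i - u \<bullet> i = (c \<bullet> i - (-c) \<bullet> i) / 2^n"
      "N \<subseteq> \<Union>\<D>"
      by (rule covering_lemma[OF _ _ \<open>gauge g\<close>]) (rule that)
    have DU: "K \<subseteq> U" if K: "K \<in> \<D>" for K
    proof -
      obtain x where "x \<in> N" "K \<subseteq> g x" using D(5)[OF K] by blast
      moreover have "x \<in> U" using U(2) \<open>x \<in> N\<close> by blast
      ultimately show ?thesis by (simp add: g_def)
    qed
    have DI: "\<exists>c d. c \<le> d \<and> K = {c..d}" if K: "K \<in> \<D>" for K
    proof -
      obtain c d where "K = {c..d}" "interior K \<noteq> {}" using D(3)[OF K] by (auto simp: cbox_interval)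
      then show ?thesis by (intro exI[of _ c] exI[of _ d]) auto
    qed
    have "\<D> \<noteq> {}" using False D(7) by auto
    \<comment> \<open>\<open>from_nat_into\<close> enumerates finite and infinite countable sets
      alike, with repetitions in the finite case, so one increasing exhaustion serves both.\<close>
    define E where "E = (\<lambda>n::nat. from_nat_into \<D> ` {..n})"
    have E: "finite (E n)" "E n \<subseteq> \<D>" for n
      using from_nat_into[OF \<open>\<D> \<noteq> {}\<close>] by (auto simp: E_def)
    have UE: "(\<Union>n. \<Union>(E n)) = \<Union>\<D>"
    proof -
      have "(\<Union>n. E n) = range (from_nat_into \<D>)" by (auto simp: E_def)
      also have "\<dots> = \<D>" using \<open>\<D> \<noteq> {}\<close> D(1) by (rule range_from_nat_into)
      finally have "(\<Union>n. E n) = \<D>" .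
      moreover have "(\<Union>n. \<Union>(E n)) = \<Union>(\<Union>n. E n)" by blast
      ultimately show ?thesis by simp
    qed
    have Em: "emeasure ?\<mu> (\<Union>(E n)) \<le> ennreal \<epsilon>" for n
    proof -
      have EI: "\<exists>c d. c \<le> d \<and> K = {c..d}" if "K \<in> E n" for K
        using DI E(2) that by blast
      have pw: "pairwise (\<lambda>A B. interior A \<inter> interior B = {}) (E n)"
        using D(4) E(2) by (rule pairwise_subset)
      have KI: "K = {Inf K..Sup K}" "Inf K \<le> Sup K" if "K \<in> E n" for K
        using EI[OF that] by auto
      have "ennreal (\<Sum>K\<in>E n. Sup K - Inf K) = (\<Sum>K\<in>E n. emeasure lborel (interior K))"
      proof (subst sum_ennreal[symmetric])
        show "(\<Sum>K\<in>E n. ennreal (Sup K - Inf K)) = (\<Sum>K\<in>E n. emeasure lborel (interior K))"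
        proof (rule sum.cong[OF refl])
          fix K assume "K \<in> E n"
          from EI[OF this] obtain c d where "c \<le> d" "K = {c..d}" by blast
          then show "ennreal (Sup K - Inf K) = emeasure lborel (interior K)" by simp
        qed
      qed (use KI(2) in auto)
      also have "\<dots> = emeasure lborel (\<Union>K\<in>E n. interior K)"
        by (rule sum_emeasure) (use pw E(1) in \<open>auto simp: disjoint_family_on_def pairwise_def\<close>)
      also have "\<dots> \<le> emeasure lborel U"
      proof (rule emeasure_mono)
        show "(\<Union>K\<in>E n. interior K) \<subseteq> U"
        proof (rule UN_least)
          fix K assume "K \<in> E n"
          then have "K \<subseteq> U" using DU E(2)[of n] by blast
          then show "interior K \<subseteq> U" using interior_subset[of K] by simp
        qed
      qed (use U(1) in auto)
      also have "\<dots> < \<delta>" by (rule U\<delta>)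
      finally have "(\<Sum>K\<in>E n. Sup K - Inf K) < \<delta>"
        by (subst (asm) ennreal_less_iff) (use KI(2) in \<open>auto intro!: sum_nonneg\<close>)
      then have lt: "(\<Sum>K\<in>E n. \<bar>G (Sup K) - G (Inf K)\<bar>) < \<epsilon>"
        using d(2)[OF E(1) EI pw] by blast
      have "emeasure ?\<mu> (\<Union>(E n)) \<le> (\<Sum>K\<in>E n. emeasure ?\<mu> K)"
      proof -
        have "(\<lambda>K. K) ` E n \<subseteq> sets ?\<mu>"
        proof
          fix K assume "K \<in> (\<lambda>K. K) ` E n"
          with EI[of K] obtain c d where "K = {c..d}" by auto
          then show "K \<in> sets ?\<mu>" by simp
        qed
        from emeasure_subadditive_finite[OF E(1) this] show ?thesis by simp
      qed
      also have "\<dots> = (\<Sum>K\<in>E n. ennreal \<bar>G (Sup K) - G (Inf K)\<bar>)"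
      proof (rule sum.cong[OF refl])
        fix K assume "K \<in> E n"
        from EI[OF this] obtain c d where "c \<le> d" "K = {c..d}" by blast
        then show "emeasure ?\<mu> K = ennreal \<bar>G (Sup K) - G (Inf K)\<bar>"
          using Icc[of c d] monoD[OF assms(1), of c d] by simp
      qed
      also have "\<dots> = ennreal (\<Sum>K\<in>E n. \<bar>G (Sup K) - G (Inf K)\<bar>)"
        by (rule sum_ennreal) auto
      also have "\<dots> \<le> ennreal \<epsilon>" using lt by (intro ennreal_leI) auto
      finally show ?thesis .
    qed
    have meas: "\<Union>(E n) \<in> sets ?\<mu>" for n
    proof (rule sets.finite_Union[OF E(1)])
      show "E n \<subseteq> sets ?\<mu>"
      proof
        fix K assume "K \<in> E n"
        with DI[of K] E(2)[of n] obtain c d where "K = {c..d}" by auto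
        then show "K \<in> sets ?\<mu>" by simp
      qed
    qed
    have "emeasure ?\<mu> (\<Union>\<D>) = (SUP n. emeasure ?\<mu> (\<Union>(E n)))"
      unfolding UE[symmetric]
    proof (rule SUP_emeasure_incseq[symmetric])
      show "range (\<lambda>n. \<Union>(E n)) \<subseteq> sets ?\<mu>" using meas by blast
      have "E m \<subseteq> E n" if "m \<le> n" for m n using that by (auto simp: E_def)
      then show "incseq (\<lambda>n. \<Union>(E n))" unfolding incseq_def by (blast intro: Union_mono)
    qed
    also have "\<dots> \<le> ennreal \<epsilon>" by (rule SUP_least) (rule Em)
    finally have "emeasure ?\<mu> (\<Union>\<D>) \<le> ennreal \<epsilon>" .
    moreover have "emeasure ?\<mu> N \<le> emeasure ?\<mu> (\<Union>\<D>)"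
    proof (rule emeasure_mono[OF D(7)])
      show "\<Union>\<D> \<in> sets ?\<mu>" unfolding UE[symmetric] by (rule sets.countable_UN) (use meas in blast)
    qed
    ultimately show ?thesis by (rule order_trans[rotated])
  qed simp
  then have "emeasure ?\<mu> N \<le> 0 + ennreal \<epsilon>" if "\<epsilon> > 0" for \<epsilon>
    using that by simp
  then have "emeasure ?\<mu> N \<le> 0" by (rule ennreal_le_epsilon)
  then show ?thesis by simp
qed

lemma mono_abs_cont_absolutely_continuous:
  assumes "mono G" "abs_cont G"
  shows "absolutely_continuous lborel (interval_measure G)"
  unfolding absolutely_continuous_def
proof
  fix N :: "real set" assume N: "N \<in> null_sets lborel"
  have "N \<inter> {-real n<..<real n} \<in> null_sets (interval_measure G)" for n
  proof (rule null_setsI)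
    have *: "N \<inter> {-real n<..<real n} \<in> null_sets lborel"
      by (rule null_set_Int2[OF N]) auto
    then show "N \<inter> {-real n<..<real n} \<in> sets (interval_measure G)" by auto
    show "emeasure (interval_measure G) (N \<inter> {-real n<..<real n}) = 0"
      by (rule mono_abs_cont_interval_measure_null[OF assms *]) auto
  qed
  then have "(\<Union>n. N \<inter> {-real n<..<real n}) \<in> null_sets (interval_measure G)"
    by (rule null_sets_UN)
  moreover have "(\<Union>n. N \<inter> {-real n<..<real n}) = N"
  proof (intro equalityI subsetI)
    fix x assume "x \<in> N"
    moreover obtain n where "\<bar>x\<bar> < real n" using reals_Archimedean2 by blast
    ultimately show "x \<in> (\<Union>n. N \<inter> {-real n<..<real n})" by (intro UN_I[of n]) auto
  qed auto
  ultimately show "N \<in> null_sets (interval_measure G)" by simp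
qed

text \<open>The integrand is the Radon-Nikodym density of the Stieltjes measure of \<open>G\<close>.
  The mass of \<open>{a..b}\<close> is finite, so the density is finite almost everywhere there and
  \<open>enn2real\<close> changes it on a null set only.\<close>

lemma mono_abs_cont_integral:
  assumes "mono G" "abs_cont G" "a \<le> b"
  obtains h where "h absolutely_integrable_on {a..b}"
    "\<And>t. t \<in> {a..b} \<Longrightarrow> (h has_integral (G t - G a)) {a..t}"
proof -
  let ?\<mu> = "interval_measure G"
  have cont: "continuous_on UNIV G" by (rule abs_cont_continuous[OF assms(2)])
  have Icc: "emeasure ?\<mu> {p..q} = ennreal (G q - G p)" if "p \<le> q" for p q
    by (rule emeasure_interval_measure_Icc[OF that])
       (use assms(1) cont in \<open>auto simp: mono_def intro: continuous_on_subset\<close>)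
  from sigma_finite_measure.Radon_Nikodym[OF sigma_finite_lborel mono_abs_cont_absolutely_continuous[OF assms(1,2)]]
  obtain f where f: "f \<in> borel_measurable lborel" "density lborel f = ?\<mu>" by auto
  have fi: "(\<integral>\<^sup>+x. f x * indicator {a..t} x \<partial>lborel) = ennreal (G t - G a)" if "a \<le> t" for t
    using emeasure_density[OF f(1), of "{a..t}"] Icc[OF that] f(2) by simp
  have fin: "AE x in lborel. f x * indicator {a..b} x \<noteq> \<infinity>"
    by (rule nn_integral_PInf_AE) (use f(1) fi[OF assms(3)] in auto)
  define h where "h = (\<lambda>x. enn2real (f x))"
  have hm: "h \<in> borel_measurable borel" using f(1) by (simp add: h_def)
  have hi: "(h has_integral (G t - G a)) {a..t}" if t: "t \<in> {a..b}" for t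
  proof -
    have "(\<integral>\<^sup>+x. ennreal (h x * indicator {a..t} x) \<partial>lborel) = (\<integral>\<^sup>+x. f x * indicator {a..t} x \<partial>lborel)"
    proof (rule nn_integral_cong_AE)
      show "AE x in lborel. ennreal (h x * indicator {a..t} x) = f x * indicator {a..t} x"
        using fin by eventually_elim (use t in \<open>auto simp: h_def indicator_def less_top\<close>)
    qed
    then have "(\<integral>\<^sup>+x. ennreal (h x * indicator {a..t} x) \<partial>lborel) = ennreal (G t - G a)"
      using fi t by simp
    from nn_integral_has_integral[OF _ _ this]
    have "((\<lambda>x. h x * indicator {a..t} x) has_integral (G t - G a)) UNIV"
      using hm t monoD[OF assms(1), of a t] by (auto simp: h_def)
    moreover have "(\<lambda>x. h x * indicator {a..t} x) = (\<lambda>x. if x \<in> {a..t} then h x else 0)"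
      by (auto simp: indicator_def)
    ultimately show ?thesis by (simp only: has_integral_restrict_UNIV)
  qed
  have "h absolutely_integrable_on {a..b}"
    by (rule nonnegative_absolutely_integrable_1)
       (use hi[of b] assms(3) in \<open>auto simp: h_def has_integral_integrable_integral\<close>)
  with hi show ?thesis using that by blast
qed

text \<open>\<open>integrable_ccontinuous_explicit\<close> treats difference quotients to the right
  only. Those to the left come from applying it to the reflected integrand; \<open>h0\<close>
  extends \<open>h\<close> by zero so that both applications make sense on the whole line.\<close>

lemma indefinite_integral_AE_derivative:
  fixes h :: "real \<Rightarrow> 'a::euclidean_space"
  assumes h: "h integrable_on {a..b}"
  obtains N where "negligible N"
    "\<And>t. t \<in> {a<..<b} - N \<Longrightarrow> ((\<lambda>t. integral {a..t} h) has_vector_derivative h t) (at t)"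
proof -
  define h0 where "h0 = (\<lambda>x. if x \<in> {a..b} then h x else 0)"
  have "h0 integrable_on UNIV"
    using h unfolding h0_def by (simp only: integrable_restrict_UNIV)
  then have int: "h0 integrable_on cbox c d" for c d
    by (rule integrable_on_subcbox) auto
  then have int': "(\<lambda>x. h0 (- x)) integrable_on cbox c d" for c d
    using integrable_reflect[where f=h0 and a="-d" and b="-c"] by (simp del: cbox_interval)
  obtain N1 where N1: "negligible N1" "\<And>x e. \<lbrakk>x \<notin> N1; 0 < e\<rbrakk> \<Longrightarrow>
      \<exists>d>0. \<forall>k. 0 < k \<and> k < d \<longrightarrow> norm (integral (cbox x (x + k *\<^sub>R One)) h0 /\<^sub>R k ^ DIM(real) - h0 x) < e"
    using integrable_ccontinuous_explicit[of h0] int by blast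
  obtain N2 where N2: "negligible N2" "\<And>x e. \<lbrakk>x \<notin> N2; 0 < e\<rbrakk> \<Longrightarrow>
      \<exists>d>0. \<forall>k. 0 < k \<and> k < d \<longrightarrow> norm (integral (cbox x (x + k *\<^sub>R One)) (\<lambda>x. h0 (- x)) /\<^sub>R k ^ DIM(real) - h0 (- x)) < e"
    using integrable_ccontinuous_explicit[of "\<lambda>x. h0 (- x)"] int' by blast
  have neg: "negligible (N1 \<union> uminus ` N2)"
  proof (rule negligible_Un[OF N1(1)])
    show "negligible (uminus ` N2)"
      by (rule negligible_differentiable_image_negligible[OF _ N2(1)])
         (auto intro!: linear_imp_differentiable_on linear_uminus)
  qed
  show ?thesis
  proof (rule that[OF neg])
    fix t assume t: "t \<in> {a<..<b} - (N1 \<union> uminus ` N2)"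
    have "h0 t = h t" using t by (simp add: h0_def)
    have tN: "t \<notin> N1" "- t \<notin> N2" using t by (auto simp: image_iff)
    have comb: "integral {a..v} h - integral {a..u} h = integral {u..v} h0" if "a \<le> u" "u \<le> v" "v \<le> b" for u v
    proof -
      have "h integrable_on {a..v}"
        by (rule integrable_on_subinterval[OF h]) (use that in auto)
      from Henstock_Kurzweil_Integration.integral_combine[OF that(1,2) this]
      have "integral {a..v} h - integral {a..u} h = integral {u..v} h" by (simp add: algebra_simps)
      also have "\<dots> = integral {u..v} h0"
        by (rule Henstock_Kurzweil_Integration.integral_cong) (use that in \<open>auto simp: h0_def\<close>)
      finally show ?thesis .
    qed
    show "((\<lambda>t. integral {a..t} h) has_vector_derivative h t) (at t)"
      unfolding has_vector_derivative_def has_derivative_at_alt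
    proof (intro conjI allI impI)
      show "bounded_linear (\<lambda>x. x *\<^sub>R h t)" by (rule bounded_linear_scaleR_left)
      fix e :: real assume "e > 0"
      obtain d1 where d1: "d1 > 0" "\<And>k. 0 < k \<Longrightarrow> k < d1 \<Longrightarrow> norm (integral {t..t + k} h0 /\<^sub>R k - h t) < e"
        using N1(2)[OF tN(1) \<open>e > 0\<close>] \<open>h0 t = h t\<close> by auto
      obtain d2 where d2: "d2 > 0" "\<And>k. 0 < k \<Longrightarrow> k < d2 \<Longrightarrow> norm (integral {- t..- t + k} (\<lambda>x. h0 (- x)) /\<^sub>R k - h t) < e"
        using N2(2)[OF tN(2) \<open>e > 0\<close>] \<open>h0 t = h t\<close> by auto
      have scale: "norm (v - k *\<^sub>R h t) \<le> e * k" if "norm (v /\<^sub>R k - h t) < e" "k > 0" for v k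
      proof -
        have "v - k *\<^sub>R h t = k *\<^sub>R (v /\<^sub>R k - h t)" using that(2) by (simp add: scaleR_diff_right)
        then show ?thesis using that by (simp add: mult.commute mult_left_mono)
      qed
      define d where "d = Min {d1, d2, t - a, b - t}"
      have d: "d > 0" "d \<le> d1" "d \<le> d2" "d \<le> t - a" "d \<le> b - t"
        using t d1(1) d2(1) by (auto simp: d_def)
      show "\<exists>d>0. \<forall>y. norm (y - t) < d \<longrightarrow>
          norm (integral {a..y} h - integral {a..t} h - (y - t) *\<^sub>R h t) \<le> e * norm (y - t)"
      proof (intro exI[of _ d] conjI allI impI d(1))
        fix y assume y: "norm (y - t) < d"
        consider "y = t" | "y > t" | "y < t" by linarith
        then show "norm (integral {a..y} h - integral {a..t} h - (y - t) *\<^sub>R h t) \<le> e * norm (y - t)"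
        proof cases
          case 2
          have "norm (integral {t..t + (y - t)} h0 /\<^sub>R (y - t) - h t) < e"
            by (rule d1(2)) (use 2 y d in auto)
          from scale[OF this] 2 comb[of t y] y d t show ?thesis by auto
        next
          case 3
          have "norm (integral {- t..- t + (t - y)} (\<lambda>x. h0 (- x)) /\<^sub>R (t - y) - h t) < e"
            by (rule d2(2)) (use 3 y d in auto)
          moreover have "integral {- t..- t + (t - y)} (\<lambda>x. h0 (- x)) = integral {y..t} h0"
            using Henstock_Kurzweil_Integration.integral_reflect_real[where f=h0 and a=y and b=t] by simp
          ultimately have "norm (integral {y..t} h0 - (t - y) *\<^sub>R h t) \<le> e * (t - y)"
            using scale 3 by simp
          moreover have "integral {a..t} h - integral {a..y} h = integral {y..t} h0"
            by (rule comb) (use 3 y d t in auto)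
          then have "integral {a..y} h - integral {a..t} h - (y - t) *\<^sub>R h t = - (integral {y..t} h0 - (t - y) *\<^sub>R h t)"
            by (simp add: algebra_simps)
          ultimately show ?thesis using 3 by (simp only: norm_minus_cancel) simp
        qed simp
      qed
    qed
  qed
qed

section \<open>Absolutely continuous curves in Euclidean space\<close>

lemma abs_cont_on_component:
  fixes \<sigma> :: "real \<Rightarrow> 'a::euclidean_space"
  assumes "abs_cont_on a b \<sigma>" "a \<le> b" "i \<in> Basis"
  shows "abs_cont (\<lambda>t. \<sigma> (max a (min b t)) \<bullet> i)"
  unfolding abs_cont_def
proof (intro allI impI)
  fix \<epsilon> :: real assume "\<epsilon> > 0"
  with assms(1) obtain \<delta> where d: "\<delta> > 0" "\<And>(N::nat) s t.
        (\<forall>k<N. a \<le> s k \<and> s k \<le> t k \<and> t k \<le> b) \<and>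
        disjoint_family_on (\<lambda>k. {s k<..<t k}) {..<N} \<and> (\<Sum>k<N. t k - s k) < \<delta>
        \<Longrightarrow> (\<Sum>k<N. norm (\<sigma> (t k) - \<sigma> (s k))) < \<epsilon>"
    unfolding abs_cont_on_def by meson
  show "\<exists>\<delta>>0. \<forall>(N::nat) s t.
        (\<forall>k<N. s k \<le> t k) \<and> disjoint_family_on (\<lambda>k. {s k<..<t k}) {..<N} \<and>
        (\<Sum>k<N. t k - s k) < \<delta> \<longrightarrow> (\<Sum>k<N. \<bar>\<sigma> (max a (min b (t k))) \<bullet> i - \<sigma> (max a (min b (s k))) \<bullet> i\<bar>) < \<epsilon>"
  proof (intro exI[of _ \<delta>] conjI allI impI d(1))
    fix N :: nat and s t
    assume *: "(\<forall>k<N. s k \<le> t k) \<and> disjoint_family_on (\<lambda>k. {s k<..<t k}) {..<N} \<and>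
        (\<Sum>k<N. t k - s k) < \<delta>"
    \<comment> \<open>Clamping the parameter extends the curve by constants to the whole line. It
      keeps disjoint intervals disjoint and lengthens none of them.\<close>
    let ?c = "\<lambda>x. max a (min b x)"
    have sub: "{?c u<..<?c v} \<subseteq> {u<..<v}" for u v by auto
    have "disjoint_family_on (\<lambda>k. {?c (s k)<..<?c (t k)}) {..<N}"
    proof (rule disjoint_family_on_bisimulation)
      show "disjoint_family_on (\<lambda>k. {s k<..<t k}) {..<N}" using * by auto
      fix m n assume "{s m<..<t m} \<inter> {s n<..<t n} = {}"
      then show "{?c (s m)<..<?c (t m)} \<inter> {?c (s n)<..<?c (t n)} = {}"
        using sub by blast
    qed
    moreover have "(\<Sum>k<N. ?c (t k) - ?c (s k)) \<le> (\<Sum>k<N. t k - s k)"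
      by (intro sum_mono) (use * in \<open>auto simp: min_def max_def\<close>)
    ultimately have "(\<Sum>k<N. norm (\<sigma> (?c (t k)) - \<sigma> (?c (s k)))) < \<epsilon>"
      using * assms(2) by (intro d(2)) (auto simp: min_def max_def)
    moreover have "(\<Sum>k<N. \<bar>\<sigma> (?c (t k)) \<bullet> i - \<sigma> (?c (s k)) \<bullet> i\<bar>) \<le> (\<Sum>k<N. norm (\<sigma> (?c (t k)) - \<sigma> (?c (s k))))"
      by (intro sum_mono) (metis assms(3) Basis_le_norm inner_diff_left)
    ultimately show "(\<Sum>k<N. \<bar>\<sigma> (?c (t k)) \<bullet> i - \<sigma> (?c (s k)) \<bullet> i\<bar>) < \<epsilon>" by linarith
  qed
qed

text \<open>Jordan decomposition \<open>F = V - (V - F)\<close> with \<open>V\<close> the variation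
  over \<open>{a<..<t}\<close>. Both \<open>F\<close> and \<open>V\<close> are constant to the left
  of \<open>a\<close>, which makes \<open>V - F\<close> monotone on the whole line, as
  \<open>mono_abs_cont_integral\<close> requires.\<close>

lemma abs_cont_integral:
  assumes "abs_cont F" "a \<le> b" "\<And>t. t \<le> a \<Longrightarrow> F t = F a"
  obtains h where "h absolutely_integrable_on {a..b}"
    "\<And>t. t \<in> {a..b} \<Longrightarrow> (h has_integral (F t - F a)) {a..t}"
proof -
  define V where "V = (\<lambda>t. enn2real (variation_on F {a<..<t}))"
  have V: "mono V" "abs_cont V" "\<And>s t. a \<le> s \<Longrightarrow> s \<le> t \<Longrightarrow> \<bar>F t - F s\<bar> \<le> V t - V s"
    unfolding V_def by (rule abs_cont_variation_function[OF assms(1)]; assumption)+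
  have Va: "V t = V a" if "t \<le> a" for t using that by (simp add: V_def)
  have "mono (\<lambda>t. V t - F t)"
  proof (rule monoI)
    fix s t :: real assume "s \<le> t"
    have "V s = V (max s a)" "F s = F (max s a)" "V t = V (max t a)" "F t = F (max t a)"
      using Va[of s] Va[of t] assms(3)[of s] assms(3)[of t] by (simp_all add: max_def)
    moreover have "\<bar>F (max t a) - F (max s a)\<bar> \<le> V (max t a) - V (max s a)"
      by (rule V(3)) (use \<open>s \<le> t\<close> in auto)
    ultimately show "V s - F s \<le> V t - F t" by linarith
  qed
  from mono_abs_cont_integral[OF this abs_cont_diff[OF V(2) assms(1)] assms(2)]
  obtain h2 where h2: "h2 absolutely_integrable_on {a..b}"
    "\<And>t. t \<in> {a..b} \<Longrightarrow> (h2 has_integral (V t - F t - (V a - F a))) {a..t}" by blast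
  from mono_abs_cont_integral[OF V(1,2) assms(2)]
  obtain h1 where h1: "h1 absolutely_integrable_on {a..b}"
    "\<And>t. t \<in> {a..b} \<Longrightarrow> (h1 has_integral (V t - V a)) {a..t}" by blast
  show ?thesis
  proof (rule that[of "\<lambda>x. h1 x - h2 x"])
    show "(\<lambda>x. h1 x - h2 x) absolutely_integrable_on {a..b}"
      using h1(1) h2(1) by (rule set_integral_diff)
    show "((\<lambda>x. h1 x - h2 x) has_integral (F t - F a)) {a..t}" if "t \<in> {a..b}" for t
      using has_integral_diff[OF h1(2)[OF that] h2(2)[OF that]] by (simp add: algebra_simps)
  qed
qed

theorem abs_cont_on_integral:
  fixes \<sigma> :: "real \<Rightarrow> 'a::euclidean_space"
  assumes "abs_cont_on a b \<sigma>" "a \<le> b"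
  obtains h N where "h absolutely_integrable_on {a..b}" "negligible N"
    "\<And>t. t \<in> {a..b} \<Longrightarrow> (h has_integral (\<sigma> t - \<sigma> a)) {a..t}"
    "\<And>t. t \<in> {a..b} - N \<Longrightarrow> (\<sigma> has_vector_derivative h t) (at t)"
proof -
  have "\<exists>h. h absolutely_integrable_on {a..b} \<and> (\<forall>t\<in>{a..b}. (h has_integral (\<sigma> t \<bullet> i - \<sigma> a \<bullet> i)) {a..t})"
    if i: "i \<in> Basis" for i
  proof -
    have A: "abs_cont (\<lambda>t. \<sigma> (max a (min b t)) \<bullet> i)" by (rule abs_cont_on_component[OF assms i])
    have B: "\<sigma> (max a (min b t)) \<bullet> i = \<sigma> (max a (min b a)) \<bullet> i" if "t \<le> a" for t
      using that assms(2) by simp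
    from abs_cont_integral[OF A assms(2) B] obtain h where "h absolutely_integrable_on {a..b}"
      "\<And>t. t \<in> {a..b} \<Longrightarrow> (h has_integral (\<sigma> (max a (min b t)) \<bullet> i - \<sigma> (max a (min b a)) \<bullet> i)) {a..t}"
      by blast
    moreover have "max a (min b t) = t" if "t \<in> {a..b}" for t using that by auto
    ultimately show ?thesis using assms(2) by (intro exI[of _ h]) auto
  qed
  then have "\<forall>i\<in>Basis. \<exists>h. h absolutely_integrable_on {a..b} \<and> (\<forall>t\<in>{a..b}. (h has_integral (\<sigma> t \<bullet> i - \<sigma> a \<bullet> i)) {a..t})"
    by blast
  then obtain H where "\<forall>i\<in>Basis. H i absolutely_integrable_on {a..b} \<and> (\<forall>t\<in>{a..b}. (H i has_integral (\<sigma> t \<bullet> i - \<sigma> a \<bullet> i)) {a..t})"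
    by (rule bchoice[THEN exE])
  then have H: "\<And>i. i \<in> Basis \<Longrightarrow> H i absolutely_integrable_on {a..b}"
    "\<And>i t. i \<in> Basis \<Longrightarrow> t \<in> {a..b} \<Longrightarrow> (H i has_integral (\<sigma> t \<bullet> i - \<sigma> a \<bullet> i)) {a..t}"
    by blast+
  define h where "h = (\<lambda>x. \<Sum>i\<in>Basis. H i x *\<^sub>R i)"
  have 1: "h absolutely_integrable_on {a..b}"
    unfolding h_def
  proof (rule absolutely_integrable_sum)
    fix i :: 'a assume "i \<in> Basis"
    from absolutely_integrable_linear[OF H(1)[OF this] bounded_linear_scaleR_left[of i]]
    show "(\<lambda>x. H i x *\<^sub>R i) absolutely_integrable_on {a..b}" by (simp add: o_def)
  qed simp
  have 2: "(h has_integral (\<sigma> t - \<sigma> a)) {a..t}" if "t \<in> {a..b}" for t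
  proof -
    have "(h has_integral (\<Sum>i\<in>Basis. (\<sigma> t \<bullet> i - \<sigma> a \<bullet> i) *\<^sub>R i)) {a..t}"
      unfolding h_def by (intro has_integral_sum has_integral_scaleR_left H(2) that) auto
    also have "(\<Sum>i\<in>Basis. (\<sigma> t \<bullet> i - \<sigma> a \<bullet> i) *\<^sub>R i) = \<sigma> t - \<sigma> a"
      by (simp add: euclidean_representation flip: inner_diff_left)
    finally show ?thesis .
  qed
  have "h integrable_on {a..b}" using 1 by (rule set_lebesgue_integral_eq_integral(1))
  from indefinite_integral_AE_derivative[OF this] obtain N where N: "negligible N"
    "\<And>t. t \<in> {a<..<b} - N \<Longrightarrow> ((\<lambda>t. integral {a..t} h) has_vector_derivative h t) (at t)" by blast
  show ?thesis
  \<comment> \<open>The endpoints join the exceptional set: the derivative in question is two-sided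
    and the curve is arbitrary outside \<open>{a..b}\<close>.\<close>
  proof (rule that[OF 1 _ 2, of "N \<union> {a, b}"])
    show "negligible (N \<union> {a, b})" using N(1) by (simp add: negligible_Un)
    fix t assume t: "t \<in> {a..b} - (N \<union> {a, b})"
    have "((\<lambda>t. \<sigma> a + integral {a..t} h) has_vector_derivative (0 + h t)) (at t)"
      by (intro has_vector_derivative_add has_vector_derivative_const N(2)) (use t in auto)
    then have "((\<lambda>t. \<sigma> a + integral {a..t} h) has_vector_derivative h t) (at t)" by simp
    then show "(\<sigma> has_vector_derivative h t) (at t)"
    proof (rule has_vector_derivative_transform_within_open)
      show "open {a<..<b}" "t \<in> {a<..<b}" using t by auto
      show "\<sigma> a + integral {a..x} h = \<sigma> x" if "x \<in> {a<..<b}" for x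
        using 2[of x] that by (auto dest: integral_unique)
    qed
  qed
qed

text \<open>The form in which absolute continuity enters later: an increment is bounded by an
  integral whose integrand can be compared pointwise with the Kobayashi metric.\<close>

theorem abs_cont_on_norm_le_nn_integral:
  fixes \<sigma> :: "real \<Rightarrow> 'a::euclidean_space"
  assumes "abs_cont_on a b \<sigma>" "a \<le> b"
  obtains N where "negligible N" "\<And>t. t \<in> {a..b} - N \<Longrightarrow> \<sigma> differentiable at t"
    "ennreal (norm (\<sigma> b - \<sigma> a)) \<le> (\<integral>\<^sup>+t\<in>{a..b}. ennreal (norm (vector_derivative \<sigma> (at t))) \<partial>lebesgue)"
proof -
  from abs_cont_on_integral[OF assms] obtain h N where h: "h absolutely_integrable_on {a..b}"
    "negligible N" "\<And>t. t \<in> {a..b} \<Longrightarrow> (h has_integral (\<sigma> t - \<sigma> a)) {a..t}"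
    "\<And>t. t \<in> {a..b} - N \<Longrightarrow> (\<sigma> has_vector_derivative h t) (at t)" by blast
  have "(\<lambda>t. norm (h t)) integrable_on {a..b}"
    using h(1) by (simp add: absolutely_integrable_on_def)
  then have hi: "((\<lambda>t. norm (h t)) has_integral integral {a..b} (\<lambda>t. norm (h t))) {a..b}" by blast
  have "norm (\<sigma> b - \<sigma> a) = norm (integral {a..b} h)"
    using h(3)[of b] assms(2) by (auto dest: integral_unique)
  also have "\<dots> \<le> integral {a..b} (\<lambda>t. norm (h t))"
    by (rule integral_norm_bound_integral)
       (use h(1) in \<open>auto simp: absolutely_integrable_on_def\<close>)
  finally have "ennreal (norm (\<sigma> b - \<sigma> a)) \<le> ennreal (integral {a..b} (\<lambda>t. norm (h t)))"
    by (rule ennreal_leI)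
  also have "\<dots> = (\<integral>\<^sup>+t. ennreal (norm (h t)) * indicator {a..b} t \<partial>lebesgue)"
    by (subst nn_integral_completion, subst nn_integral_has_integral_lebesgue'[OF _ hi]) auto
  also have "\<dots> = (\<integral>\<^sup>+t\<in>{a..b}. ennreal (norm (vector_derivative \<sigma> (at t))) \<partial>lebesgue)"
  proof (rule nn_integral_cong_AE)
    have "AE t in lebesgue. t \<notin> N" using h(2) by (simp add: AE_not_in negligible_iff_null_sets)
    then show "AE t in lebesgue. ennreal (norm (h t)) * indicator {a..b} t
        = ennreal (norm (vector_derivative \<sigma> (at t))) * indicator {a..b} t"
    proof eventually_elim
      case (elim t)
      show ?case
      proof (cases "t \<in> {a..b}")
        case True
        then have "vector_derivative \<sigma> (at t) = h t"
          using h(4)[of t] elim by (intro vector_derivative_at) auto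
        then show ?thesis by simp
      qed simp
    qed
  qed
  finally show ?thesis
    using that[OF h(2)] h(4) differentiableI_vector by blast
qed

section \<open>The Kobayashi metric\<close>

text \<open>\<open>2 * D\<close> is the reflection of \<open>0\<close> in the line
  \<open>Re w = D\<close>, so \<open>\<phi>\<close> is \<open>g - g 0\<close> followed by a Moebius
  map of the half plane \<open>Re w < D\<close> onto the disc that fixes \<open>0\<close>. The
  Schwarz lemma applies to \<open>\<phi>\<close>.\<close>

lemma Schwarz_half_plane:
  assumes hol: "g holomorphic_on ball 0 1" and Re: "\<And>z. z \<in> ball 0 1 \<Longrightarrow> Re (g z) < M"
  shows "norm (deriv g 0) \<le> 2 * (M - Re (g 0))"
proof -
  define D where "D = M - Re (g 0)"
  have D: "D > 0" using Re[of 0] by (simp add: D_def)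
  define \<phi> where "\<phi> = (\<lambda>z. (g z - g 0) / (g z - g 0 - of_real (2 * D)))"
  have R: "Re (g z - g 0) < D" if "z \<in> ball 0 1" for z
    using Re[OF that] by (simp add: D_def)
  have nz: "g z - g 0 - of_real (2 * D) \<noteq> 0" if "z \<in> ball 0 1" for z
    using R[OF that] D by (auto simp: complex_eq_iff)
  have hol\<phi>: "\<phi> holomorphic_on ball 0 1"
    unfolding \<phi>_def by (intro holomorphic_intros hol) (use nz in auto)
  have lt: "norm (\<phi> z) < 1" if "norm z < 1" for z
  proof -
    have z: "z \<in> ball 0 1" using that by simp
    have "(norm (g z - g 0))\<^sup>2 < (norm (g z - g 0 - of_real (2 * D)))\<^sup>2"
      using mult_strict_left_mono[OF R[OF z] D] unfolding cmod_power2 by (simp add: power2_eq_square algebra_simps)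
    then have "norm (g z - g 0) < norm (g z - g 0 - of_real (2 * D))"
      by (rule power_less_imp_less_base) simp
    then show ?thesis unfolding \<phi>_def norm_divide using nz[OF z] by (subst divide_less_eq_1_pos) auto
  qed
  have "norm (deriv \<phi> 0) \<le> 1"
    by (rule Schwarz_Lemma(2)[OF hol\<phi> _ lt, of 0]) (auto simp: \<phi>_def)
  have gd: "(g has_field_derivative deriv g 0) (at 0)"
    using hol by (rule holomorphic_derivI) auto
  have "(\<phi> has_field_derivative (deriv g 0 * (g 0 - g 0 - of_real (2 * D)) - (g 0 - g 0) * deriv g 0) /
      ((g 0 - g 0 - of_real (2 * D)) * (g 0 - g 0 - of_real (2 * D)))) (at 0)"
    unfolding \<phi>_def by (rule derivative_eq_intros refl gd | (use D in simp))+
  then have "deriv \<phi> 0 = - deriv g 0 / of_real (2 * D)"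
    using D by (auto dest!: DERIV_imp_deriv simp: field_simps)
  then have "norm (deriv g 0) / (2 * D) \<le> 1"
    using \<open>norm (deriv \<phi> 0) \<le> 1\<close> D by (simp add: norm_divide norm_mult)
  then show ?thesis using D by (simp add: field_simps D_def)
qed

text \<open>The complex-linear functional of \<open>v\<close> with real part
  \<open>a \<bullet> v\<close>. Composed with a holomorphic disc it turns a real supporting half
  space into a half plane for a scalar function.\<close>

definition hermitian :: "complex ^ 'n \<Rightarrow> complex ^ 'n \<Rightarrow> complex" where
  "hermitian a v = (\<Sum>i\<in>UNIV. v $ i * cnj (a $ i))"

lemma Re_hermitian: "Re (hermitian a v) = a \<bullet> v"
  by (simp add: hermitian_def inner_vec_def inner_complex_def mult.commute)

lemma hermitian_scale: "hermitian a (c *s v) = c * hermitian a v"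
  by (simp add: hermitian_def sum_distrib_left mult.assoc)

lemma inner_le_norm_hermitian: "\<bar>a \<bullet> v\<bar> \<le> norm (hermitian a v)"
  by (metis Re_hermitian abs_Re_le_cmod)

lemma norm_vector_scalar_mult: "norm (c *s (v :: complex ^ 'n)) = norm c * norm v"
  by (simp add: norm_vec_def L2_set_def norm_mult power_mult_distrib sum_distrib_left[symmetric] real_sqrt_mult)

definition kobayashi_disc :: "(complex ^ 'n) set \<Rightarrow> complex ^ 'n \<Rightarrow> complex ^ 'n \<Rightarrow> (complex \<Rightarrow> complex ^ 'n) \<Rightarrow> complex \<Rightarrow> bool" where
  "kobayashi_disc \<Omega> z v f \<xi> \<longleftrightarrow>
     (\<forall>i. (\<lambda>\<zeta>. f \<zeta> $ i) holomorphic_on ball 0 1) \<and> f ` ball 0 1 \<subseteq> \<Omega> \<and> f 0 = z \<and>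
     (\<chi> i. deriv (\<lambda>\<zeta>. f \<zeta> $ i) 0 * \<xi>) = v"

lemma kobayashi_metric_alt: "kobayashi_metric \<Omega> z v = Inf {norm \<xi> |\<xi> f. kobayashi_disc \<Omega> z v f \<xi>}"
  by (simp add: kobayashi_metric_def kobayashi_disc_def)

lemma kobayashi_metric_le: "kobayashi_disc \<Omega> z v f \<xi> \<Longrightarrow> kobayashi_metric \<Omega> z v \<le> norm \<xi>"
  unfolding kobayashi_metric_alt by (rule cInf_lower) (auto intro!: bdd_belowI[of _ 0])

text \<open>All nonconstant test discs constructed below lie in a complex line, so only the scalar
  map \<open>\<phi>\<close> has to be chosen and \<open>deriv \<phi> 0\<close> determines the
  bound.\<close>

lemma kobayashi_disc_line:
  fixes z v :: "complex ^ 'n"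
  assumes \<phi>: "\<phi> holomorphic_on ball 0 1" "\<phi> 0 = 0" "deriv \<phi> 0 \<noteq> 0"
    and sub: "\<And>\<zeta>. \<zeta> \<in> ball 0 1 \<Longrightarrow> z + \<phi> \<zeta> *s v \<in> \<Omega>"
  shows "kobayashi_disc \<Omega> z (c *s v) (\<lambda>\<zeta>. z + \<phi> \<zeta> *s v) (c / deriv \<phi> 0)"
  unfolding kobayashi_disc_def
proof (intro conjI allI)
  have d: "(\<phi> has_field_derivative deriv \<phi> 0) (at 0)"
    using \<phi>(1) by (rule holomorphic_derivI) auto
  show "(\<lambda>\<zeta>. (z + \<phi> \<zeta> *s v) $ i) holomorphic_on ball 0 1" for i
    using \<phi>(1) by (auto intro!: holomorphic_intros)
  have "deriv (\<lambda>\<zeta>. (z + \<phi> \<zeta> *s v) $ i) 0 = deriv \<phi> 0 * v $ i" for i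
    by (rule DERIV_imp_deriv) (auto intro!: derivative_eq_intros d)
  then show "(\<chi> i. deriv (\<lambda>\<zeta>. (z + \<phi> \<zeta> *s v) $ i) 0 * (c / deriv \<phi> 0)) = c *s v"
    using \<phi>(3) by (simp add: vec_eq_iff)
qed (use sub \<phi>(2) in auto)

text \<open>The linear disc filling the ball gives the bound. The existence claim shows that the
  infimum in the metric is over a nonempty set, on which every lower bound rests.\<close>

lemma kobayashi_metric_ball_bound:
  fixes z v :: "complex ^ 'n"
  assumes "ball z r \<subseteq> \<Omega>" "r > 0"
  shows "kobayashi_metric \<Omega> z v \<le> norm v / r" "\<exists>f \<xi>. kobayashi_disc \<Omega> z v f \<xi>"
proof -
  have "kobayashi_metric \<Omega> z v \<le> norm v / r \<and> (\<exists>f \<xi>. kobayashi_disc \<Omega> z v f \<xi>)"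
  proof (cases "v = 0")
    case True
    have "kobayashi_disc \<Omega> z v (\<lambda>_. z) 0"
      using assms True by (auto simp: kobayashi_disc_def vec_eq_iff)
    then show ?thesis using kobayashi_metric_le[of \<Omega> z v] True by fastforce
  next
    case False
    define \<phi> where "\<phi> = (\<lambda>\<zeta>. of_real (r / norm v) * \<zeta> :: complex)"
    have d: "deriv \<phi> 0 = of_real (r / norm v)" unfolding \<phi>_def by simp
    have *: "kobayashi_disc \<Omega> z (1 *s v) (\<lambda>\<zeta>. z + \<phi> \<zeta> *s v) (1 / deriv \<phi> 0)"
    proof (rule kobayashi_disc_line)
      show "\<phi> holomorphic_on ball 0 1" unfolding \<phi>_def by (intro holomorphic_intros)
      show "deriv \<phi> 0 \<noteq> 0" using d False assms(2) by simp
      fix \<zeta> :: complex assume "\<zeta> \<in> ball 0 1"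
      then have "norm (\<phi> \<zeta> *s v) < r"
        using False assms(2) by (simp add: norm_vector_scalar_mult \<phi>_def norm_mult norm_divide)
      then show "z + \<phi> \<zeta> *s v \<in> \<Omega>" using assms(1) by (auto simp: dist_norm subset_iff)
    qed (simp add: \<phi>_def)
    have "norm (1 / deriv \<phi> 0) = norm v / r" using d assms(2) by (simp add: norm_divide)
    with kobayashi_metric_le[OF *] * show ?thesis by (auto simp: vector_smult_lid)
  qed
  then show "kobayashi_metric \<Omega> z v \<le> norm v / r" "\<exists>f \<xi>. kobayashi_disc \<Omega> z v f \<xi>" by auto
qed

lemma kobayashi_metric_greatest:
  assumes "open \<Omega>" "z \<in> \<Omega>" "\<And>f \<xi>. kobayashi_disc \<Omega> z v f \<xi> \<Longrightarrow> c \<le> norm \<xi>"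
  shows "c \<le> kobayashi_metric \<Omega> z v"
proof -
  obtain r where "r > 0" "ball z r \<subseteq> \<Omega>" using assms(1,2) openE by blast
  from kobayashi_metric_ball_bound(2)[OF this(2,1)] show ?thesis
    unfolding kobayashi_metric_alt by (intro cInf_greatest) (use assms(3) in blast)+
qed

lemma kobayashi_metric_nonneg: "open \<Omega> \<Longrightarrow> z \<in> \<Omega> \<Longrightarrow> 0 \<le> kobayashi_metric \<Omega> z v"
  by (rule kobayashi_metric_greatest) auto

text \<open>A disc in \<open>\<Omega>\<close> followed by \<open>hermitian a\<close> is a scalar
  function into the half plane \<open>Re w < M\<close>, so \<open>Schwarz_half_plane\<close> bounds
  its derivative at \<open>0\<close>.\<close>

lemma kobayashi_metric_half_space:
  fixes a z v :: "complex ^ 'n"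
  assumes "open \<Omega>" "z \<in> \<Omega>" and half: "\<And>x. x \<in> \<Omega> \<Longrightarrow> a \<bullet> x < M"
  shows "norm (hermitian a v) / (2 * (M - a \<bullet> z)) \<le> kobayashi_metric \<Omega> z v"
proof (rule kobayashi_metric_greatest[OF assms(1,2)])
  fix f \<xi> assume "kobayashi_disc \<Omega> z v f \<xi>"
  then have f: "\<And>i. (\<lambda>\<zeta>. f \<zeta> $ i) holomorphic_on ball 0 1" "f ` ball 0 1 \<subseteq> \<Omega>" "f 0 = z"
    "(\<chi> i. deriv (\<lambda>\<zeta>. f \<zeta> $ i) 0 * \<xi>) = v"
    by (auto simp: kobayashi_disc_def)
  let ?g = "\<lambda>\<zeta>. hermitian a (f \<zeta>)"
  have hol: "?g holomorphic_on ball 0 1"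
    unfolding hermitian_def by (intro holomorphic_intros f(1))
  have "Re (?g \<zeta>) < M" if "\<zeta> \<in> ball 0 1" for \<zeta>
    unfolding Re_hermitian by (rule half) (use f(2) that in blast)
  from Schwarz_half_plane[OF hol this]
  have S: "norm (deriv ?g 0) \<le> 2 * (M - a \<bullet> z)" by (simp add: Re_hermitian f(3))
  have "((\<lambda>\<zeta>. f \<zeta> $ i) has_field_derivative deriv (\<lambda>\<zeta>. f \<zeta> $ i) 0) (at 0)" for i
    using f(1) by (rule holomorphic_derivI) auto
  then have "(?g has_field_derivative (\<Sum>i\<in>UNIV. deriv (\<lambda>\<zeta>. f \<zeta> $ i) 0 * cnj (a $ i))) (at 0)"
    unfolding hermitian_def by (auto intro!: derivative_eq_intros)
  then have "deriv ?g 0 * \<xi> = (\<Sum>i\<in>UNIV. deriv (\<lambda>\<zeta>. f \<zeta> $ i) 0 * cnj (a $ i)) * \<xi>"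
    by (simp add: DERIV_imp_deriv)
  also have "\<dots> = hermitian a v"
    unfolding f(4)[symmetric] by (simp add: hermitian_def sum_distrib_right sum_distrib_left algebra_simps)
  finally have "norm (hermitian a v) = norm (deriv ?g 0) * norm \<xi>" by (metis norm_mult)
  also have "\<dots> \<le> 2 * (M - a \<bullet> z) * norm \<xi>"
    by (rule mult_right_mono[OF S]) simp
  finally show "norm (hermitian a v) / (2 * (M - a \<bullet> z)) \<le> norm \<xi>"
    using half[OF assms(2)] by (simp add: field_simps)
qed

section \<open>Boundary distance and supporting half spaces\<close>

lemma frontier_nonempty:
  fixes \<Omega> :: "(complex ^ 'n) set"
  assumes "bounded \<Omega>" "\<Omega> \<noteq> {}"
  shows "frontier \<Omega> \<noteq> {}"
  using assms not_bounded_UNIV by (auto simp: frontier_eq_empty)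

lemma bdist_pos:
  fixes \<Omega> :: "(complex ^ 'n) set"
  assumes "open \<Omega>" "bounded \<Omega>" "z \<in> \<Omega>"
  shows "bdist \<Omega> z > 0"
proof -
  have "z \<notin> frontier \<Omega>" using assms(1,3) by (simp add: frontier_def interior_open)
  then show ?thesis
    unfolding bdist_def using infdist_pos_not_in_closed[OF frontier_closed frontier_nonempty] assms by blast
qed

lemma ball_bdist_subset:
  fixes \<Omega> :: "(complex ^ 'n) set"
  assumes "z \<in> \<Omega>"
  shows "ball z (bdist \<Omega> z) \<subseteq> \<Omega>"
proof (cases "bdist \<Omega> z > 0")
  case True
  show ?thesis
  proof (rule ccontr)
    assume "\<not> ?thesis"
    moreover have "z \<in> ball z (bdist \<Omega> z) \<inter> \<Omega>" using assms True by simp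
    ultimately have "ball z (bdist \<Omega> z) \<inter> frontier \<Omega> \<noteq> {}"
      by (intro connected_Int_frontier) blast+
    then obtain p where "p \<in> frontier \<Omega>" "dist z p < bdist \<Omega> z" by auto
    then show False using infdist_le[of p "frontier \<Omega>" z] by (simp add: bdist_def)
  qed
qed (simp add: ball_empty not_less)

lemma bdist_geI:
  fixes \<Omega> :: "(complex ^ 'n) set"
  assumes "open \<Omega>" "bounded \<Omega>" "\<Omega> \<noteq> {}" "ball z r \<subseteq> \<Omega>"
  shows "r \<le> bdist \<Omega> z"
proof -
  have "r \<le> dist z p" if "p \<in> frontier \<Omega>" for p
  proof -
    have "p \<notin> \<Omega>" using that assms(1) by (simp add: frontier_def interior_open)
    then have "p \<notin> ball z r" using assms(4) by blast
    then show ?thesis by simp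
  qed
  then show ?thesis
    using frontier_nonempty[OF assms(2,3)] by (simp add: bdist_def infdist_def cINF_greatest)
qed

lemma bdist_triangle: "bdist \<Omega> x \<le> bdist \<Omega> y + norm (x - y)"
  unfolding bdist_def dist_norm[symmetric] by (rule infdist_triangle)

text \<open>Translating both endpoints by a vector shorter than \<open>r\<close> stays in
  \<open>\<Omega>\<close>, and convexity then puts the translate of \<open>x\<close> into
  \<open>\<Omega>\<close> as well.\<close>

lemma bdist_segment:
  fixes \<Omega> :: "(complex ^ 'n) set"
  assumes "open \<Omega>" "bounded \<Omega>" "convex \<Omega>" "z \<in> \<Omega>" "w \<in> \<Omega>" "x \<in> closed_segment z w"
    and "r \<le> bdist \<Omega> z" "r \<le> bdist \<Omega> w"
  shows "r \<le> bdist \<Omega> x"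
proof (rule bdist_geI[OF assms(1,2)])
  show "\<Omega> \<noteq> {}" using assms by auto
  obtain u where u: "0 \<le> u" "u \<le> 1" "x = (1 - u) *\<^sub>R z + u *\<^sub>R w"
    using assms(6) by (auto simp: in_segment)
  show "ball x r \<subseteq> \<Omega>"
  proof
    fix y assume "y \<in> ball x r"
    then have n: "norm (y - x) < r" by (simp add: dist_norm norm_minus_commute)
    have "z + (y - x) \<in> \<Omega>" "w + (y - x) \<in> \<Omega>"
    proof -
      have "z + (y - x) \<in> ball z (bdist \<Omega> z)" "w + (y - x) \<in> ball w (bdist \<Omega> w)"
        using n assms(7,8) by (simp_all add: dist_norm norm_minus_commute)
      then show "z + (y - x) \<in> \<Omega>" "w + (y - x) \<in> \<Omega>"
        using ball_bdist_subset[OF assms(4)] ball_bdist_subset[OF assms(5)] by blast+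
    qed
    from convexD[OF assms(3) this, of "1 - u" u] u
    have "(1 - u) *\<^sub>R (z + (y - x)) + u *\<^sub>R (w + (y - x)) \<in> \<Omega>" by simp
    also have "(1 - u) *\<^sub>R (z + (y - x)) + u *\<^sub>R (w + (y - x)) = y"
      unfolding u(3) by (simp add: algebra_simps)
    finally show "y \<in> \<Omega>" .
  qed
qed

lemma supporting_half_space:
  fixes \<Omega> :: "(complex ^ 'n) set"
  assumes "open \<Omega>" "convex \<Omega>" "\<Omega> \<noteq> {}" "p \<notin> \<Omega>"
  obtains a where "norm a = 1" "\<And>x. x \<in> \<Omega> \<Longrightarrow> a \<bullet> x < a \<bullet> p"
proof -
  obtain a0 b where ab: "a0 \<noteq> 0" "\<forall>x\<in>\<Omega>. a0 \<bullet> x \<le> b" "\<forall>x\<in>{p}. b \<le> a0 \<bullet> x"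
    using separating_hyperplane_sets[of \<Omega> "{p}"] assms by auto
  define a where "a = a0 /\<^sub>R norm a0"
  have a: "norm a = 1" using ab(1) by (simp add: a_def)
  have le: "a \<bullet> x \<le> a \<bullet> p" if "x \<in> \<Omega>" for x
  proof -
    have "a0 \<bullet> x \<le> a0 \<bullet> p" using ab(2,3) that by force
    then show ?thesis by (simp add: a_def divide_right_mono divide_inverse[symmetric] mult.commute mult_left_mono)
  qed
  show ?thesis
  proof (rule that[OF a])
    fix x assume x: "x \<in> \<Omega>"
    obtain e where e: "e > 0" "ball x e \<subseteq> \<Omega>" using assms(1) x openE by blast
    \<comment> \<open>Strictness comes from openness: a small step from \<open>x\<close> in the
      direction \<open>a\<close> stays in \<open>\<Omega>\<close>.\<close>
    have "x + (e/2) *\<^sub>R a \<in> \<Omega>" using e a by (auto simp: dist_norm subset_iff)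
    from le[OF this] have "a \<bullet> x + e/2 * (a \<bullet> a) \<le> a \<bullet> p" by (simp add: inner_add_right)
    moreover have "a \<bullet> a = 1" using a by (simp add: dot_square_norm)
    ultimately show "a \<bullet> x < a \<bullet> p" using e(1) by simp
  qed
qed

lemma bdist_le_half_space:
  fixes \<Omega> :: "(complex ^ 'n) set"
  assumes "norm a = 1" "\<And>x. x \<in> \<Omega> \<Longrightarrow> a \<bullet> x < M" "z \<in> \<Omega>"
  shows "bdist \<Omega> z \<le> M - a \<bullet> z"
proof (rule ccontr)
  assume *: "\<not> ?thesis"
  have pos: "M - a \<bullet> z > 0" using assms(2)[OF assms(3)] by simp
  have "z + (M - a \<bullet> z) *\<^sub>R a \<in> ball z (bdist \<Omega> z)"
    using * pos assms(1) by (simp add: dist_norm)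
  then have "z + (M - a \<bullet> z) *\<^sub>R a \<in> \<Omega>" using ball_bdist_subset[OF assms(3)] by blast
  from assms(2)[OF this] show False
    using assms(1) by (simp add: inner_add_right dot_square_norm)
qed

text \<open>Supporting at the boundary point nearest to \<open>z\<close> makes the distance to the
  hyperplane equal to \<open>bdist\<close> at \<open>z\<close>, while it remains an upper bound for
  \<open>bdist\<close> elsewhere. This configuration yields the logarithmic lower bounds.\<close>

lemma nearest_half_space:
  fixes \<Omega> :: "(complex ^ 'n) set"
  assumes "open \<Omega>" "bounded \<Omega>" "convex \<Omega>" "z \<in> \<Omega>"
  obtains a M where "norm a = 1" "\<And>x. x \<in> \<Omega> \<Longrightarrow> a \<bullet> x < M" "M - a \<bullet> z = bdist \<Omega> z"
    "\<And>x. x \<in> \<Omega> \<Longrightarrow> bdist \<Omega> x \<le> M - a \<bullet> x"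
proof -
  have "frontier \<Omega> \<noteq> {}" using frontier_nonempty assms by blast
  then obtain p where p: "p \<in> frontier \<Omega>" "infdist z (frontier \<Omega>) = dist z p"
    using infdist_attains_inf[OF frontier_closed] by metis
  have "p \<notin> \<Omega>" using p(1) assms(1) by (simp add: frontier_def interior_open)
  then obtain a where a: "norm a = 1" "\<And>x. x \<in> \<Omega> \<Longrightarrow> a \<bullet> x < a \<bullet> p"
    using supporting_half_space[OF assms(1,3)] assms(4) by blast
  have le: "bdist \<Omega> x \<le> a \<bullet> p - a \<bullet> x" if "x \<in> \<Omega>" for x
    using a that by (rule bdist_le_half_space)
  have "a \<bullet> (p - z) \<le> norm a * norm (p - z)" by (rule norm_cauchy_schwarz)
  then have "a \<bullet> p - a \<bullet> z = bdist \<Omega> z"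
    using le[OF assms(4)] a(1) p(2) by (simp add: bdist_def dist_norm inner_diff_right norm_minus_commute)
  with a le show ?thesis using that by blast
qed

text \<open>Let \<open>p = z + c *s v\<close> be a nearest boundary point on the complex line. The
  half space at \<open>p\<close> bounds the metric below by \<open>norm (hermitian a v)\<close> over
  twice the gap \<open>a \<bullet> p - a \<bullet> z\<close>, and the gap is at most
  \<open>norm c * norm (hermitian a v)\<close>. The unknown angle between \<open>a\<close> and
  \<open>v\<close> cancels.\<close>

lemma kobayashi_metric_ge_bdist_dir:
  fixes \<Omega> :: "(complex ^ 'n) set"
  assumes "open \<Omega>" "bounded \<Omega>" "convex \<Omega>" "z \<in> \<Omega>" "v \<noteq> 0"
  shows "norm v \<le> 2 * bdist_dir \<Omega> z v * kobayashi_metric \<Omega> z v"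
proof -
  let ?L = "range (\<lambda>c. z + c *s v)"
  have cont: "continuous_on UNIV (\<lambda>c. z + c *s v)"
    by (intro continuous_intros continuous_on_vec_lambda | simp add: vector_scalar_mult_def)+
  have nv: "norm v > 0" using assms(5) by simp
  \<comment> \<open>The line is cut out by the equations of proportionality to \<open>v\<close>. Its
    closedness lets the infimum in \<open>bdist_dir\<close> be attained.\<close>
  have closedL: "closed ?L"
  proof -
    have "?L = {w. \<forall>i j. (w $ i - z $ i) * v $ j = (w $ j - z $ j) * v $ i}"
    proof (intro equalityI subsetI)
      fix w assume "w \<in> {w. \<forall>i j. (w $ i - z $ i) * v $ j = (w $ j - z $ j) * v $ i}"
      then have w: "\<And>i j. (w $ i - z $ i) * v $ j = (w $ j - z $ j) * v $ i" by auto
      obtain j where j: "v $ j \<noteq> 0" using assms(5) by (auto simp: vec_eq_iff)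
      have "w = z + ((w $ j - z $ j) / v $ j) *s v"
        using w[of _ j] j by (simp add: vec_eq_iff field_simps)
      then show "w \<in> ?L" by blast
    qed (auto simp: algebra_simps)
    moreover have "closed {w. \<forall>i j. (w $ i - z $ i) * v $ j = (w $ j - z $ j) * v $ i}"
      by (intro closed_Collect_all closed_Collect_eq continuous_intros)
    ultimately show ?thesis by simp
  qed
  have "connected ?L" by (rule connected_continuous_image[OF cont]) (rule connected_UNIV)
  moreover have "z \<in> ?L" by (rule range_eqI[of _ _ 0]) simp
  \<comment> \<open>A bounded set contains no complex line, so the line crosses the frontier and the
    infimum is over a nonempty set.\<close>
  moreover have "?L - \<Omega> \<noteq> {}"
  proof
    assume "?L - \<Omega> = {}"
    obtain B where B: "\<And>x. x \<in> \<Omega> \<Longrightarrow> norm x \<le> B" using assms(2) by (auto simp: bounded_iff)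
    let ?c = "of_real ((B + norm z + 1) / norm v) :: complex"
    have "z + ?c *s v \<in> \<Omega>" using \<open>?L - \<Omega> = {}\<close> by blast
    from B[OF this] have "norm (?c *s v) \<le> B + norm z"
      using norm_triangle_ineq2[of "?c *s v" "-z"] by (simp add: add.commute)
    moreover have "0 \<le> B" using B[OF assms(4)] norm_ge_zero order_trans by blast
    then have "norm (?c *s v) = B + norm z + 1"
      unfolding norm_vector_scalar_mult norm_of_real using nv by simp
    ultimately show False by simp
  qed
  ultimately have ne: "?L \<inter> frontier \<Omega> \<noteq> {}"
    using assms(4) by (intro connected_Int_frontier) auto
  have "closed (frontier \<Omega> \<inter> ?L)" "frontier \<Omega> \<inter> ?L \<noteq> {}"
    using closedL ne by (auto intro: closed_Int)
  from infdist_attains_inf[OF this] obtain p where p: "p \<in> frontier \<Omega> \<inter> ?L" "bdist_dir \<Omega> z v = dist z p"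
    unfolding bdist_dir_def by metis
  then obtain c where c: "p = z + c *s v" by auto
  have dc: "bdist_dir \<Omega> z v = norm c * norm v" unfolding p(2) c by (simp add: dist_norm norm_vector_scalar_mult)
  have "p \<notin> \<Omega>" using p(1) assms(1) by (simp add: frontier_def interior_open)
  then obtain a where a: "norm a = 1" "\<And>x. x \<in> \<Omega> \<Longrightarrow> a \<bullet> x < a \<bullet> p"
    using supporting_half_space[OF assms(1,3)] assms(4) by blast
  have pos: "a \<bullet> p - a \<bullet> z > 0" using a(2)[OF assms(4)] by simp
  have "a \<bullet> p - a \<bullet> z = a \<bullet> (c *s v)" by (simp add: c inner_add_right)
  also have "\<dots> \<le> norm c * norm (hermitian a v)"
    using inner_le_norm_hermitian[of a "c *s v"] by (simp add: hermitian_scale norm_mult)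
  finally have le: "a \<bullet> p - a \<bullet> z \<le> norm c * norm (hermitian a v)" .
  have h0: "norm (hermitian a v) > 0"
    using le pos by (cases "hermitian a v = 0") auto
  have k: "norm (hermitian a v) \<le> kobayashi_metric \<Omega> z v * (2 * (a \<bullet> p - a \<bullet> z))"
    using kobayashi_metric_half_space[OF assms(1,4) a(2), of v] pos by (simp add: field_simps)
  note k0 = kobayashi_metric_nonneg[OF assms(1,4), of v]
  have "norm (hermitian a v) \<le> kobayashi_metric \<Omega> z v * (2 * (norm c * norm (hermitian a v)))"
    using k mult_left_mono[OF le k0] by linarith
  then have "1 \<le> kobayashi_metric \<Omega> z v * (2 * norm c)"
    using h0 by (simp add: field_simps)
  then have "norm v \<le> norm v * (kobayashi_metric \<Omega> z v * (2 * norm c))"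
    using nv by simp
  then show ?thesis unfolding dc by (simp add: algebra_simps)
qed

section \<open>Kobayashi length of curves\<close>

text \<open>Phrased through increments, so that it covers functions that are Lipschitz only along
  the given curve, such as a logarithm.\<close>

lemma abs_cont_on_Lipschitz_compose:
  fixes \<sigma> :: "real \<Rightarrow> 'a::real_normed_vector" and \<psi> :: "real \<Rightarrow> 'b::real_normed_vector"
  assumes "abs_cont_on a b \<sigma>" "B > 0"
    and le: "\<And>s t. s \<in> {a..b} \<Longrightarrow> t \<in> {a..b} \<Longrightarrow> norm (\<psi> t - \<psi> s) \<le> B * norm (\<sigma> t - \<sigma> s)"
  shows "abs_cont_on a b \<psi>"
  unfolding abs_cont_on_def
proof (intro allI impI)
  fix \<epsilon> :: real assume "\<epsilon> > 0"
  then have "\<epsilon> / B > 0" using assms(2) by simp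
  with assms(1) obtain \<delta> where d: "\<delta> > 0" "\<And>(N::nat) s t.
        (\<forall>k<N. a \<le> s k \<and> s k \<le> t k \<and> t k \<le> b) \<and>
        disjoint_family_on (\<lambda>k. {s k<..<t k}) {..<N} \<and> (\<Sum>k<N. t k - s k) < \<delta>
        \<Longrightarrow> (\<Sum>k<N. norm (\<sigma> (t k) - \<sigma> (s k))) < \<epsilon> / B"
    unfolding abs_cont_on_def by meson
  show "\<exists>\<delta>>0. \<forall>(N::nat) s t.
        (\<forall>k<N. a \<le> s k \<and> s k \<le> t k \<and> t k \<le> b) \<and>
        disjoint_family_on (\<lambda>k. {s k<..<t k}) {..<N} \<and> (\<Sum>k<N. t k - s k) < \<delta>
        \<longrightarrow> (\<Sum>k<N. norm (\<psi> (t k) - \<psi> (s k))) < \<epsilon>"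
  proof (intro exI[of _ \<delta>] conjI allI impI d(1))
    fix N :: nat and s t
    assume *: "(\<forall>k<N. a \<le> s k \<and> s k \<le> t k \<and> t k \<le> b) \<and>
        disjoint_family_on (\<lambda>k. {s k<..<t k}) {..<N} \<and> (\<Sum>k<N. t k - s k) < \<delta>"
    have "(\<Sum>k<N. norm (\<psi> (t k) - \<psi> (s k))) \<le> (\<Sum>k<N. B * norm (\<sigma> (t k) - \<sigma> (s k)))"
    proof (rule sum_mono)
      fix k assume "k \<in> {..<N}"
      then have "a \<le> s k" "s k \<le> t k" "t k \<le> b" using * by auto
      then show "norm (\<psi> (t k) - \<psi> (s k)) \<le> B * norm (\<sigma> (t k) - \<sigma> (s k))"
        by (intro le) auto
    qed
    also have "\<dots> = B * (\<Sum>k<N. norm (\<sigma> (t k) - \<sigma> (s k)))"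
      by (rule sum_distrib_left[symmetric])
    also have "\<dots> < B * (\<epsilon> / B)"
      using d(2)[OF *] assms(2) by (rule mult_strict_left_mono)
    finally show "(\<Sum>k<N. norm (\<psi> (t k) - \<psi> (s k))) < \<epsilon>" using assms(2) by simp
  qed
qed

lemma abs_cont_on_id: "abs_cont_on a b (\<lambda>t. t)"
  unfolding abs_cont_on_def
proof (intro allI impI)
  fix \<epsilon> :: real assume e: "\<epsilon> > 0"
  show "\<exists>\<delta>>0. \<forall>(N::nat) s t.
        (\<forall>k<N. a \<le> s k \<and> s k \<le> t k \<and> t k \<le> b) \<and>
        disjoint_family_on (\<lambda>k. {s k<..<t k}) {..<N} \<and> (\<Sum>k<N. t k - s k) < \<delta>
        \<longrightarrow> (\<Sum>k<N. norm (t k - s k)) < \<epsilon>"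
  proof (intro exI[of _ \<epsilon>] conjI allI impI e)
    fix N :: nat and s t
    assume *: "(\<forall>k<N. a \<le> s k \<and> s k \<le> t k \<and> t k \<le> b) \<and>
        disjoint_family_on (\<lambda>k. {s k<..<t k}) {..<N} \<and> (\<Sum>k<N. t k - s k) < \<epsilon>"
    have "(\<Sum>k<N. norm (t k - s k)) = (\<Sum>k<N. t k - s k)"
      by (rule sum.cong) (use * in auto)
    then show "(\<Sum>k<N. norm (t k - s k)) < \<epsilon>" using * by simp
  qed
qed

lemma lipschitz_imp_abs_cont_on:
  fixes \<sigma> :: "real \<Rightarrow> 'a::real_normed_vector"
  assumes "L-lipschitz_on {a..b} \<sigma>"
  shows "abs_cont_on a b \<sigma>"
proof (rule abs_cont_on_Lipschitz_compose[OF abs_cont_on_id])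
  show "L + 1 > 0" using lipschitz_on_nonneg[OF assms] by simp
  fix s t assume "s \<in> {a..b}" "t \<in> {a..b}"
  from lipschitz_onD[OF assms this(2,1)] show "norm (\<sigma> t - \<sigma> s) \<le> (L + 1) * norm (t - s)"
    by (auto simp: dist_norm algebra_simps intro: order_trans)
qed

lemma abs_cont_on_continuous:
  fixes \<sigma> :: "real \<Rightarrow> 'a::real_normed_vector"
  assumes "abs_cont_on a b \<sigma>"
  shows "continuous_on {a..b} \<sigma>"
  unfolding continuous_on_iff
proof (intro ballI allI impI)
  fix x e :: real assume x: "x \<in> {a..b}" and "e > 0"
  with assms obtain \<delta> where d: "\<delta> > 0" "\<And>(N::nat) s t.
        (\<forall>k<N. a \<le> s k \<and> s k \<le> t k \<and> t k \<le> b) \<and>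
        disjoint_family_on (\<lambda>k. {s k<..<t k}) {..<N} \<and> (\<Sum>k<N. t k - s k) < \<delta>
        \<Longrightarrow> (\<Sum>k<N. norm (\<sigma> (t k) - \<sigma> (s k))) < e"
    unfolding abs_cont_on_def by meson
  have "norm (\<sigma> y - \<sigma> x) < e" if y: "y \<in> {a..b}" "\<bar>y - x\<bar> < \<delta>" for y
  proof (cases "x \<le> y")
    case True
    then show ?thesis
      using d(2)[of "Suc 0" "\<lambda>_. x" "\<lambda>_. y"] x y by (auto simp: disjoint_family_on_def)
  next
    case False
    then show ?thesis
      using d(2)[of "Suc 0" "\<lambda>_. y" "\<lambda>_. x"] x y by (auto simp: disjoint_family_on_def norm_minus_commute)
  qed
  then show "\<exists>d>0. \<forall>x'\<in>{a..b}. dist x' x < d \<longrightarrow> dist (\<sigma> x') (\<sigma> x) < e"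
    using d(1) by (auto simp: dist_norm)
qed

lemma abs_cont_on_subinterval:
  assumes "abs_cont_on a b \<sigma>" "a \<le> c" "d \<le> b"
  shows "abs_cont_on c d \<sigma>"
  unfolding abs_cont_on_def
proof (intro allI impI)
  fix \<epsilon> :: real assume "\<epsilon> > 0"
  with assms(1) obtain \<delta> where d: "\<delta> > 0" "\<And>(N::nat) s t.
        (\<forall>k<N. a \<le> s k \<and> s k \<le> t k \<and> t k \<le> b) \<and>
        disjoint_family_on (\<lambda>k. {s k<..<t k}) {..<N} \<and> (\<Sum>k<N. t k - s k) < \<delta>
        \<Longrightarrow> (\<Sum>k<N. norm (\<sigma> (t k) - \<sigma> (s k))) < \<epsilon>"
    unfolding abs_cont_on_def by meson
  then show "\<exists>\<delta>>0. \<forall>(N::nat) s t.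
        (\<forall>k<N. c \<le> s k \<and> s k \<le> t k \<and> t k \<le> d) \<and>
        disjoint_family_on (\<lambda>k. {s k<..<t k}) {..<N} \<and> (\<Sum>k<N. t k - s k) < \<delta>
        \<longrightarrow> (\<Sum>k<N. norm (\<sigma> (t k) - \<sigma> (s k))) < \<epsilon>"
    using assms(2,3) by (intro exI[of _ \<delta>] conjI allI impI d(1) d(2)) fastforce+
qed

text \<open>Half the logarithm of the gap to the hyperplane measures half plane distance in the
  normal direction. By \<open>kobayashi_metric_half_space\<close> its derivative along the curve is
  at most the Kobayashi speed.\<close>

lemma kobayashi_length_ge_log:
  fixes \<sigma> :: "real \<Rightarrow> complex ^ 'n"
  assumes \<Omega>: "open \<Omega>" and \<sigma>: "abs_cont_on p q \<sigma>" "p \<le> q" "\<sigma> ` {p..q} \<subseteq> \<Omega>"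
    and a: "norm a = 1" "\<And>x. x \<in> \<Omega> \<Longrightarrow> a \<bullet> x < M"
  shows "ennreal (\<bar>ln (M - a \<bullet> \<sigma> q) - ln (M - a \<bullet> \<sigma> p)\<bar> / 2) \<le> kobayashi_length \<Omega> p q \<sigma>"
proof -
  define d where "d = (\<lambda>t. M - a \<bullet> \<sigma> t)"
  define \<psi> where "\<psi> = (\<lambda>t. ln (d t) / 2)"
  have dpos: "d t > 0" if "t \<in> {p..q}" for t
  proof -
    have "\<sigma> t \<in> \<Omega>" using \<sigma>(3) that by blast
    then show ?thesis using a(2) by (simp add: d_def)
  qed
  have "continuous_on {p..q} d"
    unfolding d_def by (intro continuous_intros abs_cont_on_continuous[OF \<sigma>(1)])
  \<comment> \<open>The smallest gap along the curve is positive, which makes the logarithm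
    Lipschitz there.\<close>
  then obtain t0 where t0: "t0 \<in> {p..q}" "\<And>t. t \<in> {p..q} \<Longrightarrow> d t0 \<le> d t"
    using continuous_attains_inf[of "{p..q}" d] \<sigma>(2) by auto
  have lip: "\<psi> t - \<psi> s \<le> (1 / (2 * d t0)) * norm (\<sigma> t - \<sigma> s)" if "s \<in> {p..q}" "t \<in> {p..q}" for s t
  proof -
    have "\<psi> t - \<psi> s = ln (d t / d s) / 2"
      using dpos[OF that(1)] dpos[OF that(2)] by (simp add: \<psi>_def ln_div diff_divide_distrib)
    also have "\<dots> \<le> (d t / d s - 1) / 2"
      using dpos[OF that(1)] dpos[OF that(2)] ln_le_minus_one[of "d t / d s"] by simp
    also have "\<dots> = (a \<bullet> (\<sigma> s - \<sigma> t)) / (2 * d s)"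
      using dpos[OF that(1)] by (simp add: d_def field_simps inner_diff_right)
    also have "\<dots> \<le> norm (\<sigma> t - \<sigma> s) / (2 * d s)"
    proof -
      have "a \<bullet> (\<sigma> s - \<sigma> t) \<le> norm a * norm (\<sigma> s - \<sigma> t)" by (rule norm_cauchy_schwarz)
      then show ?thesis using a(1) dpos[OF that(1)] by (simp add: divide_right_mono norm_minus_commute)
    qed
    also have "\<dots> \<le> norm (\<sigma> t - \<sigma> s) / (2 * d t0)"
      by (rule divide_left_mono) (use t0(2)[OF that(1)] dpos[OF that(1)] dpos[OF t0(1)] in auto)
    finally show ?thesis by simp
  qed
  have "abs_cont_on p q \<psi>"
  proof (rule abs_cont_on_Lipschitz_compose[OF \<sigma>(1)])
    show "1 / (2 * d t0) > 0" using dpos[OF t0(1)] by simp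
    fix s t assume st: "s \<in> {p..q}" "t \<in> {p..q}"
    show "norm (\<psi> t - \<psi> s) \<le> 1 / (2 * d t0) * norm (\<sigma> t - \<sigma> s)"
      using lip[OF st] lip[OF st(2,1)] by (simp add: abs_le_iff norm_minus_commute)
  qed
  from abs_cont_on_norm_le_nn_integral[OF this \<sigma>(2)]
  have "ennreal (norm (\<psi> q - \<psi> p)) \<le> (\<integral>\<^sup>+t\<in>{p..q}. ennreal (norm (vector_derivative \<psi> (at t))) \<partial>lebesgue)"
    by blast
  also have "\<dots> \<le> kobayashi_length \<Omega> p q \<sigma>"
    unfolding kobayashi_length_def
  proof (rule nn_integral_mono_AE)
    obtain N where N: "negligible N" "\<And>t. t \<in> {p..q} - N \<Longrightarrow> \<sigma> differentiable at t"
      using abs_cont_on_norm_le_nn_integral[OF \<sigma>(1,2)] by blast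
    have "AE t in lebesgue. t \<notin> N" using N(1) by (simp add: AE_not_in negligible_iff_null_sets)
    then show "AE t in lebesgue. ennreal (norm (vector_derivative \<psi> (at t))) * indicator {p..q} t
        \<le> ennreal (kobayashi_metric \<Omega> (\<sigma> t) (vector_derivative \<sigma> (at t))) * indicator {p..q} t"
    proof eventually_elim
      case (elim t)
      show ?case
      proof (cases "t \<in> {p..q}")
        case True
        let ?v = "vector_derivative \<sigma> (at t)"
        have "(\<sigma> has_vector_derivative ?v) (at t)"
          using N(2) True elim by (simp add: vector_derivative_works[symmetric])
        then have "((\<lambda>t. a \<bullet> \<sigma> t) has_vector_derivative a \<bullet> ?v) (at t)"
          by (rule bounded_linear.has_vector_derivative[OF bounded_linear_inner_right])
        then have "((\<lambda>t. a \<bullet> \<sigma> t) has_real_derivative a \<bullet> ?v) (at t)"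
          by (simp add: has_real_derivative_iff_has_vector_derivative)
        then have "(\<psi> has_real_derivative (- (a \<bullet> ?v) / (2 * d t))) (at t)"
          unfolding \<psi>_def d_def using dpos[OF True] unfolding d_def
          by (auto intro!: derivative_eq_intros simp: field_simps)
        then have "vector_derivative \<psi> (at t) = - (a \<bullet> ?v) / (2 * d t)"
          by (intro vector_derivative_at) (simp add: has_real_derivative_iff_has_vector_derivative)
        then have "norm (vector_derivative \<psi> (at t)) = \<bar>a \<bullet> ?v\<bar> / (2 * d t)"
          using dpos[OF True] by simp
        also have "\<dots> \<le> norm (hermitian a ?v) / (2 * d t)"
          using dpos[OF True] by (intro divide_right_mono inner_le_norm_hermitian) auto
        also have "\<dots> \<le> kobayashi_metric \<Omega> (\<sigma> t) ?v"
          unfolding d_def by (rule kobayashi_metric_half_space[OF \<Omega> _ a(2)]) (use \<sigma>(3) True in auto)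
        finally show ?thesis using True by (simp add: ennreal_leI)
      qed simp
    qed
  qed
  finally have "ennreal (norm (\<psi> q - \<psi> p)) \<le> kobayashi_length \<Omega> p q \<sigma>" .
  then show ?thesis by (simp add: \<psi>_def d_def diff_divide_distrib[symmetric])
qed

lemma kobayashi_length_ge_norm:
  fixes \<sigma> :: "real \<Rightarrow> complex ^ 'n"
  assumes \<sigma>: "abs_cont_on p q \<sigma>" "p \<le> q" and B: "B > 0"
    and le: "\<And>t v. t \<in> {p..q} \<Longrightarrow> norm v \<le> B * kobayashi_metric \<Omega> (\<sigma> t) v"
  shows "ennreal (norm (\<sigma> q - \<sigma> p) / B) \<le> kobayashi_length \<Omega> p q \<sigma>"
proof -
  let ?\<psi> = "\<lambda>t. (1 / B) *\<^sub>R \<sigma> t"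
  have "abs_cont_on p q ?\<psi>"
    by (rule abs_cont_on_Lipschitz_compose[OF \<sigma>(1), of "1 / B"])
       (use B in \<open>auto simp: scaleR_diff_right[symmetric]\<close>)
  from abs_cont_on_norm_le_nn_integral[OF this \<sigma>(2)]
  have "ennreal (norm (?\<psi> q - ?\<psi> p)) \<le> (\<integral>\<^sup>+t\<in>{p..q}. ennreal (norm (vector_derivative ?\<psi> (at t))) \<partial>lebesgue)"
    by blast
  also have "\<dots> \<le> kobayashi_length \<Omega> p q \<sigma>"
    unfolding kobayashi_length_def
  proof (rule nn_integral_mono_AE)
    obtain N where N: "negligible N" "\<And>t. t \<in> {p..q} - N \<Longrightarrow> \<sigma> differentiable at t"
      using abs_cont_on_norm_le_nn_integral[OF \<sigma>(1,2)] by blast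
    have "AE t in lebesgue. t \<notin> N" using N(1) by (simp add: AE_not_in negligible_iff_null_sets)
    then show "AE t in lebesgue. ennreal (norm (vector_derivative ?\<psi> (at t))) * indicator {p..q} t
        \<le> ennreal (kobayashi_metric \<Omega> (\<sigma> t) (vector_derivative \<sigma> (at t))) * indicator {p..q} t"
    proof eventually_elim
      case (elim t)
      show ?case
      proof (cases "t \<in> {p..q}")
        case True
        let ?v = "vector_derivative \<sigma> (at t)"
        have "(\<sigma> has_vector_derivative ?v) (at t)"
          using N(2) True elim by (simp add: vector_derivative_works[symmetric])
        then have "(?\<psi> has_vector_derivative (1 / B) *\<^sub>R ?v) (at t)"
          by (rule bounded_linear.has_vector_derivative[OF bounded_linear_scaleR_right])
        then have "vector_derivative ?\<psi> (at t) = (1 / B) *\<^sub>R ?v"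
          by (rule vector_derivative_at)
        then have "norm (vector_derivative ?\<psi> (at t)) = norm ?v / B"
          using B by simp
        also have "\<dots> \<le> kobayashi_metric \<Omega> (\<sigma> t) ?v"
          using le[OF True, of ?v] B by (simp add: field_simps)
        finally show ?thesis using True by (simp add: ennreal_leI)
      qed simp
    qed
  qed
  finally show ?thesis using B by (simp add: scaleR_diff_right[symmetric])
qed

text \<open>An upper bound for the distance together with its witness. The Borel majorant
  \<open>g\<close> carries the integral, so reversal and concatenation only integrate Borel
  functions and never the Kobayashi metric itself; \<open>S\<close> collects the corners.\<close>

definition curve_bound :: "(complex ^ 'n) set \<Rightarrow> complex ^ 'n \<Rightarrow> complex ^ 'n \<Rightarrow> real \<Rightarrow> bool" where
  "curve_bound \<Omega> x y c \<longleftrightarrow>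
     (\<exists>a b \<sigma> g L S. a \<le> b \<and> L-lipschitz_on {a..b} \<sigma> \<and> \<sigma> ` {a..b} \<subseteq> \<Omega> \<and> \<sigma> a = x \<and> \<sigma> b = y \<and>
        g \<in> borel_measurable borel \<and> finite S \<and>
        (\<forall>t\<in>{a<..<b} - S. \<exists>v. (\<sigma> has_vector_derivative v) (at t) \<and>
            ennreal (kobayashi_metric \<Omega> (\<sigma> t) v) \<le> g t) \<and>
        (\<integral>\<^sup>+t\<in>{a..b}. g t \<partial>lborel) \<le> ennreal c)"

lemma curve_boundI:
  assumes "a \<le> b" "L-lipschitz_on {a..b} \<sigma>" "\<sigma> ` {a..b} \<subseteq> \<Omega>" "\<sigma> a = x" "\<sigma> b = y"
    "g \<in> borel_measurable borel" "finite S"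
    "\<And>t. t \<in> {a<..<b} - S \<Longrightarrow> \<exists>v. (\<sigma> has_vector_derivative v) (at t) \<and>
            ennreal (kobayashi_metric \<Omega> (\<sigma> t) v) \<le> g t"
    "(\<integral>\<^sup>+t\<in>{a..b}. g t \<partial>lborel) \<le> ennreal c"
  shows "curve_bound \<Omega> x y c"
  unfolding curve_bound_def
  by (intro exI[of _ a] exI[of _ b] exI[of _ \<sigma>] exI[of _ g] exI[of _ L] exI[of _ S] conjI ballI) (rule assms; assumption)+

lemma curve_boundE:
  assumes "curve_bound \<Omega> x y c"
  obtains a b \<sigma> g L S where "a \<le> b" "L-lipschitz_on {a..b} \<sigma>" "\<sigma> ` {a..b} \<subseteq> \<Omega>" "\<sigma> a = x" "\<sigma> b = y"
    "g \<in> borel_measurable borel" "finite S"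
    "\<And>t. t \<in> {a<..<b} - S \<Longrightarrow> \<exists>v. (\<sigma> has_vector_derivative v) (at t) \<and>
            ennreal (kobayashi_metric \<Omega> (\<sigma> t) v) \<le> g t"
    "(\<integral>\<^sup>+t\<in>{a..b}. g t \<partial>lborel) \<le> ennreal c"
  using assms unfolding curve_bound_def
  by (elim exE conjE) (rule that, assumption+, erule bspec, assumption+)

lemma curve_bound_length:
  assumes "curve_bound \<Omega> x y c"
  shows "Inf {kobayashi_length \<Omega> a b \<sigma> | a b \<sigma>.
                a \<le> b \<and> abs_cont_on a b \<sigma> \<and> \<sigma> ` {a..b} \<subseteq> \<Omega> \<and> \<sigma> a = x \<and> \<sigma> b = y} \<le> ennreal c"
proof -
  from assms obtain a b \<sigma> g L S where c: "a \<le> b" "L-lipschitz_on {a..b} \<sigma>" "\<sigma> ` {a..b} \<subseteq> \<Omega>" "\<sigma> a = x" "\<sigma> b = y"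
    "g \<in> borel_measurable borel" "finite S"
    "\<And>t. t \<in> {a<..<b} - S \<Longrightarrow> \<exists>v. (\<sigma> has_vector_derivative v) (at t) \<and>
            ennreal (kobayashi_metric \<Omega> (\<sigma> t) v) \<le> g t"
    "(\<integral>\<^sup>+t\<in>{a..b}. g t \<partial>lborel) \<le> ennreal c"
    by (rule curve_boundE) (rule that)
  have "kobayashi_length \<Omega> a b \<sigma> \<le> (\<integral>\<^sup>+t\<in>{a..b}. g t \<partial>lborel)"
    unfolding kobayashi_length_def nn_integral_completion
  proof (rule nn_integral_mono_AE)
    have "AE t in lborel. t \<notin> insert a (insert b S)"
      using c(7) by (intro AE_not_in finite_imp_null_set_lborel) simp
    then show "AE t in lborel. ennreal (kobayashi_metric \<Omega> (\<sigma> t) (vector_derivative \<sigma> (at t))) * indicator {a..b} t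
        \<le> g t * indicator {a..b} t"
    proof eventually_elim
      case (elim t)
      show ?case
      proof (cases "t \<in> {a..b}")
        case True
        then have "t \<in> {a<..<b} - S" using elim by auto
        from c(8)[OF this] obtain v where v: "(\<sigma> has_vector_derivative v) (at t)"
            "ennreal (kobayashi_metric \<Omega> (\<sigma> t) v) \<le> g t" by blast
        then show ?thesis using True vector_derivative_at[OF v(1)] by simp
      qed simp
    qed
  qed
  with c(9) have "kobayashi_length \<Omega> a b \<sigma> \<le> ennreal c" by (rule order_trans[rotated])
  moreover have "kobayashi_length \<Omega> a b \<sigma> \<in> {kobayashi_length \<Omega> a b \<sigma> | a b \<sigma>.
                a \<le> b \<and> abs_cont_on a b \<sigma> \<and> \<sigma> ` {a..b} \<subseteq> \<Omega> \<and> \<sigma> a = x \<and> \<sigma> b = y}"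
    by (intro CollectI exI conjI) (rule refl c lipschitz_imp_abs_cont_on[OF c(2)])+
  ultimately show ?thesis by (rule Inf_lower2[rotated])
qed

lemma curve_bound_dist:
  assumes "curve_bound \<Omega> x y c" "c \<ge> 0"
  shows "kobayashi_dist \<Omega> x y \<le> c"
  unfolding kobayashi_dist_def
  using enn2real_mono[OF curve_bound_length[OF assms(1)]] assms(2) by simp

text \<open>\<open>enn2real\<close> would send an infinite infimum to \<open>0\<close>. The given
  \<open>curve_bound\<close> excludes this, so a curve of length close to the distance
  exists.\<close>

lemma kobayashi_dist_obtain_curve:
  assumes "curve_bound \<Omega> x y c" "kobayashi_dist \<Omega> x y < \<tau>"
  obtains a b \<sigma> where "a \<le> b" "abs_cont_on a b \<sigma>" "\<sigma> ` {a..b} \<subseteq> \<Omega>" "\<sigma> a = x" "\<sigma> b = y"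
    "kobayashi_length \<Omega> a b \<sigma> < ennreal \<tau>"
proof -
  let ?I = "Inf {kobayashi_length \<Omega> a b \<sigma> | a b \<sigma>.
                a \<le> b \<and> abs_cont_on a b \<sigma> \<and> \<sigma> ` {a..b} \<subseteq> \<Omega> \<and> \<sigma> a = x \<and> \<sigma> b = y}"
  have "?I < top" by (rule le_less_trans[OF curve_bound_length[OF assms(1)] ennreal_less_top])
  then have "?I = ennreal (enn2real ?I)" by (rule ennreal_enn2real[symmetric])
  also have "\<dots> < ennreal \<tau>"
    using assms(2) by (intro ennreal_lessI) (auto simp: kobayashi_dist_def intro: le_less_trans[OF enn2real_nonneg])
  finally obtain l where l: "l \<in> {kobayashi_length \<Omega> a b \<sigma> | a b \<sigma>.
      a \<le> b \<and> abs_cont_on a b \<sigma> \<and> \<sigma> ` {a..b} \<subseteq> \<Omega> \<and> \<sigma> a = x \<and> \<sigma> b = y}" "l < ennreal \<tau>"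
    unfolding Inf_less_iff by (rule bexE)
  from l(1) obtain a b \<sigma> where "l = kobayashi_length \<Omega> a b \<sigma>"
      "a \<le> b" "abs_cont_on a b \<sigma>" "\<sigma> ` {a..b} \<subseteq> \<Omega>" "\<sigma> a = x" "\<sigma> b = y"
    by (elim CollectE exE conjE) (rule that)
  with l(2) show ?thesis by (intro that) auto
qed

lemma kobayashi_metric_minus: "kobayashi_metric \<Omega> z (- v) = kobayashi_metric \<Omega> z v"
proof -
  have *: "kobayashi_disc \<Omega> z (- v) f (- \<xi>)" if "kobayashi_disc \<Omega> z v f \<xi>" for v f \<xi>
    using that by (auto simp: kobayashi_disc_def vec_eq_iff)
  have "{norm \<xi> |\<xi> f. kobayashi_disc \<Omega> z (- v) f \<xi>} = {norm \<xi> |\<xi> f. kobayashi_disc \<Omega> z v f \<xi>}"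
    using *[of v] *[of "- v"] by (auto, metis norm_minus_cancel, metis minus_minus norm_minus_cancel)
  then show ?thesis by (simp add: kobayashi_metric_alt)
qed

lemma curve_bound_sym:
  assumes "curve_bound \<Omega> x y c"
  shows "curve_bound \<Omega> y x c"
proof -
  from assms obtain a b \<sigma> g L S where c: "a \<le> b" "L-lipschitz_on {a..b} \<sigma>" "\<sigma> ` {a..b} \<subseteq> \<Omega>" "\<sigma> a = x" "\<sigma> b = y"
    "g \<in> borel_measurable borel" "finite S"
    "\<And>t. t \<in> {a<..<b} - S \<Longrightarrow> \<exists>v. (\<sigma> has_vector_derivative v) (at t) \<and>
            ennreal (kobayashi_metric \<Omega> (\<sigma> t) v) \<le> g t"
    "(\<integral>\<^sup>+t\<in>{a..b}. g t \<partial>lborel) \<le> ennreal c"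
    by (rule curve_boundE) (rule that)
  show ?thesis
  proof (rule curve_boundI[of "-b" "-a" L "\<lambda>t. \<sigma> (- t)" \<Omega> y x "\<lambda>t. g (- t)" "uminus ` S"])
    show "L-lipschitz_on {-b..-a} (\<lambda>t. \<sigma> (- t))"
    proof (rule lipschitz_onI)
      fix s t assume "s \<in> {-b..-a}" "t \<in> {-b..-a}"
      then show "dist (\<sigma> (- s)) (\<sigma> (- t)) \<le> L * dist s t"
        using lipschitz_onD[OF c(2), of "- s" "- t"] by (auto simp: dist_real_def abs_minus_commute)
    qed (rule lipschitz_on_nonneg[OF c(2)])
    show "(\<lambda>t. \<sigma> (- t)) ` {-b..-a} \<subseteq> \<Omega>"
    proof (rule image_subsetI)
      fix t assume "t \<in> {-b..-a}"
      then have "- t \<in> {a..b}" by auto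
      then show "\<sigma> (- t) \<in> \<Omega>" using c(3) by blast
    qed
    show "(\<lambda>t. g (- t)) \<in> borel_measurable borel" using c(6) by measurable
    fix t assume t: "t \<in> {-b<..<-a} - uminus ` S"
    have "- t \<in> {a<..<b} - S" using t by (auto simp: image_iff)
    from c(8)[OF this] obtain v where v: "(\<sigma> has_vector_derivative v) (at (- t))"
            "ennreal (kobayashi_metric \<Omega> (\<sigma> (- t)) v) \<le> g (- t)" by blast
    have "(uminus has_vector_derivative (- 1)) (at t)"
      by (auto intro!: derivative_eq_intros simp: has_real_derivative_iff_has_vector_derivative[symmetric])
    from vector_diff_chain_at[OF this v(1)]
    have "((\<lambda>t. \<sigma> (- t)) has_vector_derivative - v) (at t)" by (simp add: o_def)
    then show "\<exists>v. ((\<lambda>t. \<sigma> (- t)) has_vector_derivative v) (at t) \<and>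
        ennreal (kobayashi_metric \<Omega> (\<sigma> (- t)) v) \<le> g (- t)"
      using v(2) kobayashi_metric_minus by metis
  next
    have "(\<integral>\<^sup>+t\<in>{a..b}. g t \<partial>lborel) = ennreal \<bar>- 1\<bar> * (\<integral>\<^sup>+t. g (0 + (- 1) * t) * indicator {a..b} (0 + (- 1) * t) \<partial>lborel)"
      by (rule nn_integral_real_affine) (use c(6) in \<open>auto intro!: measurable_compose\<close>)
    also have "\<dots> = (\<integral>\<^sup>+t\<in>{-b..-a}. g (- t) \<partial>lborel)"
      by (auto intro!: nn_integral_cong simp: indicator_def)
    finally show "(\<integral>\<^sup>+t\<in>{-b..-a}. g (- t) \<partial>lborel) \<le> ennreal c" using c(9) by simp
  qed (use c in auto)
qed

lemma curve_bound_trans: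
  assumes "curve_bound \<Omega> x y c" "curve_bound \<Omega> y z d" "c \<ge> 0" "d \<ge> 0"
  shows "curve_bound \<Omega> x z (c + d)"
proof -
  from assms(1) obtain a b \<sigma> g L S where c: "a \<le> b" "L-lipschitz_on {a..b} \<sigma>" "\<sigma> ` {a..b} \<subseteq> \<Omega>" "\<sigma> a = x" "\<sigma> b = y"
    "g \<in> borel_measurable borel" "finite S"
    "\<And>t. t \<in> {a<..<b} - S \<Longrightarrow> \<exists>v. (\<sigma> has_vector_derivative v) (at t) \<and>
            ennreal (kobayashi_metric \<Omega> (\<sigma> t) v) \<le> g t"
    "(\<integral>\<^sup>+t\<in>{a..b}. g t \<partial>lborel) \<le> ennreal c"
    by (rule curve_boundE) (rule that)
  from assms(2) obtain p q \<sigma>' h L' S' where d: "p \<le> q" "L'-lipschitz_on {p..q} \<sigma>'" "\<sigma>' ` {p..q} \<subseteq> \<Omega>" "\<sigma>' p = y" "\<sigma>' q = z"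
    "h \<in> borel_measurable borel" "finite S'"
    "\<And>t. t \<in> {p<..<q} - S' \<Longrightarrow> \<exists>v. (\<sigma>' has_vector_derivative v) (at t) \<and>
            ennreal (kobayashi_metric \<Omega> (\<sigma>' t) v) \<le> h t"
    "(\<integral>\<^sup>+t\<in>{p..q}. h t \<partial>lborel) \<le> ennreal d"
    by (rule curve_boundE) (rule that)
  define e where "e = p - b"
  let ?\<sigma> = "\<lambda>t. if t \<le> b then \<sigma> t else \<sigma>' (t + e)"
  let ?g = "\<lambda>t. if t \<le> b then g t else h (t + e)"
  let ?M = "max L L'"
  show ?thesis
  \<comment> \<open>The joint \<open>b\<close> may be a corner, hence the
    \<open>insert\<close>.\<close>
  proof (rule curve_boundI[of a "b + (q - p)" ?M ?\<sigma> \<Omega> x z ?g "insert b (S \<union> (\<lambda>t. t - e) ` S')"])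
    show "?M-lipschitz_on {a..b + (q - p)} ?\<sigma>"
    proof (rule lipschitz_on_concat)
      show "?M-lipschitz_on {a..b} \<sigma>" using c(2) by (rule lipschitz_on_mono) auto
      have "L'-lipschitz_on {b..b + (q - p)} (\<lambda>t. \<sigma>' (t + e))"
      proof (rule lipschitz_onI)
        fix s t assume "s \<in> {b..b + (q - p)}" "t \<in> {b..b + (q - p)}"
        then show "dist (\<sigma>' (s + e)) (\<sigma>' (t + e)) \<le> L' * dist s t"
          using lipschitz_onD[OF d(2), of "s + e" "t + e"] by (auto simp: dist_real_def e_def)
      qed (rule lipschitz_on_nonneg[OF d(2)])
      then show "?M-lipschitz_on {b..b + (q - p)} (\<lambda>t. \<sigma>' (t + e))" by (rule lipschitz_on_mono) auto
      show "\<sigma> b = \<sigma>' (b + e)" using c(5) d(4) by (simp add: e_def)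
    qed
    show "?\<sigma> ` {a..b + (q - p)} \<subseteq> \<Omega>"
    proof (rule image_subsetI)
      fix t assume t: "t \<in> {a..b + (q - p)}"
      show "?\<sigma> t \<in> \<Omega>"
      proof (cases "t \<le> b")
        case True
        then have "t \<in> {a..b}" using t by auto
        then show ?thesis using c(3) True by auto
      next
        case False
        then have "t + e \<in> {p..q}" using t by (auto simp: e_def)
        then show ?thesis using d(3) False by auto
      qed
    qed
    show "?g \<in> borel_measurable borel" using c(6) d(6) by measurable
    fix t assume t: "t \<in> {a<..<b + (q - p)} - insert b (S \<union> (\<lambda>t. t - e) ` S')"
    show "\<exists>v. (?\<sigma> has_vector_derivative v) (at t) \<and> ennreal (kobayashi_metric \<Omega> (?\<sigma> t) v) \<le> ?g t"
    proof (cases "t < b")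
      case True
      then obtain v where v: "(\<sigma> has_vector_derivative v) (at t)"
            "ennreal (kobayashi_metric \<Omega> (\<sigma> t) v) \<le> g t" using c(8)[of t] t by auto
      have "(?\<sigma> has_vector_derivative v) (at t)"
        using v(1) by (rule has_vector_derivative_transform_within_open[of _ _ _ "{..<b}"]) (use True in auto)
      then show ?thesis using v(2) True by auto
    next
      case False
      then have "t > b" using t by auto
      have "t + e \<in> {p<..<q} - S'"
        using t \<open>t > b\<close> by (auto simp: e_def image_iff)
      from d(8)[OF this] obtain v where v: "(\<sigma>' has_vector_derivative v) (at (t + e))"
            "ennreal (kobayashi_metric \<Omega> (\<sigma>' (t + e)) v) \<le> h (t + e)" by blast
      have "((\<lambda>t. t + e) has_vector_derivative 1) (at t)"
        by (auto intro!: derivative_eq_intros simp: has_real_derivative_iff_has_vector_derivative[symmetric])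
      from vector_diff_chain_at[OF this v(1)]
      have "((\<lambda>t. \<sigma>' (t + e)) has_vector_derivative v) (at t)" by (simp add: o_def)
      then have "(?\<sigma> has_vector_derivative v) (at t)"
        by (rule has_vector_derivative_transform_within_open[of _ _ _ "{b<..}"]) (use \<open>t > b\<close> in auto)
      then show ?thesis using v(2) \<open>t > b\<close> by auto
    qed
  next
    have "(\<integral>\<^sup>+t\<in>{p..q}. h t \<partial>lborel) = ennreal \<bar>1\<bar> * (\<integral>\<^sup>+t. h (e + 1 * t) * indicator {p..q} (e + 1 * t) \<partial>lborel)"
      by (rule nn_integral_real_affine) (use d(6) in auto)
    also have "\<dots> = (\<integral>\<^sup>+t\<in>{b..b + (q - p)}. h (t + e) \<partial>lborel)"
      by (auto intro!: nn_integral_cong simp: indicator_def e_def add.commute)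
    finally have he: "(\<integral>\<^sup>+t\<in>{b..b + (q - p)}. h (t + e) \<partial>lborel) \<le> ennreal d" using d(9) by simp
    have "(\<integral>\<^sup>+t\<in>{a..b + (q - p)}. ?g t \<partial>lborel)
        \<le> (\<integral>\<^sup>+t. g t * indicator {a..b} t + h (t + e) * indicator {b..b + (q - p)} t \<partial>lborel)"
      by (intro nn_integral_mono) (auto simp: indicator_def)
    also have "\<dots> = (\<integral>\<^sup>+t\<in>{a..b}. g t \<partial>lborel) + (\<integral>\<^sup>+t\<in>{b..b + (q - p)}. h (t + e) \<partial>lborel)"
      by (rule nn_integral_add) (use c(6) d(6) in measurable)
    also have "\<dots> \<le> ennreal c + ennreal d" using c(9) he by (rule add_mono)
    finally show "(\<integral>\<^sup>+t\<in>{a..b + (q - p)}. ?g t \<partial>lborel) \<le> ennreal (c + d)"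
      using assms(3,4) by simp
  next
    show "?\<sigma> (b + (q - p)) = z" using c(5) d(1,4,5) by (auto simp: e_def)
  qed (use c d in auto)
qed

lemma curve_bound_segment:
  assumes "z \<in> \<Omega>" "w \<in> \<Omega>" "convex \<Omega>" "r > 0"
    and "\<And>x. x \<in> closed_segment z w \<Longrightarrow> ball x r \<subseteq> \<Omega>"
  shows "curve_bound \<Omega> z w (norm (w - z) / r)"
proof (rule curve_boundI[of 0 1 "norm (w - z)" "\<lambda>t. z + t *\<^sub>R (w - z)" \<Omega> z w "\<lambda>_. ennreal (norm (w - z) / r)" "{}"])
  show "(norm (w - z))-lipschitz_on {0..1} (\<lambda>t. z + t *\<^sub>R (w - z))"
    by (rule lipschitz_onI) (auto simp: dist_norm scaleR_diff_left[symmetric] mult.commute)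
  have seg: "z + t *\<^sub>R (w - z) \<in> closed_segment z w" if "t \<in> {0..1}" for t
    using that by (auto simp: in_segment algebra_simps intro!: exI[of _ t])
  then show "(\<lambda>t. z + t *\<^sub>R (w - z)) ` {0..1} \<subseteq> \<Omega>"
    using closed_segment_subset[OF assms(1,2,3)] by blast
  fix t :: real assume t: "t \<in> {0<..<1} - {}"
  have "((\<lambda>t. z + t *\<^sub>R (w - z)) has_vector_derivative (w - z)) (at t)"
    by (auto intro!: derivative_eq_intros)
  moreover have "kobayashi_metric \<Omega> (z + t *\<^sub>R (w - z)) (w - z) \<le> norm (w - z) / r"
    by (rule kobayashi_metric_ball_bound(1)[OF assms(5)[OF seg] assms(4)]) (use t in auto)
  ultimately show "\<exists>v. ((\<lambda>t. z + t *\<^sub>R (w - z)) has_vector_derivative v) (at t) \<and>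
      ennreal (kobayashi_metric \<Omega> (z + t *\<^sub>R (w - z)) v) \<le> ennreal (norm (w - z) / r)"
    using ennreal_leI by blast
qed (auto simp: nn_integral_cmult_indicator)

lemma kobayashi_length_subinterval:
  "a \<le> c \<Longrightarrow> d \<le> b \<Longrightarrow> kobayashi_length \<Omega> c d \<sigma> \<le> kobayashi_length \<Omega> a b \<sigma>"
  unfolding kobayashi_length_def by (rule nn_integral_mono) (auto simp: indicator_def)

section \<open>Kobayashi distance on bounded convex domains\<close>

locale bounded_convex_domain =
  fixes \<Omega> :: "(complex ^ 'n) set"
  assumes open_dom: "open \<Omega>" and bounded_dom: "bounded \<Omega>" and convex_dom: "convex \<Omega>"
begin

lemma bdist_pos': "z \<in> \<Omega> \<Longrightarrow> bdist \<Omega> z > 0"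
  by (rule bdist_pos[OF open_dom bounded_dom])

lemma curve_bound_straight:
  assumes "z \<in> \<Omega>" "w \<in> \<Omega>" "r > 0" "r \<le> bdist \<Omega> z" "r \<le> bdist \<Omega> w"
  shows "curve_bound \<Omega> z w (norm (w - z) / r)"
proof (rule curve_bound_segment[OF assms(1,2) convex_dom assms(3)])
  fix x assume x: "x \<in> closed_segment z w"
  have "r \<le> bdist \<Omega> x"
    using bdist_segment[OF open_dom bounded_dom convex_dom assms(1,2) x assms(4,5)] .
  moreover have "x \<in> \<Omega>" using closed_segment_subset[OF assms(1,2) convex_dom] x by blast
  ultimately show "ball x r \<subseteq> \<Omega>" using ball_bdist_subset[of x \<Omega>] by (meson subset_ball subset_trans)
qed

lemma kobayashi_dist_straight:
  assumes "z \<in> \<Omega>" "w \<in> \<Omega>" "r > 0" "r \<le> bdist \<Omega> z" "r \<le> bdist \<Omega> w"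
  shows "kobayashi_dist \<Omega> z w \<le> norm (w - z) / r"
  by (rule curve_bound_dist[OF curve_bound_straight[OF assms]]) (use assms(3) in simp)

lemma obtain_curve:
  assumes "z \<in> \<Omega>" "w \<in> \<Omega>" "kobayashi_dist \<Omega> z w < \<tau>"
  obtains a b \<sigma> where "a \<le> b" "abs_cont_on a b \<sigma>" "\<sigma> ` {a..b} \<subseteq> \<Omega>" "\<sigma> a = z" "\<sigma> b = w"
    "kobayashi_length \<Omega> a b \<sigma> < ennreal \<tau>"
proof -
  have "curve_bound \<Omega> z w (norm (w - z) / min (bdist \<Omega> z) (bdist \<Omega> w))"
    by (rule curve_bound_straight) (use assms bdist_pos' in auto)
  from kobayashi_dist_obtain_curve[OF this assms(3)] that show ?thesis by blast
qed

text \<open>Compare with the half space supporting \<open>\<Omega>\<close> at the boundary point nearest to \<open>\<sigma> s\<close>.\<close>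

lemma bdist_along_curve:
  assumes \<sigma>: "abs_cont_on p q \<sigma>" "\<sigma> ` {p..q} \<subseteq> \<Omega>" "kobayashi_length \<Omega> p q \<sigma> < ennreal \<tau>"
    and t: "s \<in> {p..q}" "t \<in> {p..q}"
  shows "ln (bdist \<Omega> (\<sigma> t)) - ln (bdist \<Omega> (\<sigma> s)) \<le> 2 * \<tau>"
proof -
  have in\<Omega>: "\<sigma> s \<in> \<Omega>" "\<sigma> t \<in> \<Omega>" using \<sigma>(2) t by auto
  obtain a M where a: "norm a = 1" "\<And>x. x \<in> \<Omega> \<Longrightarrow> a \<bullet> x < M" "M - a \<bullet> \<sigma> s = bdist \<Omega> (\<sigma> s)"
    "\<And>x. x \<in> \<Omega> \<Longrightarrow> bdist \<Omega> x \<le> M - a \<bullet> x"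
    using nearest_half_space[OF open_dom bounded_dom convex_dom in\<Omega>(1)] by blast
  let ?u = "min s t" and ?v = "max s t"
  have "ennreal (\<bar>ln (M - a \<bullet> \<sigma> ?v) - ln (M - a \<bullet> \<sigma> ?u)\<bar> / 2) \<le> kobayashi_length \<Omega> ?u ?v \<sigma>"
  proof (rule kobayashi_length_ge_log[OF open_dom _ _ _ a(1,2)])
    show "abs_cont_on ?u ?v \<sigma>" by (rule abs_cont_on_subinterval[OF \<sigma>(1)]) (use t in auto)
    have "{?u..?v} \<subseteq> {p..q}" using t by auto
    then show "\<sigma> ` {?u..?v} \<subseteq> \<Omega>" using \<sigma>(2) by blast
  qed auto
  also have "\<dots> \<le> kobayashi_length \<Omega> p q \<sigma>"
    by (rule kobayashi_length_subinterval) (use t in auto)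
  also have "\<dots> < ennreal \<tau>" by (rule \<sigma>(3))
  finally have "\<bar>ln (M - a \<bullet> \<sigma> ?v) - ln (M - a \<bullet> \<sigma> ?u)\<bar> < 2 * \<tau>"
    by (subst (asm) ennreal_less_iff) auto
  then have "ln (M - a \<bullet> \<sigma> t) - ln (M - a \<bullet> \<sigma> s) < 2 * \<tau>"
    by (auto simp: min_def max_def split: if_splits)
  moreover have "ln (bdist \<Omega> (\<sigma> t)) \<le> ln (M - a \<bullet> \<sigma> t)"
    using a(4)[OF in\<Omega>(2)] bdist_pos'[OF in\<Omega>(2)] by simp
  ultimately show ?thesis using a(3) by simp
qed

lemma kobayashi_dist_ge_log:
  assumes "z \<in> \<Omega>" "w \<in> \<Omega>"
  shows "\<bar>ln (bdist \<Omega> w) - ln (bdist \<Omega> z)\<bar> \<le> 2 * kobayashi_dist \<Omega> z w"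
proof -
  have "\<bar>ln (bdist \<Omega> w) - ln (bdist \<Omega> z)\<bar> / 2 \<le> \<tau>" if lt: "kobayashi_dist \<Omega> z w < \<tau>" for \<tau>
  proof -
    obtain a b \<sigma> where c: "a \<le> b" "abs_cont_on a b \<sigma>" "\<sigma> ` {a..b} \<subseteq> \<Omega>" "\<sigma> a = z" "\<sigma> b = w"
      "kobayashi_length \<Omega> a b \<sigma> < ennreal \<tau>"
      by (rule obtain_curve[OF assms lt]) (rule that)
    from bdist_along_curve[OF c(2,3,6), of a b] bdist_along_curve[OF c(2,3,6), of b a] c
    show ?thesis by auto
  qed
  then have "\<bar>ln (bdist \<Omega> w) - ln (bdist \<Omega> z)\<bar> / 2 \<le> kobayashi_dist \<Omega> z w"
    by (rule dense_ge)
  then show ?thesis by simp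
qed

text \<open>Along a curve of Kobayashi length below \<open>\<tau>\<close> the boundary distance is
  at most \<open>exp (2 * \<tau>)\<close> times its value at \<open>y\<close>. The directional bound
  thus becomes uniform on the curve, and Euclidean displacement is at most a constant times
  Kobayashi length. Either endpoint may serve as \<open>y\<close>: later the one farther from the
  top of a quasi-geodesic is chosen.\<close>

lemma norm_le_kobayashi_dist:
  assumes C: "C > 0" "\<And>z v. z \<in> \<Omega> \<Longrightarrow> v \<noteq> 0 \<Longrightarrow> bdist_dir \<Omega> z v \<le> C * bdist \<Omega> z powr (1 / m)"
    and m: "m > 0" and zw: "z \<in> \<Omega>" "w \<in> \<Omega>" "kobayashi_dist \<Omega> z w < \<tau>" and y: "y = z \<or> y = w"
  shows "norm (w - z) \<le> 2 * C * exp (2 * \<tau> / m) * bdist \<Omega> y powr (1 / m) * \<tau>"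
proof -
  obtain p q \<sigma> where c: "p \<le> q" "abs_cont_on p q \<sigma>" "\<sigma> ` {p..q} \<subseteq> \<Omega>" "\<sigma> p = z" "\<sigma> q = w"
    "kobayashi_length \<Omega> p q \<sigma> < ennreal \<tau>"
    by (rule obtain_curve[OF zw]) (rule that)
  from y obtain s where s: "s \<in> {p..q}" "\<sigma> s = y" using c by auto
  have yp: "bdist \<Omega> y > 0" using bdist_pos' zw y by auto
  define B where "B = 2 * C * exp (2 * \<tau> / m) * bdist \<Omega> y powr (1 / m)"
  have B: "B > 0" using C(1) yp by (simp add: B_def)
  have le: "norm v \<le> B * kobayashi_metric \<Omega> (\<sigma> t) v" if t: "t \<in> {p..q}" for t v
  proof -
    have in\<Omega>: "\<sigma> t \<in> \<Omega>" using c(3) t by auto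
    note k0 = kobayashi_metric_nonneg[OF open_dom in\<Omega>, of v]
    show ?thesis
    proof (cases "v = 0")
      case False
      have tp: "bdist \<Omega> (\<sigma> t) > 0" by (rule bdist_pos'[OF in\<Omega>])
      have "ln (bdist \<Omega> (\<sigma> t)) \<le> ln (bdist \<Omega> y) + 2 * \<tau>"
        using bdist_along_curve[OF c(2,3,6) s(1) t] s(2) by simp
      then have "ln (bdist \<Omega> (\<sigma> t)) / m \<le> ln (bdist \<Omega> y) / m + 2 * \<tau> / m"
        using m by (simp add: divide_right_mono flip: add_divide_distrib)
      then have "bdist \<Omega> (\<sigma> t) powr (1 / m) \<le> bdist \<Omega> y powr (1 / m) * exp (2 * \<tau> / m)"
        using tp yp by (simp add: powr_def flip: exp_add)
      then have "C * bdist \<Omega> (\<sigma> t) powr (1 / m) \<le> C * (bdist \<Omega> y powr (1 / m) * exp (2 * \<tau> / m))"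
        using C(1) by (intro mult_left_mono) auto
      then have "2 * bdist_dir \<Omega> (\<sigma> t) v \<le> B"
        using C(2)[OF in\<Omega> False] by (simp add: B_def algebra_simps)
      from mult_right_mono[OF this k0] show ?thesis
        using kobayashi_metric_ge_bdist_dir[OF open_dom bounded_dom convex_dom in\<Omega> False] by linarith
    qed (use k0 B in auto)
  qed
  have "ennreal (norm (\<sigma> q - \<sigma> p) / B) \<le> kobayashi_length \<Omega> p q \<sigma>"
    by (rule kobayashi_length_ge_norm[OF c(2,1) B]) (rule le)
  from le_less_trans[OF this c(6)]
  have "norm (w - z) / B < \<tau>"
    using c(4,5) B by (subst (asm) ennreal_less_iff) auto
  then show ?thesis using B by (simp add: B_def field_simps)
qed

end

section \<open>Interior cones and upper bounds\<close>

text \<open>Near \<open>p\<close> the gradient stays within \<open>\<epsilon> * G\<close> of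
  \<open>g p\<close>, so \<open>r\<close> decreases in every direction of the cone about
  \<open>- g p\<close>. The mean value theorem is applied to \<open>r\<close> in a ball inside
  \<open>U\<close>, so the segment is not assumed to lie in \<open>\<Omega>\<close>
  beforehand.\<close>

lemma local_defining_cone:
  fixes \<Omega> :: "(complex ^ 'n) set"
  assumes "local_defining \<Omega> p U r g" "\<epsilon> > 0"
  obtains \<rho> \<nu> where "\<rho> > 0" "norm \<nu> = 1"
    "\<And>u z. u \<in> \<Omega> \<Longrightarrow> u \<in> ball p \<rho> \<Longrightarrow> u + z \<in> ball p \<rho> \<Longrightarrow> z \<bullet> \<nu> > \<epsilon> * norm z \<Longrightarrow> u + z \<in> \<Omega>"
proof -
  have U: "open U" "p \<in> U" "continuous_on U g" "\<And>x. x \<in> U \<Longrightarrow> GDERIV r x :> g x \<and> g x \<noteq> 0"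
    "\<Omega> \<inter> U = {x \<in> U. r x < 0}"
    using assms(1) by (auto simp: local_defining_def)
  define G where "G = norm (g p)"
  have G: "G > 0" using U(2,4) by (simp add: G_def)
  have "isCont g p" using U(1-3) by (simp add: continuous_on_eq_continuous_at)
  then obtain d where d: "d > 0" "\<And>x. dist x p < d \<Longrightarrow> dist (g x) (g p) < \<epsilon> * G"
    using G assms(2) unfolding continuous_at_eps_delta by (metis mult_pos_pos)
  obtain e where e: "e > 0" "ball p e \<subseteq> U" using U(1,2) openE by blast
  let ?\<rho> = "min d e"
  let ?\<nu> = "- (g p /\<^sub>R G)"
  show ?thesis
  proof (rule that[of ?\<rho> ?\<nu>])
    show "?\<rho> > 0" using d(1) e(1) by simp
    show "norm ?\<nu> = 1" using G by (simp add: G_def)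
    fix u z assume u: "u \<in> \<Omega>" "u \<in> ball p ?\<rho>" "u + z \<in> ball p ?\<rho>" "z \<bullet> ?\<nu> > \<epsilon> * norm z"
    have seg: "u + t *\<^sub>R z \<in> ball p ?\<rho>" if "0 \<le> t" "t \<le> 1" for t
    proof -
      have "(1 - t) *\<^sub>R u + t *\<^sub>R (u + z) \<in> ball p ?\<rho>"
        by (rule convexD[OF convex_ball u(2,3)]) (use that in auto)
      then show ?thesis by (simp add: algebra_simps)
    qed
    have segU: "u + t *\<^sub>R z \<in> U" if "0 \<le> t" "t \<le> 1" for t
      using seg[OF that] e(2) by auto
    have der: "((\<lambda>t. r (u + t *\<^sub>R z)) has_real_derivative g (u + t *\<^sub>R z) \<bullet> z) (at t)" if "0 \<le> t" "t \<le> 1" for t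
    proof -
      have "(r has_derivative (\<lambda>h. h \<bullet> g (u + t *\<^sub>R z))) (at (u + t *\<^sub>R z))"
        using U(4)[OF segU[OF that]] by (simp add: gderiv_def)
      moreover have "((\<lambda>t. u + t *\<^sub>R z) has_derivative (\<lambda>t. t *\<^sub>R z)) (at t)"
        by (auto intro!: derivative_eq_intros)
      ultimately have "((\<lambda>t. r (u + t *\<^sub>R z)) has_derivative (\<lambda>s. (s *\<^sub>R z) \<bullet> g (u + t *\<^sub>R z))) (at t)"
        by (rule has_derivative_compose[rotated])
      then show ?thesis by (simp add: has_field_derivative_def inner_commute mult.commute[of _ "_ \<bullet> _"])
    qed
    have "\<exists>t. 0 < t \<and> t < 1 \<and> r (u + 1 *\<^sub>R z) - r (u + 0 *\<^sub>R z) = (1 - 0) * (g (u + t *\<^sub>R z) \<bullet> z)"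
      by (rule MVT2) (use der in auto)
    then obtain t where t: "0 < t" "t < 1" "r (u + z) - r u = g (u + t *\<^sub>R z) \<bullet> z" by auto
    have "z \<noteq> 0" using u(4) by auto
    have "(g (u + t *\<^sub>R z) - g p) \<bullet> z \<le> norm (g (u + t *\<^sub>R z) - g p) * norm z"
      by (rule norm_cauchy_schwarz)
    also have "\<dots> \<le> \<epsilon> * G * norm z"
    proof (rule mult_right_mono)
      have "dist (u + t *\<^sub>R z) p < d" using seg[of t] t by (simp add: dist_commute)
      then show "norm (g (u + t *\<^sub>R z) - g p) \<le> \<epsilon> * G" using d(2) by (simp add: dist_norm less_imp_le)
    qed simp
    also have "\<dots> < - (g p \<bullet> z)"
    proof -
      have "\<epsilon> * norm z < - (g p \<bullet> z) / G" using u(4) by (simp add: inner_commute divide_inverse mult.commute)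
      then show ?thesis using G by (simp add: field_simps)
    qed
    finally have "g (u + t *\<^sub>R z) \<bullet> z < 0" by (simp add: inner_diff_left)
    moreover have "r u < 0" using U(5) u(1) segU[of 0] by auto
    ultimately have "r (u + z) < 0" using t(3) by simp
    moreover have "u + z \<in> U" using segU[of 1] by simp
    ultimately show "u + z \<in> \<Omega>" using U(5) by auto
  qed
qed

text \<open>A Lebesgue number for a cover of the compact closure makes the size of the cones
  uniform. Interior points join the cover with an arbitrary direction, since a whole ball around
  them lies in \<open>\<Omega>\<close>. Halving the number keeps both \<open>u\<close> and
  \<open>u + z\<close> in one ball of the cover.\<close>

lemma uniform_cone:
  fixes \<Omega> :: "(complex ^ 'n) set"
  assumes "open \<Omega>" "bounded \<Omega>" "C1_boundary \<Omega>" "\<epsilon> > 0"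
  obtains r0 where "r0 > 0"
    "\<And>x. x \<in> \<Omega> \<Longrightarrow> \<exists>\<nu>. norm \<nu> = 1 \<and> (\<forall>u z. u \<in> \<Omega> \<longrightarrow> norm (u - x) < r0 \<longrightarrow> norm z < r0 \<longrightarrow>
        z \<bullet> \<nu> > \<epsilon> * norm z \<longrightarrow> u + z \<in> \<Omega>)"
proof -
  define P where "P = (\<lambda>p \<rho>. \<rho> > 0 \<and> (\<exists>\<nu>. norm \<nu> = 1 \<and> (\<forall>u z. u \<in> \<Omega> \<longrightarrow> u \<in> ball p \<rho> \<longrightarrow>
      u + z \<in> ball p \<rho> \<longrightarrow> z \<bullet> \<nu> > \<epsilon> * norm z \<longrightarrow> u + z \<in> \<Omega>)))"
  have ex: "\<exists>\<rho>. P p \<rho>" if "p \<in> closure \<Omega>" for p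
  proof (cases "p \<in> \<Omega>")
    case True
    then obtain e where e: "e > 0" "ball p e \<subseteq> \<Omega>" using assms(1) openE by blast
    obtain \<nu> :: "complex ^ 'n" where "norm \<nu> = 1" using vector_choose_size[of 1] by auto
    with e show ?thesis unfolding P_def by (intro exI[of _ e] conjI exI[of _ \<nu>]) auto
  next
    case False
    then have "p \<in> frontier \<Omega>" using that assms(1) by (simp add: frontier_def interior_open)
    then obtain U r g where "local_defining \<Omega> p U r g" using assms(3) by (auto simp: C1_boundary_def)
    from local_defining_cone[OF this assms(4)] show ?thesis unfolding P_def by metis
  qed
  let ?G = "{ball p \<rho> | p \<rho>. P p \<rho>}"
  have cmp: "compact (closure \<Omega>)" using assms(2) by simp
  have cov: "closure \<Omega> \<subseteq> \<Union>?G"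
  proof
    fix p assume "p \<in> closure \<Omega>"
    with ex obtain \<rho> where "P p \<rho>" by blast
    then show "p \<in> \<Union>?G" by (intro UnionI[of "ball p \<rho>"]) (auto simp: P_def)
  qed
  obtain e where e: "e > 0" "\<And>x. x \<in> closure \<Omega> \<Longrightarrow> \<exists>b\<in>?G. ball x e \<subseteq> b"
    by (rule Heine_Borel_lemma[OF cmp cov]) (auto intro: that)
  show ?thesis
  proof (rule that[of "e / 2"])
    show "e / 2 > 0" using e(1) by simp
    fix x assume "x \<in> \<Omega>"
    then obtain p \<rho> where p: "P p \<rho>" "ball x e \<subseteq> ball p \<rho>" using e(2)[of x] closure_subset by blast
    then obtain \<nu> where \<nu>: "norm \<nu> = 1" "\<And>u z. u \<in> \<Omega> \<Longrightarrow> u \<in> ball p \<rho> \<Longrightarrow>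
      u + z \<in> ball p \<rho> \<Longrightarrow> z \<bullet> \<nu> > \<epsilon> * norm z \<Longrightarrow> u + z \<in> \<Omega>" unfolding P_def by blast
    show "\<exists>\<nu>. norm \<nu> = 1 \<and> (\<forall>u z. u \<in> \<Omega> \<longrightarrow> norm (u - x) < e / 2 \<longrightarrow> norm z < e / 2 \<longrightarrow>
        z \<bullet> \<nu> > \<epsilon> * norm z \<longrightarrow> u + z \<in> \<Omega>)"
    proof (intro exI[of _ \<nu>] conjI \<nu>(1) allI impI)
      fix u z assume u: "u \<in> \<Omega>" "norm (u - x) < e / 2" "norm z < e / 2" "z \<bullet> \<nu> > \<epsilon> * norm z"
      have "norm (u + z - x) \<le> norm (u - x) + norm z" by (metis add_diff_eq diff_add_eq norm_triangle_ineq)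
      then have "u \<in> ball x e" "u + z \<in> ball x e"
        using u(2,3) e(1) by (auto simp: dist_norm norm_minus_commute)
      then show "u + z \<in> \<Omega>" using \<nu>(2)[OF u(1) _ _ u(4)] p(2) by blast
    qed
  qed
qed

section \<open>The Kobayashi metric on the axis of a cone\<close>

lemma hermitian_self: "hermitian v v = of_real ((norm v)\<^sup>2)"
proof -
  have "(norm v)\<^sup>2 = (\<Sum>i\<in>UNIV. (norm (v $ i))\<^sup>2)"
    by (simp add: norm_vec_def L2_set_def sum_nonneg)
  then show ?thesis by (simp only: hermitian_def complex_norm_square of_real_sum)
qed

text \<open>The real part is \<open>(1 - |w|^2) / |1 - w|^2\<close> and the modulus is at most
  \<open>(1 + |w|^2) / |1 - w|^2\<close>, so for \<open>|w| < q\<close> their ratio exceeds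
  \<open>(1 - q^2) / 2\<close>. This number becomes the cosine of the half opening of the
  cone.\<close>

lemma Cayley_in_sector:
  fixes w :: complex
  assumes "norm w < q" "q < 1"
  shows "(1 - q\<^sup>2) / 2 * norm ((1 + w) / (1 - w)) < Re ((1 + w) / (1 - w))"
    "norm ((1 + w) / (1 - w)) \<le> (1 + q) / (1 - q)" "w \<noteq> 1"
proof -
  have w1: "w \<noteq> 1" using assms by auto
  then show "w \<noteq> 1" .
  define N where "N = (norm (1 - w))\<^sup>2"
  have N: "N > 0" using w1 by (simp add: N_def)
  have q0: "0 \<le> q" using assms(1) norm_ge_zero[of w] by linarith
  have wq: "(norm w)\<^sup>2 < q\<^sup>2" using assms(1) by (intro power_strict_mono) auto
  have q1: "q\<^sup>2 < 1" using q0 assms(2) by (simp add: power_less_one_iff)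
  have R: "Re ((1 + w) / (1 - w)) = (1 - (norm w)\<^sup>2) / N"
  proof -
    have "(1 + w) / (1 - w) = ((1 + w) * cnj (1 - w)) / of_real N"
      unfolding N_def by (metis complex_div_cnj of_real_power)
    moreover have "Re ((1 + w) * cnj (1 - w)) = 1 - (norm w)\<^sup>2"
      unfolding cmod_power2 by (simp add: power2_eq_square algebra_simps)
    ultimately show ?thesis by (simp only: Re_divide_of_real)
  qed
  have "norm ((1 + w) / (1 - w)) = norm ((1 + w) * (1 - w)) / N"
    using w1 by (simp add: N_def norm_divide norm_mult power2_eq_square)
  also have "norm ((1 + w) * (1 - w)) = norm (1 - w\<^sup>2)" by (simp add: power2_eq_square algebra_simps)
  also have "\<dots> \<le> 1 + (norm w)\<^sup>2" using norm_triangle_ineq4[of 1 "w\<^sup>2"] by (simp add: norm_power)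
  finally have "norm ((1 + w) / (1 - w)) \<le> (1 + (norm w)\<^sup>2) / N"
    using N by (simp add: divide_right_mono)
  then have "(1 - q\<^sup>2) / 2 * norm ((1 + w) / (1 - w)) \<le> (1 - q\<^sup>2) / 2 * ((1 + (norm w)\<^sup>2) / N)"
    using q1 by (intro mult_left_mono) auto
  also have "\<dots> = ((1 - q\<^sup>2) / 2 * (1 + (norm w)\<^sup>2)) / N" by simp
  also have "\<dots> < (1 - (norm w)\<^sup>2) / N"
  proof (rule divide_strict_right_mono[OF _ N])
    have "(1 - q\<^sup>2) * (1 + (norm w)\<^sup>2) \<le> (1 - q\<^sup>2) * 2"
      using q1 wq by (intro mult_left_mono) auto
    then show "(1 - q\<^sup>2) / 2 * (1 + (norm w)\<^sup>2) < 1 - (norm w)\<^sup>2" using wq by simp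
  qed
  finally show "(1 - q\<^sup>2) / 2 * norm ((1 + w) / (1 - w)) < Re ((1 + w) / (1 - w))" unfolding R .
  have "norm (1 + w) \<le> 1 + q" using norm_triangle_ineq[of 1 w] assms(1) by simp
  moreover have "1 - q \<le> norm (1 - w)" using norm_triangle_ineq2[of 1 w] assms(1) by simp
  ultimately show "norm ((1 + w) / (1 - w)) \<le> (1 + q) / (1 - q)"
    unfolding norm_divide using assms(2) by (intro frac_le) (auto simp: q0)
qed

text \<open>The disc is the image of the disc of radius \<open>q\<close> under the Cayley map onto the half plane with
  \<open>s\<close> as the image of \<open>0\<close>; it stays in a sector, hence in the cone, and loses only the factor \<open>1 / q\<close>
  against the half plane metric \<open>1 / (2 * s)\<close>.\<close>

lemma kobayashi_metric_cone:
  fixes u \<nu> :: "complex ^ 'n"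
  assumes q: "0 < q" "q < 1" and \<nu>: "norm \<nu> = 1" and s: "s > 0" "s * ((1 + q) / (1 - q)) < r0"
    and cone: "\<And>z. norm z < r0 \<Longrightarrow> z \<bullet> \<nu> > (1 - q\<^sup>2) / 2 * norm z \<Longrightarrow> u + z \<in> \<Omega>"
  shows "kobayashi_metric \<Omega> (u + s *\<^sub>R \<nu>) \<nu> \<le> 1 / (2 * q * s)"
proof -
  \<comment> \<open>Subtracting \<open>s\<close> recentres the Cayley image, so that
    \<open>\<phi>\<close> vanishes at \<open>0\<close>; the derivative there is
    \<open>2 * q * s\<close>.\<close>
  define \<phi> where "\<phi> = (\<lambda>\<zeta>. of_real s * ((1 + of_real q * \<zeta>) / (1 - of_real q * \<zeta>)) - of_real s :: complex)"
  have nw: "norm (of_real q * \<zeta> :: complex) < q" if "\<zeta> \<in> ball 0 1" for \<zeta>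
    using that q by (simp add: norm_mult)
  have nz: "1 - of_real q * \<zeta> \<noteq> (0 :: complex)" if "\<zeta> \<in> ball 0 1" for \<zeta>
    using Cayley_in_sector(3)[OF nw[OF that] q(2)] by auto
  have "(\<phi> has_field_derivative (of_real s * (2 * of_real q))) (at 0)"
    unfolding \<phi>_def by (auto intro!: derivative_eq_intros)
  then have d: "deriv \<phi> 0 = of_real (2 * q * s)" by (simp add: DERIV_imp_deriv)
  have "kobayashi_disc \<Omega> (u + s *\<^sub>R \<nu>) (1 *s \<nu>) (\<lambda>\<zeta>. (u + s *\<^sub>R \<nu>) + \<phi> \<zeta> *s \<nu>) (1 / deriv \<phi> 0)"
  proof (rule kobayashi_disc_line)
    show "\<phi> holomorphic_on ball 0 1"
      unfolding \<phi>_def by (intro holomorphic_intros) (use nz in auto)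
    show "\<phi> 0 = 0" by (simp add: \<phi>_def)
    show "deriv \<phi> 0 \<noteq> 0" using d q(1) s(1) by simp
    fix \<zeta> :: complex assume \<zeta>: "\<zeta> \<in> ball 0 1"
    define c where "c = (1 + of_real q * \<zeta>) / (1 - of_real q * \<zeta> :: complex)"
    note S = Cayley_in_sector(1,2)[OF nw[OF \<zeta>] q(2), folded c_def]
    let ?z = "(of_real s * c) *s \<nu>"
    have "norm ?z = s * norm c" using \<nu> s(1) by (simp add: norm_vector_scalar_mult norm_mult)
    moreover have "s * norm c < r0" using mult_left_mono[OF S(2), of s] s by simp
    moreover have "?z \<bullet> \<nu> = s * Re c"
    proof -
      have "?z \<bullet> \<nu> = Re (hermitian \<nu> ?z)" by (simp add: Re_hermitian inner_commute)
      then show ?thesis using \<nu> by (simp add: hermitian_scale hermitian_self)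
    qed
    moreover have "(1 - q\<^sup>2) / 2 * (s * norm c) < s * Re c"
      using mult_strict_left_mono[OF S(1) s(1)] by (simp add: algebra_simps)
    ultimately have "u + ?z \<in> \<Omega>" by (intro cone) auto
    moreover have "\<phi> \<zeta> = of_real s * c - of_real s" by (simp add: \<phi>_def c_def)
    then have "u + ?z = u + s *\<^sub>R \<nu> + \<phi> \<zeta> *s \<nu>"
      by (simp add: vec_eq_iff) (simp add: scaleR_conv_of_real algebra_simps)
    ultimately show "u + s *\<^sub>R \<nu> + \<phi> \<zeta> *s \<nu> \<in> \<Omega>" by simp
  qed
  from kobayashi_metric_le[OF this] show ?thesis
    using d q(1) s(1) by (simp add: vector_smult_lid norm_divide norm_mult)
qed

lemma curve_bound_mono:
  assumes "curve_bound \<Omega> x y c" "c \<le> d"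
  shows "curve_bound \<Omega> x y d"
  using assms(1)
proof (rule curve_boundE)
  fix a b :: real and \<sigma> g L and S :: "real set"
  assume "(\<integral>\<^sup>+t\<in>{a..b}. g t \<partial>lborel) \<le> ennreal c"
  with assms(2) have "(\<integral>\<^sup>+t\<in>{a..b}. g t \<partial>lborel) \<le> ennreal d"
    by (meson ennreal_leI order_trans)
  moreover assume "a \<le> b" "L-lipschitz_on {a..b} \<sigma>" "\<sigma> ` {a..b} \<subseteq> \<Omega>" "\<sigma> a = x" "\<sigma> b = y"
    "g \<in> borel_measurable borel" "finite S"
    "\<And>t. t \<in> {a<..<b} - S \<Longrightarrow> \<exists>v. (\<sigma> has_vector_derivative v) (at t) \<and>
            ennreal (kobayashi_metric \<Omega> (\<sigma> t) v) \<le> g t"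
  ultimately show ?thesis by (intro curve_boundI)
qed

lemma curve_bound_radial:
  fixes u \<nu> :: "complex ^ 'n"
  assumes A: "A > 0" and s: "0 < s1" "s1 \<le> s2" and \<nu>: "norm \<nu> = 1"
    and sub: "\<And>s. s \<in> {s1..s2} \<Longrightarrow> u + s *\<^sub>R \<nu> \<in> \<Omega>"
    and met: "\<And>s. s \<in> {s1..s2} \<Longrightarrow> kobayashi_metric \<Omega> (u + s *\<^sub>R \<nu>) \<nu> \<le> A / (2 * s)"
  shows "curve_bound \<Omega> (u + s1 *\<^sub>R \<nu>) (u + s2 *\<^sub>R \<nu>) (A / 2 * (ln s2 - ln s1))"
proof (rule curve_boundI[of s1 s2 1 "\<lambda>s. u + s *\<^sub>R \<nu>" \<Omega> _ _ "\<lambda>s. ennreal (A / (2 * s))" "{}"])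
  show "1-lipschitz_on {s1..s2} (\<lambda>s. u + s *\<^sub>R \<nu>)"
    by (rule lipschitz_onI) (auto simp: dist_norm scaleR_diff_left[symmetric] \<nu>)
  show "(\<lambda>s. u + s *\<^sub>R \<nu>) ` {s1..s2} \<subseteq> \<Omega>" using sub by auto
  fix t assume "t \<in> {s1<..<s2} - {}"
  then have t: "t \<in> {s1..s2}" by auto
  have "((\<lambda>s. u + s *\<^sub>R \<nu>) has_vector_derivative \<nu>) (at t)"
    by (auto intro!: derivative_eq_intros)
  then show "\<exists>v. ((\<lambda>s. u + s *\<^sub>R \<nu>) has_vector_derivative v) (at t) \<and>
      ennreal (kobayashi_metric \<Omega> (u + t *\<^sub>R \<nu>) v) \<le> ennreal (A / (2 * t))"
    using ennreal_leI[OF met[OF t]] by blast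
next
  have "(\<integral>\<^sup>+s\<in>{s1..s2}. ennreal (A / (2 * s)) \<partial>lborel) = ennreal (A / 2 * ln s2 - A / 2 * ln s1)"
  proof (rule nn_integral_FTC_Icc)
    fix x assume x: "x \<in> {s1..s2}"
    with s(1) have "x > 0" by simp
    have "((\<lambda>x. A / 2 * ln x) has_real_derivative A / 2 * (1 / x)) (at x)"
      by (intro DERIV_cmult DERIV_ln_divide \<open>x > 0\<close>)
    then show "((\<lambda>x. A / 2 * ln x) has_real_derivative A / (2 * x)) (at x)" by simp
    show "0 \<le> A / (2 * x)" using A \<open>x > 0\<close> by simp
  qed (use s(2) in auto)
  then show "(\<integral>\<^sup>+s\<in>{s1..s2}. ennreal (A / (2 * s)) \<partial>lborel) \<le> ennreal (A / 2 * (ln s2 - ln s1))"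
    by (simp add: right_diff_distrib)
qed (use s in auto)

section \<open>Upper bounds for the Kobayashi distance\<close>

context bounded_convex_domain
begin

text \<open>The point \<open>x\<close> sits at parameter \<open>\<delta> / 2\<close> on the axis of
  a cone with vertex \<open>u\<close>, and moving along the axis to parameter \<open>h\<close> costs
  the integral of \<open>A / (2 * s)\<close>. Placing the vertex at half the boundary distance from
  \<open>x\<close> keeps it inside \<open>\<Omega>\<close>, where the uniform cone applies; this
  causes the factor \<open>2\<close> in the logarithm.\<close>

lemma curve_bound_inward:
  assumes C1: "C1_boundary \<Omega>" and A: "A > 1"
  obtains h0 where "h0 > 0"
    "\<And>x h. x \<in> \<Omega> \<Longrightarrow> bdist \<Omega> x / 2 \<le> h \<Longrightarrow> h \<le> h0 \<Longrightarrow>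
       \<exists>x'\<in>\<Omega>. curve_bound \<Omega> x x' (A / 2 * ln (2 * h / bdist \<Omega> x)) \<and> norm (x - x') \<le> h \<and> h / 4 \<le> bdist \<Omega> x'"
proof -
  \<comment> \<open>The metric on the axis loses the factor \<open>1 / q\<close>, which has to be
    \<open>A\<close>.\<close>
  define q where "q = 1 / A"
  have q: "0 < q" "q < 1" using A by (auto simp: q_def)
  define \<epsilon> where "\<epsilon> = (1 - q\<^sup>2) / 2"
  have "q\<^sup>2 < 1" using q by (simp add: power_less_one_iff)
  then have \<epsilon>: "0 < \<epsilon>" "\<epsilon> < 1 / 2" using q by (auto simp: \<epsilon>_def)
  obtain r0 where r0: "r0 > 0"
    "\<And>x. x \<in> \<Omega> \<Longrightarrow> \<exists>\<nu>. norm \<nu> = 1 \<and> (\<forall>u z. u \<in> \<Omega> \<longrightarrow> norm (u - x) < r0 \<longrightarrow> norm z < r0 \<longrightarrow>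
        z \<bullet> \<nu> > \<epsilon> * norm z \<longrightarrow> u + z \<in> \<Omega>)"
    using uniform_cone[OF open_dom bounded_dom C1 \<epsilon>(1)] by blast
  define R where "R = (1 + q) / (1 - q)"
  have R: "R > 1" using q by (simp add: R_def)
  \<comment> \<open>The disc centred at parameter \<open>s\<close> reaches up to distance
    \<open>s * R\<close> from the vertex, and this has to stay below \<open>r0\<close> for all
    \<open>s \<le> h0\<close>.\<close>
  define h0 where "h0 = r0 / (4 * R)"
  have h0: "h0 > 0" "h0 \<le> r0 / 4" "h0 * R < r0"
    using R r0(1) by (auto simp: h0_def field_simps)
  show ?thesis
  proof (rule that[OF h0(1)])
    fix x h assume x: "x \<in> \<Omega>" and h: "bdist \<Omega> x / 2 \<le> h" "h \<le> h0"
    define \<delta> where "\<delta> = bdist \<Omega> x"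
    have \<delta>: "\<delta> > 0" using bdist_pos'[OF x] by (simp add: \<delta>_def)
    have hp: "h > 0" "h \<le> r0 / 4" using h \<delta> h0 by (auto simp: \<delta>_def)
    obtain \<nu> where \<nu>: "norm \<nu> = 1" "\<And>u z. u \<in> \<Omega> \<Longrightarrow> norm (u - x) < r0 \<Longrightarrow> norm z < r0 \<Longrightarrow>
        z \<bullet> \<nu> > \<epsilon> * norm z \<Longrightarrow> u + z \<in> \<Omega>" using r0(2)[OF x] by blast
    have \<nu>\<nu>: "\<nu> \<bullet> \<nu> = 1" using \<nu>(1) by (simp add: dot_square_norm)
    define u where "u = x - (\<delta> / 2) *\<^sub>R \<nu>"
    have xu: "x = u + (\<delta> / 2) *\<^sub>R \<nu>" by (simp add: u_def)
    have nux: "norm (u - x) = \<delta> / 2" using \<nu>(1) \<delta> by (simp add: u_def)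
    have u\<Omega>: "u \<in> \<Omega>"
    proof -
      have "u \<in> ball x (bdist \<Omega> x)" using nux \<delta> by (simp add: dist_norm norm_minus_commute \<delta>_def[symmetric])
      then show ?thesis using ball_bdist_subset[OF x] by blast
    qed
    have cone: "u + z \<in> \<Omega>" if "norm z < r0" "z \<bullet> \<nu> > \<epsilon> * norm z" for z
      by (rule \<nu>(2)[OF u\<Omega> _ that]) (use nux h hp r0(1) \<delta>_def in auto)
    define x' where "x' = u + h *\<^sub>R \<nu>"
    \<comment> \<open>A perturbation shorter than \<open>h / 4\<close> leaves the norm below
      \<open>5 / 4 * h\<close> and the axial component above \<open>3 / 4 * h\<close>; their ratio
      exceeds \<open>1 / 2\<close>, hence \<open>\<epsilon>\<close>.\<close>
    have ball: "ball x' (h / 4) \<subseteq> \<Omega>"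
    proof
      fix y assume "y \<in> ball x' (h / 4)"
      then have w: "norm (y - x') < h / 4" by (simp add: dist_norm norm_minus_commute)
      let ?z = "h *\<^sub>R \<nu> + (y - x')"
      have "norm ?z \<le> norm (h *\<^sub>R \<nu>) + norm (y - x')" by (rule norm_triangle_ineq)
      then have n: "norm ?z < 5 / 4 * h" using w \<nu>(1) hp by simp
      have "- (norm (y - x') * norm \<nu>) \<le> (y - x') \<bullet> \<nu>"
        using norm_cauchy_schwarz[of "- (y - x')" \<nu>] by (simp only: inner_minus_left norm_minus_cancel)
      then have "?z \<bullet> \<nu> > 3 / 4 * h" using w \<nu>(1) \<nu>\<nu> by (simp add: inner_add_left)
      moreover have "\<epsilon> * norm ?z \<le> 1 / 2 * norm ?z" using \<epsilon>(2) by (intro mult_right_mono) auto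
      ultimately have "?z \<bullet> \<nu> > \<epsilon> * norm ?z" using n hp(1) by linarith
      moreover have "norm ?z < r0" using n hp by linarith
      ultimately have "u + ?z \<in> \<Omega>" by (intro cone)
      then show "y \<in> \<Omega>" by (simp add: x'_def)
    qed
    have x'\<Omega>: "x' \<in> \<Omega>" using ball hp(1) by auto
    have "curve_bound \<Omega> (u + (\<delta> / 2) *\<^sub>R \<nu>) (u + h *\<^sub>R \<nu>) (A / 2 * (ln h - ln (\<delta> / 2)))"
    proof (rule curve_bound_radial[OF _ _ _ \<nu>(1)])
      fix s assume "s \<in> {\<delta> / 2..h}"
      then have s: "s > 0" "s \<le> h" using \<delta> by auto
      have "\<epsilon> * s < 1 * s" using s(1) \<epsilon>(2) by (intro mult_strict_right_mono) auto
      then show "u + s *\<^sub>R \<nu> \<in> \<Omega>" using \<nu>(1) \<nu>\<nu> s hp r0(1) by (intro cone) auto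
      have "s * ((1 + q) / (1 - q)) < r0"
      proof -
        have "s * R \<le> h0 * R" using s h R by (intro mult_right_mono) auto
        then show ?thesis using h0(3) by (simp add: R_def)
      qed
      then have "kobayashi_metric \<Omega> (u + s *\<^sub>R \<nu>) \<nu> \<le> 1 / (2 * q * s)"
        by (rule kobayashi_metric_cone[OF q \<nu>(1) s(1)]) (rule cone, auto simp: \<epsilon>_def)
      also have "1 / (2 * q * s) = A / (2 * s)" using A by (simp add: q_def)
      finally show "kobayashi_metric \<Omega> (u + s *\<^sub>R \<nu>) \<nu> \<le> A / (2 * s)" .
    qed (use A \<delta> h in \<open>auto simp: \<delta>_def\<close>)
    moreover have "ln h - ln (\<delta> / 2) = ln (2 * h / bdist \<Omega> x)"
      using hp \<delta> by (simp add: \<delta>_def ln_div ln_mult)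
    moreover have "norm (x - x') \<le> h"
    proof -
      have "x - x' = (\<delta> / 2 - h) *\<^sub>R \<nu>" by (simp add: xu x'_def algebra_simps)
      then show ?thesis using \<nu>(1) h \<delta> by (simp add: \<delta>_def)
    qed
    moreover have "h / 4 \<le> bdist \<Omega> x'"
      by (rule bdist_geI[OF open_dom bounded_dom _ ball]) (use x in auto)
    ultimately show "\<exists>x'\<in>\<Omega>. curve_bound \<Omega> x x' (A / 2 * ln (2 * h / bdist \<Omega> x)) \<and>
        norm (x - x') \<le> h \<and> h / 4 \<le> bdist \<Omega> x'"
      using x'\<Omega> by (intro bexI[of _ x']) (simp_all add: xu[symmetric] x'_def[symmetric])
  qed
qed

text \<open>Both points climb inwards to a height comparable with the scale and are then joined by a
  segment of bounded Kobayashi length. The first bound takes \<open>h\<close> as the scale, the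
  second the fixed height \<open>h0\<close>.\<close>

lemma kobayashi_dist_upper:
  assumes C1: "C1_boundary \<Omega>" and A: "A > 1" and ne: "\<Omega> \<noteq> {}"
  obtains B h0 where "B \<ge> 0" "h0 > 0"
    "\<And>x y h. x \<in> \<Omega> \<Longrightarrow> y \<in> \<Omega> \<Longrightarrow> norm (x - y) \<le> h \<Longrightarrow> bdist \<Omega> x \<le> h \<Longrightarrow> bdist \<Omega> y \<le> h \<Longrightarrow> h \<le> h0 \<Longrightarrow>
       kobayashi_dist \<Omega> x y \<le> A / 2 * ((ln h - ln (bdist \<Omega> x)) + (ln h - ln (bdist \<Omega> y))) + B"
    "\<And>x y. x \<in> \<Omega> \<Longrightarrow> y \<in> \<Omega> \<Longrightarrow>
       kobayashi_dist \<Omega> x y \<le> A / 2 * (- ln (bdist \<Omega> x) - ln (bdist \<Omega> y)) + B"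
proof -
  obtain h0 where h0: "h0 > 0"
    "\<And>x h. x \<in> \<Omega> \<Longrightarrow> bdist \<Omega> x / 2 \<le> h \<Longrightarrow> h \<le> h0 \<Longrightarrow>
       \<exists>x'\<in>\<Omega>. curve_bound \<Omega> x x' (A / 2 * ln (2 * h / bdist \<Omega> x)) \<and> norm (x - x') \<le> h \<and> h / 4 \<le> bdist \<Omega> x'"
    using curve_bound_inward[OF C1 A] by blast
  have join: "kobayashi_dist \<Omega> x y \<le> c + norm (x' - y') / r + d"
    if "curve_bound \<Omega> x x' c" "curve_bound \<Omega> y y' d" "c \<ge> 0" "d \<ge> 0" "x' \<in> \<Omega>" "y' \<in> \<Omega>"
      "r > 0" "r \<le> bdist \<Omega> x'" "r \<le> bdist \<Omega> y'" for x y x' y' c d r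
  proof -
    have "curve_bound \<Omega> x' y' (norm (x' - y') / r)"
      using curve_bound_straight[OF that(5-9)] by (simp add: norm_minus_commute)
    from curve_bound_trans[OF that(1) this that(3)]
    have "curve_bound \<Omega> x y' (c + norm (x' - y') / r)" using that(7) by simp
    from curve_bound_trans[OF this curve_bound_sym[OF that(2)] _ that(4)]
    have "curve_bound \<Omega> x y (c + norm (x' - y') / r + d)" using that(3,7) by simp
    then show ?thesis by (rule curve_bound_dist) (use that in auto)
  qed
  \<comment> \<open>\<open>A * ln 2\<close> collects the factors \<open>2\<close> inside the two
    logarithms; \<open>12\<close> is the cost of a segment of length at most \<open>3 * h\<close> at
    height at least \<open>h / 4\<close>.\<close>
  define B1 where "B1 = A * ln 2 + 12"
  have near: "kobayashi_dist \<Omega> x y \<le> A / 2 * ((ln h - ln (bdist \<Omega> x)) + (ln h - ln (bdist \<Omega> y))) + B1"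
    if *: "x \<in> \<Omega>" "y \<in> \<Omega>" "norm (x - y) \<le> h" "bdist \<Omega> x \<le> h" "bdist \<Omega> y \<le> h" "h \<le> h0" for x y h
  proof -
    have p: "bdist \<Omega> x > 0" "bdist \<Omega> y > 0" "h > 0" using bdist_pos' * by force+
    obtain x' where x': "x' \<in> \<Omega>" "curve_bound \<Omega> x x' (A / 2 * ln (2 * h / bdist \<Omega> x))" "norm (x - x') \<le> h" "h / 4 \<le> bdist \<Omega> x'"
      using h0(2)[of x h] * p by auto
    obtain y' where y': "y' \<in> \<Omega>" "curve_bound \<Omega> y y' (A / 2 * ln (2 * h / bdist \<Omega> y))" "norm (y - y') \<le> h" "h / 4 \<le> bdist \<Omega> y'"
      using h0(2)[of y h] * p by auto
    have "norm (x' - y') \<le> norm (x' - x) + norm (x - y) + norm (y - y')"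
      using norm_triangle_ineq[of "x' - x + (x - y)" "y - y'"] norm_triangle_ineq[of "x' - x" "x - y"] by simp
    then have "norm (x' - y') \<le> 3 * h" using x'(3) y'(3) *(3) by (simp add: norm_minus_commute)
    then have n12: "norm (x' - y') / (h / 4) \<le> 12" using p(3) by (simp add: field_simps)
    have "kobayashi_dist \<Omega> x y \<le> A / 2 * ln (2 * h / bdist \<Omega> x) + norm (x' - y') / (h / 4) + A / 2 * ln (2 * h / bdist \<Omega> y)"
      by (rule join[OF x'(2) y'(2) _ _ x'(1) y'(1) _ x'(4) y'(4)]) (use A p * in auto)
    also have "\<dots> \<le> A / 2 * ln (2 * h / bdist \<Omega> x) + 12 + A / 2 * ln (2 * h / bdist \<Omega> y)"
      using n12 by simp
    also have "\<dots> = A / 2 * ((ln h - ln (bdist \<Omega> x)) + (ln h - ln (bdist \<Omega> y))) + B1"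
      using p by (simp add: ln_div ln_mult B1_def algebra_simps)
    finally show ?thesis .
  qed
  obtain D0 where D0: "\<And>x. x \<in> \<Omega> \<Longrightarrow> norm x \<le> D0" "D0 > 0"
    using bounded_pos[of \<Omega>] bounded_dom by blast
  obtain o' where o': "o' \<in> \<Omega>" using ne by blast
  \<comment> \<open>Besides bounding heights and distances, \<open>D\<close> is at least
    \<open>1\<close> and at least \<open>2 * h0\<close>, so \<open>ln D\<close> can replace
    \<open>ln (2 * h0)\<close> in the cost of a climb.\<close>
  define D where "D = bdist \<Omega> o' + 2 * D0 + 2 * h0 + 1"
  have bo: "bdist \<Omega> o' > 0" by (rule bdist_pos'[OF o'])
  have D: "D \<ge> 1" "2 * h0 \<le> D" using bo D0(2) h0(1) by (auto simp: D_def)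
  have nD: "norm (x - y) \<le> D" if "x \<in> \<Omega>" "y \<in> \<Omega>" for x y
    using norm_triangle_ineq4[of x y] D0(1)[OF that(1)] D0(1)[OF that(2)] bo h0(1) by (simp add: D_def)
  have bD: "bdist \<Omega> x \<le> D" if "x \<in> \<Omega>" for x
    using bdist_triangle[of \<Omega> x o'] norm_triangle_ineq4[of x o'] D0(1)[OF that] D0(1)[OF o'] h0(1) by (simp add: D_def)
  have inward: "\<exists>x'\<in>\<Omega>. curve_bound \<Omega> x x' (A / 2 * (ln D - ln (bdist \<Omega> x))) \<and> h0 / 4 \<le> bdist \<Omega> x'" if x: "x \<in> \<Omega>" for x
  proof -
    have p: "bdist \<Omega> x > 0" by (rule bdist_pos'[OF x])
    note mono = curve_bound_mono[of \<Omega> x]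
    show ?thesis
    proof (cases "bdist \<Omega> x / 2 \<le> h0")
      case True
      from h0(2)[OF x this order_refl] obtain x' where
        "x' \<in> \<Omega>" "curve_bound \<Omega> x x' (A / 2 * ln (2 * h0 / bdist \<Omega> x))" "h0 / 4 \<le> bdist \<Omega> x'" by blast
      moreover have "ln (2 * h0 / bdist \<Omega> x) \<le> ln (D / bdist \<Omega> x)"
        using D p h0(1) by (simp add: divide_right_mono)
      then have "A / 2 * ln (2 * h0 / bdist \<Omega> x) \<le> A / 2 * (ln D - ln (bdist \<Omega> x))"
        using A D p by (intro mult_left_mono) (auto simp: ln_div)
      ultimately show ?thesis using mono by blast
    next
      \<comment> \<open>A point higher than \<open>2 * h0\<close> does not have to climb, and the
        constant curve serves.\<close>
      case False
      have "curve_bound \<Omega> x x (norm (x - x) / bdist \<Omega> x)" by (rule curve_bound_straight) (use x p in auto)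
      moreover have "0 \<le> A / 2 * (ln D - ln (bdist \<Omega> x))" using A bD[OF x] p by (intro mult_nonneg_nonneg) auto
      ultimately have "curve_bound \<Omega> x x (A / 2 * (ln D - ln (bdist \<Omega> x)))" using mono by simp
      then show ?thesis using False x h0(1) by (intro bexI[of _ x]) auto
    qed
  qed
  define B2 where "B2 = A * ln D + 4 * D / h0"
  have far: "kobayashi_dist \<Omega> x y \<le> A / 2 * (- ln (bdist \<Omega> x) - ln (bdist \<Omega> y)) + B2"
    if xy: "x \<in> \<Omega>" "y \<in> \<Omega>" for x y
  proof -
    obtain x' where x': "x' \<in> \<Omega>" "curve_bound \<Omega> x x' (A / 2 * (ln D - ln (bdist \<Omega> x)))" "h0 / 4 \<le> bdist \<Omega> x'"
      using inward[OF xy(1)] by blast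
    obtain y' where y': "y' \<in> \<Omega>" "curve_bound \<Omega> y y' (A / 2 * (ln D - ln (bdist \<Omega> y)))" "h0 / 4 \<le> bdist \<Omega> y'"
      using inward[OF xy(2)] by blast
    have nn: "0 \<le> A / 2 * (ln D - ln (bdist \<Omega> z))" if "z \<in> \<Omega>" for z
      using A bD[OF that] bdist_pos'[OF that] by (intro mult_nonneg_nonneg) auto
    have "kobayashi_dist \<Omega> x y \<le> A / 2 * (ln D - ln (bdist \<Omega> x)) + norm (x' - y') / (h0 / 4) + A / 2 * (ln D - ln (bdist \<Omega> y))"
      by (rule join[OF x'(2) y'(2) nn nn x'(1) y'(1) _ x'(3) y'(3)]) (use xy h0(1) in auto)
    also have "norm (x' - y') / (h0 / 4) \<le> D / (h0 / 4)"
      using nD[OF x'(1) y'(1)] h0(1) by (intro divide_right_mono) auto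
    finally show ?thesis by (simp add: B2_def algebra_simps)
  qed
  have "B1 \<ge> 0" using A by (simp add: B1_def)
  then show ?thesis
  proof (intro that[of "max B1 B2" h0])
    show "kobayashi_dist \<Omega> x y \<le> A / 2 * ((ln h - ln (bdist \<Omega> x)) + (ln h - ln (bdist \<Omega> y))) + max B1 B2"
      if "x \<in> \<Omega>" "y \<in> \<Omega>" "norm (x - y) \<le> h" "bdist \<Omega> x \<le> h" "bdist \<Omega> y \<le> h" "h \<le> h0" for x y h
      using near[OF that] by linarith
    show "kobayashi_dist \<Omega> x y \<le> A / 2 * (- ln (bdist \<Omega> x) - ln (bdist \<Omega> y)) + max B1 B2"
      if "x \<in> \<Omega>" "y \<in> \<Omega>" for x y
      using far[OF that] by linarith
  qed (use h0(1) in auto)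
qed

end

section \<open>Quasi-geodesics\<close>

definition quasi_geodesic :: "'a set \<Rightarrow> ('a \<Rightarrow> 'a \<Rightarrow> real) \<Rightarrow> real \<Rightarrow> real \<Rightarrow> real \<Rightarrow> (real \<Rightarrow> 'a) \<Rightarrow> bool" where
  "quasi_geodesic X K L a b \<gamma> \<longleftrightarrow> a \<le> b \<and> \<gamma> ` {a..b} \<subseteq> X \<and>
     (\<forall>s\<in>{a..b}. \<forall>t\<in>{a..b}. 1 / L * \<bar>t - s\<bar> \<le> K (\<gamma> s) (\<gamma> t) \<and> K (\<gamma> s) (\<gamma> t) \<le> L * \<bar>t - s\<bar>)"

text \<open>Half of the left-hand side is the Gromov product of \<open>\<gamma> s\<close> and
  \<open>\<gamma> u\<close> seen from \<open>\<gamma> t\<close>. It vanishes on geodesics; the error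
  allowed here grows with slope \<open>\<eta>\<close> in the parameter length.\<close>

definition almost_additive :: "('a \<Rightarrow> 'a \<Rightarrow> real) \<Rightarrow> real \<Rightarrow> real \<Rightarrow> real \<Rightarrow> real \<Rightarrow> (real \<Rightarrow> 'a) \<Rightarrow> bool" where
  "almost_additive K \<eta> G a b \<gamma> \<longleftrightarrow>
     (\<forall>s t u. a \<le> s \<and> s \<le> t \<and> t \<le> u \<and> u \<le> b \<longrightarrow>
        K (\<gamma> s) (\<gamma> t) + K (\<gamma> t) (\<gamma> u) - K (\<gamma> s) (\<gamma> u) \<le> 2 * (\<eta> * (u - s) + G))"

lemma quasi_geodesic_subinterval:
  "quasi_geodesic X K L a b \<gamma> \<Longrightarrow> a \<le> c \<Longrightarrow> c \<le> d \<Longrightarrow> d \<le> b \<Longrightarrow> quasi_geodesic X K L c d \<gamma>"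
  unfolding quasi_geodesic_def by (auto intro: subsetD)

text \<open>The speed estimates are made over times at most \<open>1\<close>, where \<open>K\<close>
  stays bounded. Steps of that size telescope on the right and obey the triangle inequality on the
  left.\<close>

lemma locally_dominated_imp_dominated:
  fixes \<gamma> :: "real \<Rightarrow> 'a::real_normed_vector" and \<Phi> :: "real \<Rightarrow> real"
  assumes loc: "\<And>s t. u \<le> s \<Longrightarrow> s \<le> t \<Longrightarrow> t \<le> v \<Longrightarrow> t - s \<le> 1 \<Longrightarrow> norm (\<gamma> t - \<gamma> s) \<le> \<Phi> t - \<Phi> s"
    and st: "u \<le> s" "s \<le> t" "t \<le> v"
  shows "norm (\<gamma> t - \<gamma> s) \<le> \<Phi> t - \<Phi> s"
proof -
  have "norm (\<gamma> t - \<gamma> s) \<le> \<Phi> t - \<Phi> s" if "u \<le> s" "s \<le> t" "t \<le> v" "t - s \<le> real n" for n s t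
    using that
  proof (induction n arbitrary: t)
    case 0
    then have "s = t" by simp
    then show ?case by simp
  next
    case (Suc n)
    let ?w = "max s (t - 1)"
    have "norm (\<gamma> ?w - \<gamma> s) \<le> \<Phi> ?w - \<Phi> s" by (rule Suc.IH) (use Suc.prems in auto)
    moreover have "norm (\<gamma> t - \<gamma> ?w) \<le> \<Phi> t - \<Phi> ?w" by (rule loc) (use Suc.prems in auto)
    ultimately show ?case using norm_triangle_ineq[of "\<gamma> t - \<gamma> ?w" "\<gamma> ?w - \<gamma> s"] by simp
  qed
  moreover obtain n :: nat where "t - s \<le> real n" using real_arch_simple by blast
  ultimately show ?thesis using st by blast
qed

lemma euclidean_length_dominated:
  assumes "a \<le> b" and dom: "\<And>s t. a \<le> s \<Longrightarrow> s \<le> t \<Longrightarrow> t \<le> b \<Longrightarrow> norm (\<gamma> t - \<gamma> s) \<le> \<Phi> t - \<Phi> s"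
  shows "euclidean_length a b \<gamma> \<le> ennreal (\<Phi> b - \<Phi> a)"
  unfolding euclidean_length_def
proof (rule Sup_least)
  fix x assume "x \<in> {\<Sum>k<N. ennreal (norm (\<gamma> (t (Suc k)) - \<gamma> (t k))) |N t. mono_on {..N} t \<and> t ` {..N} \<subseteq> {a..b}}"
  then obtain N t where x: "x = (\<Sum>k<N. ennreal (norm (\<gamma> (t (Suc k)) - \<gamma> (t k))))"
    "mono_on {..N::nat} t" "t ` {..N} \<subseteq> {a..b}" by blast
  have t: "a \<le> t k" "t k \<le> b" if "k \<le> N" for k using x(3) that by auto
  have mono: "\<Phi> s \<le> \<Phi> s'" if "a \<le> s" "s \<le> s'" "s' \<le> b" for s s'
    using dom[OF that] norm_ge_zero[of "\<gamma> s' - \<gamma> s"] by linarith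
  have "x = ennreal (\<Sum>k<N. norm (\<gamma> (t (Suc k)) - \<gamma> (t k)))"
    unfolding x(1) by (simp add: sum_ennreal)
  also have "\<dots> \<le> ennreal (\<Sum>k<N. \<Phi> (t (Suc k)) - \<Phi> (t k))"
    by (intro ennreal_leI sum_mono dom) (use t x(2) in \<open>auto simp: mono_on_def\<close>)
  also have "(\<Sum>k<N. \<Phi> (t (Suc k)) - \<Phi> (t k)) = \<Phi> (t N) - \<Phi> (t 0)"
    by (induction N) auto
  also have "ennreal \<dots> \<le> ennreal (\<Phi> b - \<Phi> a)"
    using mono[of "t N" b] mono[of a "t 0"] t[of 0] t[of N] by (intro ennreal_leI) auto
  finally show "x \<le> ennreal (\<Phi> b - \<Phi> a)" .
qed

text \<open>\<open>\<delta>\<close> abstracts the boundary distance and \<open>K\<close> the Kobayashi distance. The constant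
  \<open>1 + 1 / (4 * m)\<close> can be any number close enough to the sharp value \<open>1\<close>; this choice makes the
  final exponent exactly \<open>1 / (4 * m)\<close>.\<close>

locale distance_estimates =
  fixes X :: "(complex ^ 'n) set" and K :: "complex ^ 'n \<Rightarrow> complex ^ 'n \<Rightarrow> real"
    and \<delta> :: "complex ^ 'n \<Rightarrow> real" and m C B h0 D A :: real
  assumes m: "m \<ge> 1" and C: "C > 0" and B: "B \<ge> 0" and h0: "h0 > 0" and D: "D \<ge> 1"
    and A_def: "A = 1 + 1 / (4 * m)"
    and \<delta>_pos: "x \<in> X \<Longrightarrow> \<delta> x > 0" and \<delta>_le: "x \<in> X \<Longrightarrow> \<delta> x \<le> D"
    and \<delta>_triangle: "\<delta> x \<le> \<delta> y + norm (x - y)"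
    and diam: "x \<in> X \<Longrightarrow> y \<in> X \<Longrightarrow> norm (x - y) \<le> D"
    and K_ge_log: "x \<in> X \<Longrightarrow> y \<in> X \<Longrightarrow> \<bar>ln (\<delta> y) - ln (\<delta> x)\<bar> \<le> 2 * K x y"
    and K_norm: "x \<in> X \<Longrightarrow> y \<in> X \<Longrightarrow> K x y < \<tau> \<Longrightarrow> z = x \<or> z = y \<Longrightarrow>
       norm (y - x) \<le> C * exp (2 * \<tau> / m) * \<delta> z powr (1 / m) * \<tau>"
    and K_straight: "x \<in> X \<Longrightarrow> y \<in> X \<Longrightarrow> r > 0 \<Longrightarrow> r \<le> \<delta> x \<Longrightarrow> r \<le> \<delta> y \<Longrightarrow> K x y \<le> norm (y - x) / r"
    and K_near: "x \<in> X \<Longrightarrow> y \<in> X \<Longrightarrow> norm (x - y) \<le> h \<Longrightarrow> \<delta> x \<le> h \<Longrightarrow> \<delta> y \<le> h \<Longrightarrow> h \<le> h0 \<Longrightarrow>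
       K x y \<le> A / 2 * ((ln h - ln (\<delta> x)) + (ln h - ln (\<delta> y))) + B"
    and K_far: "x \<in> X \<Longrightarrow> y \<in> X \<Longrightarrow> K x y \<le> A / 2 * (- ln (\<delta> x) - ln (\<delta> y)) + B"
begin

lemma A_bounds: "1 < A" "A \<le> 2"
  using m by (auto simp: A_def field_simps)

section \<open>Height, speed and length along a quasi-geodesic\<close>

context
  fixes L :: real
  assumes L: "L \<ge> 1"
begin

definition "speed_const = 2 * L * C * exp (4 * L)"

lemma speed_const_pos: "speed_const > 0" using L C by (simp add: speed_const_def)

lemma quasi_geodesic_step:
  assumes q: "quasi_geodesic X K L a b \<gamma>" and st: "s \<in> {a..b}" "t \<in> {a..b}" "\<bar>t - s\<bar> \<le> 1"
    and r: "r = s \<or> r = t"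
  shows "norm (\<gamma> t - \<gamma> s) \<le> speed_const * \<delta> (\<gamma> r) powr (1 / m) * \<bar>t - s\<bar>"
proof (cases "s = t")
  case False
  \<comment> \<open>Twice the quasi-geodesic bound, because \<open>K_norm\<close> asks for a strict
    inequality.\<close>
  let ?\<tau> = "2 * L * \<bar>t - s\<bar>"
  have X: "\<gamma> s \<in> X" "\<gamma> t \<in> X" using q st by (auto simp: quasi_geodesic_def)
  have "K (\<gamma> s) (\<gamma> t) \<le> L * \<bar>t - s\<bar>" using q st by (auto simp: quasi_geodesic_def)
  also have "\<dots> < ?\<tau>" using L False by simp
  finally have "norm (\<gamma> t - \<gamma> s) \<le> C * exp (2 * ?\<tau> / m) * \<delta> (\<gamma> r) powr (1 / m) * ?\<tau>"
    using K_norm[OF X] r by blast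
  also have "\<dots> \<le> C * exp (4 * L) * \<delta> (\<gamma> r) powr (1 / m) * ?\<tau>"
  proof -
    have "2 * ?\<tau> / m \<le> 2 * ?\<tau> / 1"
      using L m by (intro divide_left_mono) auto
    also have "\<dots> \<le> 4 * L" using L st(3) mult_left_mono[of "\<bar>t - s\<bar>" 1 L] by simp
    finally show ?thesis using L C
      by (intro mult_right_mono mult_left_mono) auto
  qed
  finally show ?thesis by (simp add: speed_const_def algebra_simps)
qed simp

lemma quasi_geodesic_continuous:
  assumes q: "quasi_geodesic X K L a b \<gamma>"
  shows "continuous_on {a..b} (\<lambda>t. \<delta> (\<gamma> t))"
  unfolding continuous_on_iff
proof (intro ballI allI impI)
  fix t e :: real assume t: "t \<in> {a..b}" and e: "e > 0"
  define M where "M = speed_const * D powr (1 / m)"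
  have M: "M > 0" using speed_const_pos D by (simp add: M_def)
  show "\<exists>d>0. \<forall>s\<in>{a..b}. dist s t < d \<longrightarrow> dist (\<delta> (\<gamma> s)) (\<delta> (\<gamma> t)) < e"
  proof (intro exI[of _ "min 1 (e / M)"] conjI ballI impI)
    fix s assume s: "s \<in> {a..b}" "dist s t < min 1 (e / M)"
    have "norm (\<gamma> t - \<gamma> s) \<le> speed_const * \<delta> (\<gamma> s) powr (1 / m) * \<bar>t - s\<bar>"
      by (rule quasi_geodesic_step[OF q s(1) t]) (use s in \<open>auto simp: dist_real_def abs_minus_commute\<close>)
    also have "\<dots> \<le> M * \<bar>t - s\<bar>"
    proof -
      have "\<gamma> s \<in> X" using q s by (auto simp: quasi_geodesic_def)
      then have "\<delta> (\<gamma> s) powr (1 / m) \<le> D powr (1 / m)"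
        using \<delta>_pos \<delta>_le m by (intro powr_mono2) (auto intro: less_imp_le)
      then show ?thesis using speed_const_pos by (auto simp: M_def intro!: mult_right_mono mult_left_mono)
    qed
    also have "\<dots> < e" using s(2) M by (simp add: dist_real_def field_simps abs_minus_commute)
    finally show "dist (\<delta> (\<gamma> s)) (\<delta> (\<gamma> t)) < e"
      using \<delta>_triangle[of "\<gamma> s" "\<gamma> t"] \<delta>_triangle[of "\<gamma> t" "\<gamma> s"]
      by (simp add: dist_real_def norm_minus_commute abs_less_iff)
  qed (use e M in auto)
qed

text \<open>\<open>\<kappa>\<close> is the decay rate of the speed: the rate
  \<open>1 / (4 * L)\<close> at which the logarithm of the height falls, divided by
  \<open>m\<close>. \<open>length_const\<close> comes from integrating the exponential majorant over
  both sides of the highest point.\<close>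

definition "\<kappa> = 1 / (4 * L * m)"
definition "length_const = 2 * speed_const * exp (B / 2) / \<kappa>"

lemma \<kappa>_pos: "\<kappa> > 0" using L m by (simp add: \<kappa>_def)
lemma length_const_pos: "length_const > 0" using speed_const_pos \<kappa>_pos by (simp add: length_const_def)

text \<open>With \<open>H\<close> the largest height, reached at time \<open>t0\<close>, the upper bound for \<open>K\<close> makes the height decay like
  \<open>exp (- \<bar>t - t0\<bar> / L) / H\<close>; interpolating with the trivial bound \<open>H\<close> gives an integrable majorant
  of the speed.\<close>

lemma quasi_geodesic_length:
  assumes q: "quasi_geodesic X K L a b \<gamma>" and t0: "t0 \<in> {a..b}"
    and max: "\<And>t. t \<in> {a..b} \<Longrightarrow> \<delta> (\<gamma> t) \<le> \<delta> (\<gamma> t0)"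
  obtains \<Phi> where "\<And>s t. a \<le> s \<Longrightarrow> s \<le> t \<Longrightarrow> t \<le> b \<Longrightarrow> norm (\<gamma> t - \<gamma> s) \<le> \<Phi> t - \<Phi> s"
    "\<Phi> b - \<Phi> a \<le> length_const * \<delta> (\<gamma> t0) powr (1 / (2 * m))"
proof -
  define H where "H = \<delta> (\<gamma> t0)"
  have X: "\<gamma> t \<in> X" if "t \<in> {a..b}" for t using q that by (auto simp: quasi_geodesic_def)
  have H: "H > 0" using \<delta>_pos X[OF t0] by (simp add: H_def)
  define M where "M = speed_const * exp (B / 2) * H powr (1 / (2 * m))"
  have M: "M > 0" using speed_const_pos H by (simp add: M_def)
  have speed: "speed_const * \<delta> (\<gamma> t) powr (1 / m) \<le> M * exp (- \<kappa> * \<bar>t - t0\<bar>)" if t: "t \<in> {a..b}" for t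
  proof -
    have dp: "\<delta> (\<gamma> t) > 0" using \<delta>_pos X[OF t] by simp
    have 1: "ln (\<delta> (\<gamma> t)) \<le> ln H" using max[OF t] dp by (simp add: H_def)
    have "1 / L * \<bar>t - t0\<bar> \<le> K (\<gamma> t0) (\<gamma> t)"
      using q t t0 unfolding quasi_geodesic_def by blast
    also have "\<dots> \<le> A / 2 * (- ln H - ln (\<delta> (\<gamma> t))) + B"
      using K_far[OF X[OF t0] X[OF t]] by (simp add: H_def)
    finally have "\<bar>t - t0\<bar> / L \<le> A / 2 * (- ln H - ln (\<delta> (\<gamma> t))) + B"
      by (simp only: times_divide_eq_left mult_1_left)
    then have *: "\<bar>t - t0\<bar> / L - B \<le> A / 2 * (- ln H - ln (\<delta> (\<gamma> t)))" by linarith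
    define E where "E = - ln H - ln (\<delta> (\<gamma> t))"
    \<comment> \<open>\<open>A / 2\<close> lies between \<open>1 / 2\<close> and \<open>1\<close>;
      which of the two may replace it depends on the sign of \<open>E\<close>.\<close>
    have 2: "\<bar>t - t0\<bar> / L - 2 * B \<le> E"
    proof (cases "E \<ge> 0")
      case True
      then have "A / 2 * E \<le> 1 * E"
        using A_bounds by (intro mult_right_mono) auto
      with * have "\<bar>t - t0\<bar> / L - B \<le> E" unfolding E_def[symmetric] by (metis mult_1 order_trans)
      then show ?thesis using B by linarith
    next
      case False
      have "A / 2 * E \<le> 1 / 2 * E"
        using A_bounds False by (intro mult_right_mono_neg) auto
      with * have "\<bar>t - t0\<bar> / L - B \<le> 1 / 2 * E" unfolding E_def[symmetric] by (rule order_trans)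
      moreover have "0 \<le> \<bar>t - t0\<bar> / L" using L by simp
      ultimately show ?thesis by linarith
    qed
    \<comment> \<open>Three quarters of fact \<open>1\<close> plus one quarter of fact
      \<open>2\<close>. The weight on \<open>ln H\<close> drops to
      \<open>3 / 4 - 1 / 4 = 1 / 2\<close>, which is the price for decay in time.\<close>
    have "ln (\<delta> (\<gamma> t)) \<le> ln H / 2 + B / 2 - \<bar>t - t0\<bar> / (4 * L)"
    proof -
      have "\<bar>t - t0\<bar> / (4 * L) = \<bar>t - t0\<bar> / L / 4" by simp
      then show ?thesis using 1 2 unfolding E_def by linarith
    qed
    then have "ln (\<delta> (\<gamma> t)) / m \<le> (ln H / 2 + B / 2 - \<bar>t - t0\<bar> / (4 * L)) / m"
      using m by (intro divide_right_mono) auto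
    also have "\<dots> = ln H / (2 * m) + B / (2 * m) - \<kappa> * \<bar>t - t0\<bar>"
      by (simp add: \<kappa>_def diff_divide_distrib add_divide_distrib algebra_simps)
    also have "B / (2 * m) \<le> B / 2" using B m by (intro divide_left_mono) auto
    finally have "exp (ln (\<delta> (\<gamma> t)) / m) \<le> exp (ln H / (2 * m) + B / 2 - \<kappa> * \<bar>t - t0\<bar>)" by simp
    then have "\<delta> (\<gamma> t) powr (1 / m) \<le> H powr (1 / (2 * m)) * exp (B / 2) * exp (- \<kappa> * \<bar>t - t0\<bar>)"
      using dp H by (simp add: powr_def exp_add[symmetric])
    from mult_left_mono[OF this, of speed_const] show ?thesis
      using speed_const_pos by (simp add: M_def algebra_simps)
  qed
  \<comment> \<open>An antiderivative of \<open>M * exp (- \<kappa> * |s - t0|)\<close>; the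
    constant \<open>2\<close> makes the branches agree at \<open>t0\<close>, and the total increase
    is at most \<open>2 * M / \<kappa>\<close>.\<close>
  define \<Phi> where "\<Phi> = (\<lambda>s. M / \<kappa> * (if s \<le> t0 then exp (- \<kappa> * (t0 - s)) else 2 - exp (- \<kappa> * (s - t0))))"
  have left: "norm (\<gamma> t - \<gamma> s) \<le> \<Phi> t - \<Phi> s" if st: "a \<le> s" "s \<le> t" "t \<le> t0" for s t
  proof (rule locally_dominated_imp_dominated[OF _ st])
    fix s t assume st: "a \<le> s" "s \<le> t" "t \<le> t0" "t - s \<le> 1"
    have m: "s \<in> {a..b}" "t \<in> {a..b}" using st t0 by auto
    \<comment> \<open>The height is taken at \<open>s\<close>, the endpoint farther from
      \<open>t0\<close>, where the majorant is smallest on the step. To the right of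
      \<open>t0\<close> that endpoint is \<open>t\<close>.\<close>
    have "norm (\<gamma> t - \<gamma> s) \<le> speed_const * \<delta> (\<gamma> s) powr (1 / m) * \<bar>t - s\<bar>"
      by (rule quasi_geodesic_step[OF q m]) (use st in auto)
    also have "\<dots> \<le> M * exp (- \<kappa> * \<bar>s - t0\<bar>) * \<bar>t - s\<bar>"
      by (intro mult_right_mono speed m) auto
    also have "\<dots> = M / \<kappa> * (exp (- \<kappa> * (t0 - s)) * (\<kappa> * (t - s)))"
      using st \<kappa>_pos by simp
    also have "\<dots> \<le> M / \<kappa> * (exp (- \<kappa> * (t0 - s)) * (exp (\<kappa> * (t - s)) - 1))"
    proof -
      have "\<kappa> * (t - s) \<le> exp (\<kappa> * (t - s)) - 1"
        using exp_ge_add_one_self[of "\<kappa> * (t - s)"] by linarith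
      then show ?thesis using M \<kappa>_pos by (intro mult_left_mono) auto
    qed
    also have "\<dots> = \<Phi> t - \<Phi> s"
      using st by (simp add: \<Phi>_def algebra_simps flip: exp_add)
    finally show "norm (\<gamma> t - \<gamma> s) \<le> \<Phi> t - \<Phi> s" .
  qed
  have right: "norm (\<gamma> t - \<gamma> s) \<le> \<Phi> t - \<Phi> s" if st: "t0 \<le> s" "s \<le> t" "t \<le> b" for s t
  proof (rule locally_dominated_imp_dominated[OF _ st])
    fix s t assume st: "t0 \<le> s" "s \<le> t" "t \<le> b" "t - s \<le> 1"
    have m: "s \<in> {a..b}" "t \<in> {a..b}" using st t0 by auto
    have P: "\<Phi> s = M / \<kappa> * (2 - exp (- \<kappa> * (s - t0)))" if "t0 \<le> s" for s
      using that by (auto simp: \<Phi>_def)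
    have "norm (\<gamma> t - \<gamma> s) \<le> speed_const * \<delta> (\<gamma> t) powr (1 / m) * \<bar>t - s\<bar>"
      by (rule quasi_geodesic_step[OF q m]) (use st in auto)
    also have "\<dots> \<le> M * exp (- \<kappa> * \<bar>t - t0\<bar>) * \<bar>t - s\<bar>"
      by (intro mult_right_mono speed m) auto
    also have "\<dots> = M / \<kappa> * (exp (- \<kappa> * (t - t0)) * (\<kappa> * (t - s)))"
      using st \<kappa>_pos by simp
    also have "\<dots> \<le> M / \<kappa> * (exp (- \<kappa> * (t - t0)) * (exp (\<kappa> * (t - s)) - 1))"
    proof -
      have "\<kappa> * (t - s) \<le> exp (\<kappa> * (t - s)) - 1"
        using exp_ge_add_one_self[of "\<kappa> * (t - s)"] by linarith
      then show ?thesis using M \<kappa>_pos by (intro mult_left_mono) auto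
    qed
    also have "\<dots> = \<Phi> t - \<Phi> s"
      using st by (simp add: P algebra_simps flip: exp_add)
    finally show "norm (\<gamma> t - \<gamma> s) \<le> \<Phi> t - \<Phi> s" .
  qed
  show ?thesis
  proof (rule that)
    fix s t assume st: "a \<le> s" "s \<le> t" "t \<le> b"
    consider "t \<le> t0" | "t0 \<le> s" | "s \<le> t0" "t0 \<le> t" by linarith
    then show "norm (\<gamma> t - \<gamma> s) \<le> \<Phi> t - \<Phi> s"
    proof cases
      case 3
      then show ?thesis
        using left[of s t0] right[of t0 t] st norm_triangle_ineq[of "\<gamma> t - \<gamma> t0" "\<gamma> t0 - \<gamma> s"] by simp
    qed (use left right st in auto)
  next
    have "0 \<le> \<Phi> a" using M \<kappa>_pos t0 by (simp add: \<Phi>_def)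
    moreover have "\<Phi> b \<le> M / \<kappa> * 2"
      unfolding \<Phi>_def using M \<kappa>_pos t0 by (intro mult_left_mono) (auto intro: order_trans[of _ 1])
    ultimately show "\<Phi> b - \<Phi> a \<le> length_const * \<delta> (\<gamma> t0) powr (1 / (2 * m))"
      by (simp add: length_const_def M_def H_def algebra_simps)
  qed
qed

lemma quasi_geodesic_displacement:
  assumes q: "quasi_geodesic X K L a b \<gamma>" and t0: "t0 \<in> {a..b}"
    and max: "\<And>t. t \<in> {a..b} \<Longrightarrow> \<delta> (\<gamma> t) \<le> \<delta> (\<gamma> t0)"
  shows "norm (\<gamma> b - \<gamma> a) \<le> length_const * \<delta> (\<gamma> t0) powr (1 / (2 * m))"
    "euclidean_length a b \<gamma> \<le> ennreal (length_const * \<delta> (\<gamma> t0) powr (1 / (2 * m)))"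
proof -
  have ab: "a \<le> b" using q by (simp add: quasi_geodesic_def)
  obtain \<Phi> where P: "\<And>s t. a \<le> s \<Longrightarrow> s \<le> t \<Longrightarrow> t \<le> b \<Longrightarrow> norm (\<gamma> t - \<gamma> s) \<le> \<Phi> t - \<Phi> s"
    "\<Phi> b - \<Phi> a \<le> length_const * \<delta> (\<gamma> t0) powr (1 / (2 * m))"
    using quasi_geodesic_length[OF q t0 max] by blast
  show "norm (\<gamma> b - \<gamma> a) \<le> length_const * \<delta> (\<gamma> t0) powr (1 / (2 * m))"
    using P(1)[of a b] P(2) ab by simp
  have "euclidean_length a b \<gamma> \<le> ennreal (\<Phi> b - \<Phi> a)"
    by (rule euclidean_length_dominated[OF ab P(1)])
  also have "\<dots> \<le> ennreal (length_const * \<delta> (\<gamma> t0) powr (1 / (2 * m)))"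
    by (rule ennreal_leI[OF P(2)])
  finally show "euclidean_length a b \<gamma> \<le> ennreal (length_const * \<delta> (\<gamma> t0) powr (1 / (2 * m)))" .
qed

text \<open>Up to the first time the height reaches \<open>h\<close> the curve has height at most \<open>h\<close>, so it has
  not moved far.\<close>

lemma first_high_time:
  assumes q: "quasi_geodesic X K L a b \<gamma>" and t0: "t0 \<in> {a..b}" and h: "h \<le> \<delta> (\<gamma> t0)" "h > 0"
  obtains s where "s \<in> {a..t0}" "h \<le> \<delta> (\<gamma> s)" "norm (\<gamma> s - \<gamma> a) \<le> length_const * h powr (1 / (2 * m))"
proof (cases "h \<le> \<delta> (\<gamma> a)")
  case True
  with t0 show ?thesis using length_const_pos by (intro that[of a]) auto
next
  case False
  have cont: "continuous_on {a..t0} (\<lambda>t. \<delta> (\<gamma> t))"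
    by (rule continuous_on_subset[OF quasi_geodesic_continuous[OF q]]) (use t0 in auto)
  let ?S = "{a..t0} \<inter> (\<lambda>t. \<delta> (\<gamma> t)) -` {h..}"
  have "closed ?S" by (rule continuous_closed_preimage[OF cont]) auto
  moreover have "bounded ?S" by (rule bounded_subset[of "{a..t0}"]) auto
  ultimately have "compact ?S" by (simp add: compact_eq_bounded_closed)
  moreover have "?S \<noteq> {}" using t0 h by auto
  ultimately obtain s where s: "s \<in> ?S" "\<And>t. t \<in> ?S \<Longrightarrow> s \<le> t"
    using compact_attains_inf[of ?S] by metis
  \<comment> \<open>At the first time the height equals \<open>h\<close> by continuity. It is then
    the largest height so far, and \<open>quasi_geodesic_displacement\<close> applies with its top
    at \<open>s\<close>.\<close>
  have "\<delta> (\<gamma> s) = h"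
  proof -
    obtain t where t: "a \<le> t" "t \<le> s" "\<delta> (\<gamma> t) = h"
      using IVT'[of "\<lambda>t. \<delta> (\<gamma> t)" a h s] s(1) False continuous_on_subset[OF cont, of "{a..s}"] by auto
    then have "s \<le> t" using s by auto
    then show ?thesis using t by simp
  qed
  moreover have "\<delta> (\<gamma> t) \<le> \<delta> (\<gamma> s)" if "t \<in> {a..s}" for t
  proof (cases "t = s")
    case False
    then have "t \<notin> ?S" using s(2)[of t] that by auto
    then show ?thesis using that s(1) \<open>\<delta> (\<gamma> s) = h\<close> by auto
  qed simp
  ultimately show ?thesis
    using quasi_geodesic_displacement(1)[OF quasi_geodesic_subinterval[OF q, of a s], of s] s(1) t0
    by (intro that[of s]) auto
qed

lemma last_high_time:
  assumes q: "quasi_geodesic X K L a b \<gamma>" and t0: "t0 \<in> {a..b}" and h: "h \<le> \<delta> (\<gamma> t0)" "h > 0"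
  obtains s where "s \<in> {t0..b}" "h \<le> \<delta> (\<gamma> s)" "norm (\<gamma> s - \<gamma> b) \<le> length_const * h powr (1 / (2 * m))"
proof -
  have "quasi_geodesic X K L (-b) (-a) (\<lambda>t. \<gamma> (- t))"
    unfolding quasi_geodesic_def
  proof (intro conjI ballI)
    show "- b \<le> - a" using q by (simp add: quasi_geodesic_def)
    show "(\<lambda>t. \<gamma> (- t)) ` {-b..-a} \<subseteq> X"
    proof (rule image_subsetI)
      fix t assume "t \<in> {-b..-a}"
      then have "- t \<in> {a..b}" by auto
      then show "\<gamma> (- t) \<in> X" using q unfolding quasi_geodesic_def by blast
    qed
    fix s t assume "s \<in> {-b..-a}" "t \<in> {-b..-a}"
    then have "- s \<in> {a..b}" "- t \<in> {a..b}" by auto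
    then have "1 / L * \<bar>- t - - s\<bar> \<le> K (\<gamma> (- s)) (\<gamma> (- t))" "K (\<gamma> (- s)) (\<gamma> (- t)) \<le> L * \<bar>- t - - s\<bar>"
      using q unfolding quasi_geodesic_def by blast+
    moreover have "\<bar>- t - - s\<bar> = \<bar>t - s\<bar>" by simp
    ultimately show "1 / L * \<bar>t - s\<bar> \<le> K (\<gamma> (- s)) (\<gamma> (- t))" "K (\<gamma> (- s)) (\<gamma> (- t)) \<le> L * \<bar>t - s\<bar>"
      by (simp_all only:)
  qed
  from first_high_time[OF this, of "- t0" h] t0 h obtain s where
    "s \<in> {-b..-t0}" "h \<le> \<delta> (\<gamma> (- s))" "norm (\<gamma> (- s) - \<gamma> (- (- b))) \<le> length_const * h powr (1 / (2 * m))" by auto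
  then show ?thesis by (intro that[of "- s"]) auto
qed

text \<open>\<open>spread * r\<close> is the scale for \<open>K_near\<close>. It dominates the
  distance of the two cut points, at most \<open>(1 + 2 * length_const) * r\<close>, and their
  heights, at most \<open>(3 + length_const) * r\<close>. \<open>height_const\<close> collects the
  additive constants at the end of \<open>quasi_geodesic_height\<close>.\<close>

definition "spread = 4 + 2 * length_const"
definition "height_const G = exp ((5 * ln spread + 3 * B + 4 * G) / 2)"

text \<open>With \<open>H\<close>, \<open>d1\<close>, \<open>d2\<close> the logarithmic heights of
  the top and of the cut points, passing through the top costs at least
  \<open>(2 * H - d1 - d2) / 2\<close>, and almost additivity compares this with \<open>K12\<close>.
  Up to constants and the additivity error,
  \<open>2 * H \<le> 2 * A * l - (A - 1) * (d1 + d2)\<close>. With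
  \<open>A - 1 = 1 / (4 * m)\<close> and \<open>d1 + d2 \<ge> 4 * m * l\<close> the right-hand side
  is at most \<open>l + l / (2 * m)\<close>; the last term pays for the error.\<close>

lemma quasi_geodesic_height:
  assumes q: "quasi_geodesic X K L a b \<gamma>" and t0: "t0 \<in> {a..b}"
    and gp: "almost_additive K (1 / (32 * L * m\<^sup>2)) G a b \<gamma>"
    and G: "G \<ge> 0"
    and r: "r = norm (\<gamma> a - \<gamma> b)" "r > 0" "r \<le> 1" "spread * r \<le> h0"
    and low: "\<delta> (\<gamma> a) \<le> 2 * r"
  shows "\<delta> (\<gamma> t0) \<le> height_const G * r powr (1 / 2)"
proof -
  have c: "spread \<ge> 4" using length_const_pos by (simp add: spread_def)
  have ab: "a \<in> {a..b}" "b \<in> {a..b}" using q by (auto simp: quasi_geodesic_def)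
  have X: "\<gamma> t \<in> X" if "t \<in> {a..b}" for t using q that by (auto simp: quasi_geodesic_def)
  define l lc where "l = ln r" and "lc = ln spread"
  have l: "l \<le> 0" and lc: "lc \<ge> 0" using r c by (auto simp: l_def lc_def)
  define h where "h = r powr (2 * m)"
  have h: "h > 0" "ln h = 2 * m * l" "h powr (1 / (2 * m)) = r"
    using r(2) m by (auto simp: h_def l_def ln_powr powr_powr)
  have C41: "height_const G \<ge> 1" using lc B G by (simp add: height_const_def lc_def[symmetric])
  show ?thesis
  proof (cases "h \<le> \<delta> (\<gamma> t0)")
    \<comment> \<open>The curve stays below the cutting height, which for \<open>r \<le> 1\<close>
      is at most \<open>r powr (1 / 2)\<close>.\<close>
    case False
    have "r powr (2 * m) \<le> r powr (1 / 2)" using r m by (intro powr_mono') auto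
    also have "\<dots> \<le> height_const G * r powr (1 / 2)" using mult_right_mono[OF C41, of "r powr (1 / 2)"] by simp
    finally show ?thesis using False by (simp add: h_def)
  next
    case True
    obtain s1 where s1: "s1 \<in> {a..t0}" "h \<le> \<delta> (\<gamma> s1)" "norm (\<gamma> s1 - \<gamma> a) \<le> length_const * r"
      using first_high_time[OF q t0 True h(1)] h(3) by metis
    obtain s2 where s2: "s2 \<in> {t0..b}" "h \<le> \<delta> (\<gamma> s2)" "norm (\<gamma> s2 - \<gamma> b) \<le> length_const * r"
      using last_high_time[OF q t0 True h(1)] h(3) by metis
    have s12: "s1 \<in> {a..b}" "s2 \<in> {a..b}" using s1(1) s2(1) t0 by auto
    define d1 d2 H K12 N where "d1 = ln (\<delta> (\<gamma> s1))" and "d2 = ln (\<delta> (\<gamma> s2))" and "H = ln (\<delta> (\<gamma> t0))"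
      and "K12 = K (\<gamma> s1) (\<gamma> s2)" and "N = s2 - s1"
    have d: "d1 \<ge> 2 * m * l" "d2 \<ge> 2 * m * l"
      using s1(2) s2(2) h \<delta>_pos X s12 unfolding d1_def d2_def by (metis ln_mono)+
    have lcr: "ln (spread * r) = lc + l" using r c by (simp add: ln_mult l_def lc_def)
    have sr: "spread * r = 4 * r + 2 * (length_const * r)" "0 \<le> length_const * r"
      using length_const_pos r(2) by (auto simp: spread_def algebra_simps)
    have "K12 \<le> A / 2 * ((ln (spread * r) - ln (\<delta> (\<gamma> s1))) + (ln (spread * r) - ln (\<delta> (\<gamma> s2)))) + B"
      unfolding K12_def
    proof (rule K_near[OF X[OF s12(1)] X[OF s12(2)] _ _ _ r(4)])
      have "norm (\<gamma> s1 - \<gamma> s2) \<le> norm (\<gamma> s1 - \<gamma> a) + norm (\<gamma> a - \<gamma> b) + norm (\<gamma> b - \<gamma> s2)"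
        using norm_triangle_ineq[of "\<gamma> s1 - \<gamma> a + (\<gamma> a - \<gamma> b)" "\<gamma> b - \<gamma> s2"]
          norm_triangle_ineq[of "\<gamma> s1 - \<gamma> a" "\<gamma> a - \<gamma> b"] by simp
      also have "\<dots> \<le> spread * r"
      proof -
        have "norm (\<gamma> b - \<gamma> s2) \<le> length_const * r" using s2(3) by (simp add: norm_minus_commute)
        then show ?thesis using s1(3) r(2) sr(1) unfolding r(1)[symmetric] by linarith
      qed
      finally show "norm (\<gamma> s1 - \<gamma> s2) \<le> spread * r" .
      show "\<delta> (\<gamma> s1) \<le> spread * r"
        using \<delta>_triangle[of "\<gamma> s1" "\<gamma> a"] s1(3) low sr r(2) by linarith
      have "\<delta> (\<gamma> b) \<le> 3 * r" using \<delta>_triangle[of "\<gamma> b" "\<gamma> a"] low r(1) by (simp add: norm_minus_commute)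
      then show "\<delta> (\<gamma> s2) \<le> spread * r"
        using \<delta>_triangle[of "\<gamma> s2" "\<gamma> b"] s2(3) sr r(2) by linarith
    qed
    then have "K12 \<le> A / 2 * (((lc + l) - d1) + ((lc + l) - d2)) + B"
      by (simp only: lcr d1_def d2_def)
    then have K12: "2 * K12 \<le> A * (2 * lc + 2 * l) - A * (d1 + d2) + 2 * B"
      by (simp add: field_simps)
    have "H - d1 \<le> 2 * K (\<gamma> s1) (\<gamma> t0)" "H - d2 \<le> 2 * K (\<gamma> t0) (\<gamma> s2)"
      using K_ge_log[OF X[OF s12(1)] X[OF t0]] K_ge_log[OF X[OF t0] X[OF s12(2)]]
      by (auto simp: H_def d1_def d2_def)
    moreover have "K (\<gamma> s1) (\<gamma> t0) + K (\<gamma> t0) (\<gamma> s2) - K12 \<le> 2 * (1 / (32 * L * m\<^sup>2) * N + G)"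
      using gp s1(1) s2(1) s12 unfolding K12_def N_def almost_additive_def by simp
    ultimately have H1: "2 * H \<le> d1 + d2 + 2 * K12 + 4 * (1 / (32 * L * m\<^sup>2) * N) + 4 * G" by simp
    have AA: "A * (d1 + d2) = (d1 + d2) + (d1 + d2) / (4 * m)"
      using m by (simp add: A_def field_simps)
    have dd: "(d1 + d2) / (4 * m) \<ge> l" using d m by (simp add: field_simps)
    have Al: "A * (2 * lc + 2 * l) \<le> 4 * lc + 2 * l + l / (2 * m)"
    proof -
      have "A * (2 * lc) \<le> 2 * (2 * lc)" using A_bounds lc by (intro mult_right_mono) auto
      moreover have "A * (2 * l) = 2 * l + l / (2 * m)" using m by (simp add: A_def field_simps)
      ultimately show ?thesis by (simp add: algebra_simps)
    qed
    \<comment> \<open>The parameter length is at most \<open>L * K12\<close>, and \<open>K12\<close>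
      is at most \<open>- 4 * m * l\<close> up to constants. The slope
      \<open>1 / (32 * L * m\<^sup>2)\<close> makes four times the error equal to
      \<open>- l / (2 * m)\<close> up to constants, exactly the surplus in
      \<open>Al\<close>.\<close>
    have N: "1 / (32 * L * m\<^sup>2) * N \<le> lc / 16 + B / 32 - l / (8 * m)"
    proof -
      have "1 / L * N \<le> K12"
      proof -
        have "1 / L * \<bar>s2 - s1\<bar> \<le> K (\<gamma> s1) (\<gamma> s2)" using q s12 unfolding quasi_geodesic_def by blast
        moreover have "\<bar>s2 - s1\<bar> = N" using s1(1) s2(1) by (simp add: N_def)
        ultimately show ?thesis by (simp only: K12_def)
      qed
      moreover have "2 * K12 \<le> 4 * lc - 8 * m * l + 2 * B"
      proof -
        have "2 * K12 \<le> A * ((lc + l - d1) + (lc + l - d2)) + 2 * B"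
          using K12 by (simp add: algebra_simps)
        also have "A * ((lc + l - d1) + (lc + l - d2)) \<le> A * (2 * lc - 4 * m * l)"
          using d l A_bounds by (intro mult_left_mono) auto
        also have "\<dots> \<le> 2 * (2 * lc - 4 * m * l)"
        proof (rule mult_right_mono[OF A_bounds(2)])
          have "m * l \<le> 0" using m l by (intro mult_nonneg_nonpos) auto
          moreover have "4 * m * l = 4 * (m * l)" by simp
          ultimately show "0 \<le> 2 * lc - 4 * m * l" using lc by linarith
        qed
        finally show ?thesis by simp
      qed
      ultimately have "1 / L * N \<le> 2 * lc - 4 * m * l + B" by simp
      then have le: "1 / (32 * m\<^sup>2) * (1 / L * N) \<le> 1 / (32 * m\<^sup>2) * (2 * lc - 4 * m * l + B)"
        by (intro mult_left_mono) auto
      have le2: "1 / (32 * m\<^sup>2) * (2 * lc + B) \<le> 1 / 32 * (2 * lc + B)"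
        using m lc B one_le_power[OF m, of 2] by (intro mult_right_mono divide_left_mono) auto
      have "1 / (32 * L * m\<^sup>2) * N = 1 / (32 * m\<^sup>2) * (1 / L * N)" by simp
      also note le
      also have "1 / (32 * m\<^sup>2) * (2 * lc - 4 * m * l + B) = 1 / (32 * m\<^sup>2) * (2 * lc + B) - l / (8 * m)"
        using m by (simp add: field_simps power2_eq_square)
      also have "\<dots> \<le> 1 / 32 * (2 * lc + B) - l / (8 * m)"
        using le2 by (rule diff_right_mono)
      also have "\<dots> = lc / 16 + B / 32 - l / (8 * m)" by simp
      finally show ?thesis .
    qed
    have "4 * (l / (8 * m)) = l / (2 * m)" by simp
    then have "2 * H \<le> l + 5 * lc + 3 * B + 4 * G"
      using H1 K12 AA dd Al N lc B by linarith
    then have "H \<le> l / 2 + (5 * lc + 3 * B + 4 * G) / 2" by (simp add: field_simps)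
    then have "exp H \<le> exp (l / 2) * exp ((5 * lc + 3 * B + 4 * G) / 2)"
      by (simp flip: exp_add)
    moreover have "exp H = \<delta> (\<gamma> t0)" using \<delta>_pos X[OF t0] by (simp add: H_def)
    moreover have "exp (l / 2) = r powr (1 / 2)" using r(2) by (simp add: powr_def l_def)
    ultimately show ?thesis by (simp add: height_const_def lc_def mult.commute)
  qed
qed


text \<open>Three regimes. If \<open>r\<close> is at most half the height of
  \<open>\<gamma> a\<close>, the curve is short in parameter and its heights are at most a constant
  times that of \<open>\<gamma> a\<close> (\<open>cA\<close>). If \<open>\<gamma> a\<close> is low
  and \<open>r\<close> small, \<open>quasi_geodesic_height\<close> bounds the top
  (\<open>cB\<close>). If \<open>r\<close> is bounded below, the bounded length is absorbed by the
  constant (\<open>cC\<close>).\<close>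

lemma quasi_geodesic_length_bound:
  assumes G: "G \<ge> 0"
  obtains c where "c > 0"
    "\<And>a b \<gamma>. quasi_geodesic X K L a b \<gamma> \<Longrightarrow>
       almost_additive K (1 / (32 * L * m\<^sup>2)) G a b \<gamma> \<Longrightarrow>
       euclidean_length a b \<gamma> \<le> ennreal (c * norm (\<gamma> a - \<gamma> b) powr (1 / (4 * m)))"
proof -
  let ?e = "1 / (4 * m)"
  have c0: "spread \<ge> 4" using length_const_pos by (simp add: spread_def)
  define r1 where "r1 = min 1 (h0 / spread)"
  have r1: "0 < r1" "r1 \<le> 1" "spread * r1 \<le> h0"
    using c0 h0 by (auto simp: r1_def min_def field_simps)
  define cA where "cA = 2 * L * speed_const * exp (2 * L\<^sup>2) * D"
  define cB where "cB = length_const * height_const G powr (1 / (2 * m))"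
  define cC where "cC = length_const * D * (1 / r1) powr ?e"
  have C4p: "height_const G > 0" by (simp add: height_const_def)
  have pos: "cA > 0" "cB > 0" "cC > 0"
    using L speed_const_pos length_const_pos D C4p r1 by (auto simp: cA_def cB_def cC_def)
  show ?thesis
  proof (rule that[of "cA + cB + cC"])
    show "cA + cB + cC > 0" using pos by simp
    fix a b \<gamma>
    assume q: "quasi_geodesic X K L a b \<gamma>" and gp: "almost_additive K (1 / (32 * L * m\<^sup>2)) G a b \<gamma>"
    define r where "r = norm (\<gamma> a - \<gamma> b)"
    have ab: "a \<le> b" "a \<in> {a..b}" "b \<in> {a..b}" using q by (auto simp: quasi_geodesic_def)
    have X: "\<gamma> t \<in> X" if "t \<in> {a..b}" for t using q that by (auto simp: quasi_geodesic_def)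
    have r0: "r \<ge> 0" "r \<le> D" using diam X ab by (auto simp: r_def)
    have "euclidean_length a b \<gamma> \<le> ennreal (cA * r powr ?e) \<or> euclidean_length a b \<gamma> \<le> ennreal (cB * r powr ?e)
       \<or> euclidean_length a b \<gamma> \<le> ennreal (cC * r powr ?e)"
    proof (cases "2 * r \<le> \<delta> (\<gamma> a)")
      case True
      define d where "d = \<delta> (\<gamma> a)"
      have d: "d > 0" using \<delta>_pos X ab by (simp add: d_def)
      have "K (\<gamma> a) (\<gamma> b) \<le> norm (\<gamma> b - \<gamma> a) / (d / 2)"
      proof (rule K_straight[OF X[OF ab(2)] X[OF ab(3)]])
        show "d / 2 \<le> \<delta> (\<gamma> b)" using \<delta>_triangle[of "\<gamma> a" "\<gamma> b"] True by (simp add: d_def r_def)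
      qed (use d d_def in auto)
      then have Kab: "K (\<gamma> a) (\<gamma> b) \<le> 2 * r / d" by (simp add: r_def norm_minus_commute mult.commute)
      have "1 / L * \<bar>b - a\<bar> \<le> K (\<gamma> a) (\<gamma> b)" using q ab unfolding quasi_geodesic_def by blast
      then have "\<bar>b - a\<bar> / L \<le> 2 * r / d" using Kab by simp
      then have ba: "b - a \<le> L * (2 * r / d)" using L ab(1) by (simp add: pos_divide_le_eq mult.commute)
      have "2 * r / d \<le> 1" using True d by (simp add: d_def)
      \<comment> \<open>Parameter length at most \<open>L\<close> gives
        \<open>K \<le> L\<^sup>2\<close> from \<open>\<gamma> a\<close>, so heights grow by a factor
        of at most \<open>exp (2 * L\<^sup>2)\<close>.\<close>
      then have ba1: "b - a \<le> L" using ba mult_left_mono[of "2 * r / d" 1 L] L by simp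
      define M where "M = speed_const * (exp (2 * L\<^sup>2) * d powr (1 / m))"
      have M: "M \<ge> 0" using speed_const_pos by (simp add: M_def)
      have speed: "speed_const * \<delta> (\<gamma> t) powr (1 / m) \<le> M" if t: "t \<in> {a..b}" for t
      proof -
        have dp: "\<delta> (\<gamma> t) > 0" using \<delta>_pos X[OF t] by simp
        have "K (\<gamma> a) (\<gamma> t) \<le> L * \<bar>t - a\<bar>" using q t ab unfolding quasi_geodesic_def by blast
        also have "\<dots> \<le> L * L" using t ba1 L by (intro mult_left_mono) auto
        finally have "ln (\<delta> (\<gamma> t)) \<le> ln d + 2 * L\<^sup>2"
          using K_ge_log[OF X[OF ab(2)] X[OF t]] by (simp add: d_def power2_eq_square)
        then have "ln (\<delta> (\<gamma> t)) / m \<le> (ln d + 2 * L\<^sup>2) / m" using m by (intro divide_right_mono) auto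
        also have "\<dots> \<le> ln d / m + 2 * L\<^sup>2 / 1"
          unfolding add_divide_distrib using m by (intro add_left_mono divide_left_mono) auto
        finally have "exp (ln (\<delta> (\<gamma> t)) / m) \<le> exp (ln d / m + 2 * L\<^sup>2)" by simp
        then have "\<delta> (\<gamma> t) powr (1 / m) \<le> exp (2 * L\<^sup>2) * d powr (1 / m)"
          using dp d by (simp add: powr_def exp_add mult.commute)
        then show ?thesis using speed_const_pos by (simp add: M_def)
      qed
      have dom: "norm (\<gamma> t - \<gamma> s) \<le> M * t - M * s" if st: "a \<le> s" "s \<le> t" "t \<le> b" for s t
      proof (rule locally_dominated_imp_dominated[OF _ st])
        fix s t assume st: "a \<le> s" "s \<le> t" "t \<le> b" "t - s \<le> 1"
        have "norm (\<gamma> t - \<gamma> s) \<le> speed_const * \<delta> (\<gamma> s) powr (1 / m) * \<bar>t - s\<bar>"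
          by (rule quasi_geodesic_step[OF q]) (use st in auto)
        also have "\<dots> \<le> M * \<bar>t - s\<bar>" by (intro mult_right_mono speed) (use st in auto)
        finally show "norm (\<gamma> t - \<gamma> s) \<le> M * t - M * s" using st by (simp add: algebra_simps)
      qed
      have "euclidean_length a b \<gamma> \<le> ennreal (M * b - M * a)"
        by (rule euclidean_length_dominated[OF ab(1) dom])
      also have "\<dots> \<le> ennreal (cA * r powr ?e)"
      proof (rule ennreal_leI)
        have "M * b - M * a = M * (b - a)" by (simp add: algebra_simps)
        also have "\<dots> \<le> M * (L * (2 * r / d))" using ba M by (rule mult_left_mono)
        also have "\<dots> = 2 * L * speed_const * exp (2 * L\<^sup>2) * (d powr (1 / m) * (r / d))"
          by (simp add: M_def)
        also have "\<dots> \<le> 2 * L * speed_const * exp (2 * L\<^sup>2) * (D * r powr ?e)"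
        proof (rule mult_left_mono)
          show "d powr (1 / m) * (r / d) \<le> D * r powr ?e"
          proof (cases "r = 0")
            case False
            then have rp: "r > 0" using r0 by simp
            \<comment> \<open>The exponent \<open>1 / m - 1\<close> is not positive, so
              \<open>d \<ge> 2 * r\<close> allows replacing \<open>d\<close> by
              \<open>r\<close>.\<close>
            have "d powr (1 / m) * (r / d) = r * d powr (1 / m - 1)"
              using d by (simp add: powr_diff)
            also have "\<dots> \<le> r * r powr (1 / m - 1)"
              using rp True m by (intro mult_left_mono powr_mono2') (auto simp: d_def)
            also have "\<dots> = r powr (1 / m)" using rp by (simp add: powr_diff)
            \<comment> \<open>\<open>1 / m\<close> is four times the target exponent; the other
              three quarters are absorbed by \<open>D\<close>.\<close>
            also have "\<dots> = r powr (3 * ?e) * r powr ?e"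
              using m by (simp flip: powr_add add: field_simps)
            also have "r powr (3 * ?e) \<le> D powr (3 * ?e)"
              using r0 m by (intro powr_mono2) auto
            also have "D powr (3 * ?e) \<le> D powr 1" using D m by (intro powr_mono) auto
            finally show ?thesis using D by (simp add: mult_right_mono)
          qed simp
        qed (use L speed_const_pos in auto)
        finally show "M * b - M * a \<le> cA * r powr ?e" by (simp add: cA_def algebra_simps)
      qed
      finally show ?thesis by blast
    next
      case False
      then have low: "\<delta> (\<gamma> a) \<le> 2 * r" by simp
      have rp: "r > 0" using False \<delta>_pos[OF X[OF ab(2)]] r0 by (cases "r = 0") auto
      obtain t0 where t0: "t0 \<in> {a..b}" "\<And>t. t \<in> {a..b} \<Longrightarrow> \<delta> (\<gamma> t) \<le> \<delta> (\<gamma> t0)"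
        using continuous_attains_sup[OF _ _ quasi_geodesic_continuous[OF q]] ab by auto
      define H where "H = \<delta> (\<gamma> t0)"
      have H: "H > 0" "H \<le> D" using \<delta>_pos \<delta>_le X[OF t0(1)] by (auto simp: H_def)
      have len: "euclidean_length a b \<gamma> \<le> ennreal (length_const * H powr (1 / (2 * m)))"
        unfolding H_def by (rule quasi_geodesic_displacement(2)[OF q t0])
      show ?thesis
      proof (cases "r \<le> r1")
        case True
        have "H \<le> height_const G * r powr (1 / 2)"
          unfolding H_def
        proof (rule quasi_geodesic_height[OF q t0(1) gp G r_def rp _ _ low])
          show "r \<le> 1" using True r1 by simp
          have "spread * r \<le> spread * r1" using True c0 by (intro mult_left_mono) auto
          then show "spread * r \<le> h0" using r1 by simp
        qed
        then have "H powr (1 / (2 * m)) \<le> (height_const G * r powr (1 / 2)) powr (1 / (2 * m))"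
          using H m by (intro powr_mono2) auto
        also have "\<dots> = height_const G powr (1 / (2 * m)) * r powr ?e"
          using C4p by (simp add: powr_mult powr_powr)
        finally have "length_const * H powr (1 / (2 * m)) \<le> cB * r powr ?e"
          using length_const_pos by (simp add: cB_def mult.assoc)
        from order_trans[OF len ennreal_leI[OF this]] show ?thesis by blast
      next
        case False
        have "H powr (1 / (2 * m)) \<le> D powr (1 / (2 * m))" using H m by (intro powr_mono2) auto
        also have "\<dots> \<le> D powr 1" using D m by (intro powr_mono) auto
        finally have "H powr (1 / (2 * m)) \<le> D * 1" using D by simp
        also have "\<dots> \<le> D * ((1 / r1) powr ?e * r powr ?e)"
        proof (rule mult_left_mono)
          have "1 = 1 powr ?e" by simp
          also have "\<dots> \<le> (1 / r1 * r) powr ?e"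
            using False r1 m by (intro powr_mono2) auto
          also have "\<dots> = (1 / r1) powr ?e * r powr ?e" by (rule powr_mult)
          finally show "1 \<le> (1 / r1) powr ?e * r powr ?e" .
        qed (use D in simp)
        finally have "length_const * H powr (1 / (2 * m)) \<le> cC * r powr ?e"
          using mult_left_mono[of "H powr (1 / (2 * m))" _ length_const] length_const_pos by (simp add: cC_def mult.assoc)
        from order_trans[OF len ennreal_leI[OF this]] show ?thesis by blast
      qed
    qed
    moreover have "ennreal (k * r powr ?e) \<le> ennreal ((cA + cB + cC) * r powr ?e)" if "k \<le> cA + cB + cC" for k
      using that by (intro ennreal_leI mult_right_mono) auto
    moreover have "cA \<le> cA + cB + cC" "cB \<le> cA + cB + cC" "cC \<le> cA + cB + cC" using pos by auto
    ultimately show "euclidean_length a b \<gamma> \<le> ennreal ((cA + cB + cC) * norm (\<gamma> a - \<gamma> b) powr ?e)"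
      unfolding r_def[symmetric] by (meson order_trans)
  qed
qed

end

end

section \<open>Gromov hyperbolicity\<close>

lemma log_sublinear:
  fixes c \<eta> :: real
  assumes "c \<ge> 0" "\<eta> > 0"
  obtains G where "G \<ge> 0" "\<And>x. x \<ge> 0 \<Longrightarrow> c * log 2 (x + 1) \<le> \<eta> * x + G"
proof -
  \<comment> \<open>In \<open>ln y \<le> \<epsilon> * y - 1 - ln \<epsilon>\<close> this slope makes
    \<open>c / ln 2 * \<epsilon>\<close> at most \<open>\<eta>\<close>; the \<open>+ 1\<close> in
    the denominator admits \<open>c = 0\<close>.\<close>
  define \<epsilon> where "\<epsilon> = \<eta> * ln 2 / (c + 1)"
  have \<epsilon>: "\<epsilon> > 0" using assms by (simp add: \<epsilon>_def)
  define G where "G = \<eta> + c / ln 2 * \<bar>ln \<epsilon>\<bar>"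
  show ?thesis
  proof (rule that[of G])
    show "G \<ge> 0" using assms by (simp add: G_def)
    fix x :: real assume x: "x \<ge> 0"
    have "ln (x + 1) = ln (\<epsilon> * (x + 1)) - ln \<epsilon>" using \<epsilon> x by (simp add: ln_mult)
    also have "\<dots> \<le> \<epsilon> * (x + 1) + \<bar>ln \<epsilon>\<bar>"
      using ln_le_minus_one[of "\<epsilon> * (x + 1)"] \<epsilon> x by auto
    finally have "c / ln 2 * ln (x + 1) \<le> c / ln 2 * (\<epsilon> * (x + 1) + \<bar>ln \<epsilon>\<bar>)"
      using assms(1) by (intro mult_left_mono) auto
    also have "\<dots> = c / (c + 1) * (\<eta> * (x + 1)) + c / ln 2 * \<bar>ln \<epsilon>\<bar>"
    proof -
      have "c / ln 2 * (\<epsilon> * (x + 1)) = c / (c + 1) * (\<eta> * (x + 1))" by (simp add: \<epsilon>_def)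
      then show ?thesis by (simp only: distrib_left)
    qed
    also have "c / (c + 1) * (\<eta> * (x + 1)) \<le> 1 * (\<eta> * (x + 1))"
      using assms x by (intro mult_right_mono) auto
    finally show "c * log 2 (x + 1) \<le> \<eta> * x + G" by (simp add: log_def G_def algebra_simps)
  qed
qed

text \<open>Hyperbolicity at the midpoint of the chain bounds the smaller of two products, and the
  induction continues in that half. One \<open>\<delta>\<close> is lost per halving, hence only
  logarithmically many in the number of links.\<close>

lemma gromov_product_chain:
  assumes hyp: "\<And>w x y z. w \<in> X \<Longrightarrow> x \<in> X \<Longrightarrow> y \<in> X \<Longrightarrow> z \<in> X \<Longrightarrow>
      gromov_product \<rho> w x y \<ge> min (gromov_product \<rho> w x z) (gromov_product \<rho> w z y) - \<delta>"
    and p: "p \<in> X" and z: "\<And>i. i \<le> 2 ^ k \<Longrightarrow> z i \<in> X"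
  shows "\<exists>i<2 ^ k. gromov_product \<rho> p (z i) (z (Suc i)) \<le> gromov_product \<rho> p (z 0) (z (2 ^ k)) + real k * \<delta>"
  using z
proof (induction k arbitrary: z)
  case (Suc k)
  have "gromov_product \<rho> p (z 0) (z (2 ^ Suc k)) \<ge>
      min (gromov_product \<rho> p (z 0) (z (2 ^ k))) (gromov_product \<rho> p (z (2 ^ k)) (z (2 ^ Suc k))) - \<delta>"
    by (rule hyp) (use p Suc.prems in auto)
  then consider "gromov_product \<rho> p (z 0) (z (2 ^ k)) \<le> gromov_product \<rho> p (z 0) (z (2 ^ Suc k)) + \<delta>"
    | "gromov_product \<rho> p (z (2 ^ k)) (z (2 ^ Suc k)) \<le> gromov_product \<rho> p (z 0) (z (2 ^ Suc k)) + \<delta>"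
    by (auto simp: min_def split: if_splits)
  then show ?case
  proof cases
    case 1
    obtain i where "i < 2 ^ k"
      "gromov_product \<rho> p (z i) (z (Suc i)) \<le> gromov_product \<rho> p (z 0) (z (2 ^ k)) + real k * \<delta>"
      using Suc.IH[of z] Suc.prems by auto
    then show ?thesis using 1 by (intro exI[of _ i]) (auto simp: algebra_simps)
  next
    case 2
    obtain i where "i < 2 ^ k"
      "gromov_product \<rho> p (z (2 ^ k + i)) (z (2 ^ k + Suc i)) \<le> gromov_product \<rho> p (z (2 ^ k + 0)) (z (2 ^ k + 2 ^ k)) + real k * \<delta>"
      using Suc.IH[of "\<lambda>i. z (2 ^ k + i)"] Suc.prems by auto
    then show ?thesis using 2 by (intro exI[of _ "2 ^ k + i"]) (auto simp: algebra_simps mult_2)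
  qed
qed auto

text \<open>A weak form of the stability of quasi-geodesics, with a logarithmic instead of a bounded error:
  every point of a geodesic is close to the quasi-geodesic with the same endpoints by
  hyperbolicity along a chain, so two nearby points of the geodesic are close to points of the
  quasi-geodesic before and after time \<open>t\<close>.\<close>

lemma quasi_geodesic_gromov_product:
  fixes \<rho> :: "'a \<Rightarrow> 'a \<Rightarrow> real"
  assumes hyp: "gromov_hyperbolic X \<rho>" and L: "L \<ge> 1" and \<eta>: "\<eta> > 0"
  obtains G where "G \<ge> 0"
    "\<And>\<gamma> a b. quasi_geodesic X \<rho> L a b \<gamma> \<Longrightarrow> almost_additive \<rho> \<eta> G a b \<gamma>"
proof -
  have pgs: "proper_geodesic_space X \<rho>" using hyp by (simp add: gromov_hyperbolic_def)
  then interpret Metric_space X \<rho> by (simp add: proper_geodesic_space_def)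
  obtain \<delta> where \<delta>: "\<delta> \<ge> 0" "\<And>w x y z. w \<in> X \<Longrightarrow> x \<in> X \<Longrightarrow> y \<in> X \<Longrightarrow> z \<in> X \<Longrightarrow>
      gromov_product \<rho> w x y \<ge> min (gromov_product \<rho> w x z) (gromov_product \<rho> w z y) - \<delta>"
    using hyp by (auto simp: gromov_hyperbolic_def)
  \<comment> \<open>\<open>2 * L\<^sup>2 + 1\<close> is the factor with which the closeness
    \<open>D\<close> enters the final error, so \<open>c\<close> is the coefficient of
    \<open>k\<close> there.\<close>
  define c where "c = (2 * L\<^sup>2 + 1) * \<delta>"
  have c: "c \<ge> 0" using \<delta>(1) by (simp add: c_def)
  obtain G0 where G0: "G0 \<ge> 0" "\<And>x. x \<ge> 0 \<Longrightarrow> c * log 2 (x + 1) \<le> \<eta> * x + G0"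
    using log_sublinear[OF c \<eta>] by blast
  define G where "G = G0 + (2 * L\<^sup>2 + 1) * (\<delta> + L) + L\<^sup>2"
  show ?thesis
  proof (rule that[of G])
    show "G \<ge> 0" using G0(1) \<delta>(1) L by (simp add: G_def)
    fix \<gamma> a b
    assume "quasi_geodesic X \<rho> L a b \<gamma>"
    then have sub: "\<gamma> ` {a..b} \<subseteq> X"
      and qg: "\<And>s t. s \<in> {a..b} \<Longrightarrow> t \<in> {a..b} \<Longrightarrow>
          1 / L * \<bar>t - s\<bar> \<le> \<rho> (\<gamma> s) (\<gamma> t) \<and> \<rho> (\<gamma> s) (\<gamma> t) \<le> L * \<bar>t - s\<bar>"
      unfolding quasi_geodesic_def by blast+
    show "almost_additive \<rho> \<eta> G a b \<gamma>"
      unfolding almost_additive_def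
    proof (intro allI impI)
      fix s t u assume "a \<le> s \<and> s \<le> t \<and> t \<le> u \<and> u \<le> b"
      then have stu: "a \<le> s" "s \<le> t" "t \<le> u" "u \<le> b" by auto
      have X: "\<gamma> \<tau> \<in> X" if "\<tau> \<in> {s..u}" for \<tau> using sub that stu by auto
      define N where "N = u - s"
      have N: "N \<ge> 0" using stu by (simp add: N_def)
      \<comment> \<open>Enough halvings to make the parameter steps \<open>N / 2 ^ k\<close> at most
        \<open>1\<close>; \<open>N + 1\<close> keeps the logarithm nonnegative.\<close>
      define k where "k = nat \<lceil>log 2 (N + 1)\<rceil>"
      have lg: "log 2 (N + 1) \<ge> 0" using N by simp
      have k: "real k \<le> log 2 (N + 1) + 1" "log 2 (N + 1) \<le> real k" using lg unfolding k_def by linarith+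
      have kN: "N \<le> 2 ^ k"
      proof -
        have "N + 1 = 2 powr (log 2 (N + 1))" using N by simp
        also have "\<dots> \<le> 2 powr (real k)" using k(2) by simp
        finally show ?thesis by (simp add: powr_realpow)
      qed
      define D where "D = real k * \<delta> + L"
      have D: "D \<ge> 0" using \<delta>(1) L by (simp add: D_def)
      have near: "\<exists>\<tau>\<in>{s..u}. \<rho> p (\<gamma> \<tau>) \<le> gromov_product \<rho> p (\<gamma> s) (\<gamma> u) + D" if p: "p \<in> X" for p
      proof -
        define z where "z = (\<lambda>i::nat. \<gamma> (s + N * (real i / 2 ^ k)))"
        have pt: "s + N * (real i / 2 ^ k) \<in> {s..u}" if "i \<le> 2 ^ k" for i
        proof -
          have "real i \<le> 2 ^ k" using that by (metis of_nat_le_iff of_nat_numeral of_nat_power)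
          then have "real i / 2 ^ k \<le> 1" by simp
          then have "N * (real i / 2 ^ k) \<le> N * 1" using N by (intro mult_left_mono) auto
          then show ?thesis using N by (auto simp: N_def)
        qed
        have "\<exists>i<2 ^ k. gromov_product \<rho> p (z i) (z (Suc i)) \<le> gromov_product \<rho> p (z 0) (z (2 ^ k)) + real k * \<delta>"
          by (rule gromov_product_chain[of X, OF \<delta>(2) p]) (use X pt in \<open>auto simp: z_def\<close>)
        then obtain i where i: "i < 2 ^ k"
          "gromov_product \<rho> p (z i) (z (Suc i)) \<le> gromov_product \<rho> p (\<gamma> s) (\<gamma> u) + real k * \<delta>"
          by (auto simp: z_def N_def)
        let ?\<tau> = "s + N * (real i / 2 ^ k)" and ?\<tau>' = "s + N * (real (Suc i) / 2 ^ k)"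
        have t: "?\<tau> \<in> {s..u}" "?\<tau>' \<in> {s..u}"
          using pt[of i] pt[of "Suc i"] i(1) by (simp_all only: less_imp_le Suc_leI)
        have "\<bar>?\<tau>' - ?\<tau>\<bar> = N / 2 ^ k" using N by (simp add: field_simps)
        also have "\<dots> \<le> 1" using kN by simp
        finally have "L * \<bar>?\<tau>' - ?\<tau>\<bar> \<le> L * 1" using L by (intro mult_left_mono) auto
        then have "\<rho> (z i) (z (Suc i)) \<le> L"
          using qg[of ?\<tau> ?\<tau>'] t stu unfolding z_def by auto
        moreover have "\<rho> p (z i) \<le> \<rho> p (z (Suc i)) + \<rho> (z (Suc i)) (z i)"
          by (rule triangle) (use p X t in \<open>auto simp: z_def\<close>)
        \<comment> \<open>Neighbouring points of the chain are at distance at most \<open>L\<close>,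
          so their Gromov product at \<open>p\<close> is at least the distance to \<open>p\<close>
          minus \<open>L\<close>.\<close>
        ultimately have "\<rho> p (z i) - L \<le> gromov_product \<rho> p (z i) (z (Suc i))"
          unfolding gromov_product_def by (simp add: commute field_simps)
        then have "\<rho> p (\<gamma> ?\<tau>) \<le> gromov_product \<rho> p (\<gamma> s) (\<gamma> u) + D"
          using i(2) by (simp add: D_def z_def)
        then show ?thesis using t(1) by blast
      qed
      have "\<gamma> s \<in> X" "\<gamma> t \<in> X" "\<gamma> u \<in> X" using X stu by auto
      then obtain c1 c2 \<sigma> where "metric_geodesic X \<rho> {c1..c2} \<sigma>" "joins c1 c2 \<sigma> (\<gamma> s) (\<gamma> u)"
        using pgs unfolding proper_geodesic_space_def by blast
      then have \<sigma>: "\<sigma> ` {c1..c2} \<subseteq> X" "\<And>w w'. w \<in> {c1..c2} \<Longrightarrow> w' \<in> {c1..c2} \<Longrightarrow> \<rho> (\<sigma> w) (\<sigma> w') = \<bar>w' - w\<bar>"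
        "c1 \<le> c2" "\<sigma> c1 = \<gamma> s" "\<sigma> c2 = \<gamma> u"
        by (auto simp: metric_geodesic_def joins_def)
      have \<sigma>X: "\<sigma> w \<in> X" if "w \<in> {c1..c2}" for w using \<sigma>(1) that by blast
      have near\<sigma>: "\<exists>\<tau>\<in>{s..u}. \<rho> (\<sigma> w) (\<gamma> \<tau>) \<le> D" if w: "w \<in> {c1..c2}" for w
      proof -
        have "gromov_product \<rho> (\<sigma> w) (\<gamma> s) (\<gamma> u) = 0"
          unfolding gromov_product_def \<sigma>(4)[symmetric] \<sigma>(5)[symmetric] using w \<sigma>(3) by (simp add: \<sigma>(2))
        then show ?thesis using near[OF \<sigma>X[OF w]] by simp
      qed
      define Q where "Q = (\<lambda>w. \<exists>\<tau>\<in>{t..u}. \<rho> (\<sigma> w) (\<gamma> \<tau>) \<le> D)"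
      define P where "P = (\<lambda>w. \<exists>\<tau>\<in>{s..t}. \<rho> (\<sigma> w) (\<gamma> \<tau>) \<le> D)"
      have PQ: "P w \<or> Q w" if "w \<in> {c1..c2}" for w
        using near\<sigma>[OF that] unfolding P_def Q_def by (meson atLeastAtMost_iff linear)
      have Pc: "P c1" unfolding P_def using stu D \<sigma>(4) X by (intro bexI[of _ s]) auto
      have Qc: "Q c2" unfolding Q_def using stu D \<sigma>(5) X by (intro bexI[of _ u]) auto
      \<comment> \<open>A discrete intermediate value argument: in unit steps along the geodesic,
        the first point close to the curve after time \<open>t\<close> has a predecessor close to
        the curve before \<open>t\<close>. If it is the starting point, it serves as both.\<close>
      obtain w w' where w: "w \<in> {c1..c2}" "w' \<in> {c1..c2}" "\<bar>w' - w\<bar> \<le> 1" "P w" "Q w'"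
      proof -
        obtain n :: nat where n: "c2 - c1 \<le> real n" using real_arch_simple by blast
        define v where "v = (\<lambda>j::nat. min c2 (c1 + real j))"
        have v: "v j \<in> {c1..c2}" for j using \<sigma>(3) by (auto simp: v_def)
        have "v n = c2" using n by (auto simp: v_def min_def)
        then have "Q (v n)" using Qc by simp
        define j where "j = (LEAST j. Q (v j))"
        have j: "Q (v j)" unfolding j_def by (rule LeastI) (rule \<open>Q (v n)\<close>)
        show thesis
        proof (cases j)
          case 0
          then have "v j = c1" using \<sigma>(3) by (simp add: v_def)
          then show thesis using that[of c1 c1] j Pc v[of j] by auto
        next
          case (Suc i)
          then have "\<not> Q (v i)" unfolding j_def by (metis lessI not_less_Least)
          then have "P (v i)" using PQ v by blast
          moreover have "\<bar>v j - v i\<bar> \<le> 1" unfolding Suc v_def by auto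
          ultimately show thesis using that[of "v i" "v j"] v j by blast
        qed
      qed
      obtain \<tau> where \<tau>: "\<tau> \<in> {s..t}" "\<rho> (\<sigma> w) (\<gamma> \<tau>) \<le> D" using w(4) by (auto simp: P_def)
      obtain \<tau>' where \<tau>': "\<tau>' \<in> {t..u}" "\<rho> (\<sigma> w') (\<gamma> \<tau>') \<le> D" using w(5) by (auto simp: Q_def)
      have mem: "\<tau> \<in> {s..u}" "\<tau>' \<in> {s..u}" "t \<in> {s..u}" using \<tau>(1) \<tau>'(1) stu by auto
      have "\<rho> (\<gamma> \<tau>) (\<gamma> \<tau>') \<le> \<rho> (\<gamma> \<tau>) (\<sigma> w) + \<rho> (\<sigma> w) (\<gamma> \<tau>')"
        by (rule triangle) (use X mem \<sigma>X w in auto)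
      moreover have "\<rho> (\<sigma> w) (\<gamma> \<tau>') \<le> \<rho> (\<sigma> w) (\<sigma> w') + \<rho> (\<sigma> w') (\<gamma> \<tau>')"
        by (rule triangle) (use X mem \<sigma>X w in auto)
      ultimately have "\<rho> (\<gamma> \<tau>) (\<gamma> \<tau>') \<le> 2 * D + 1"
        using \<tau>(2) \<tau>'(2) w(3) \<sigma>(2)[OF w(1,2)] commute[of "\<gamma> \<tau>" "\<sigma> w"] by simp
      moreover have "1 / L * \<bar>\<tau>' - \<tau>\<bar> \<le> \<rho> (\<gamma> \<tau>) (\<gamma> \<tau>')" using qg[of \<tau> \<tau>'] mem stu by auto
      ultimately have "\<bar>\<tau>' - \<tau>\<bar> / L \<le> 2 * D + 1" by simp
      then have "\<tau>' - \<tau> \<le> L * (2 * D + 1)" using L by (simp add: pos_divide_le_eq mult.commute)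
      \<comment> \<open>\<open>t\<close> lies between \<open>\<tau>\<close> and
        \<open>\<tau>'\<close>, so the bound for the longer interval applies.\<close>
      then have "\<bar>t - \<tau>\<bar> \<le> L * (2 * D + 1)" using \<tau>(1) \<tau>'(1) by auto
      then have "L * \<bar>t - \<tau>\<bar> \<le> L * (L * (2 * D + 1))" using L by (intro mult_left_mono) auto
      moreover have "\<rho> (\<gamma> \<tau>) (\<gamma> t) \<le> L * \<bar>t - \<tau>\<bar>" using qg[of \<tau> t] mem stu by auto
      ultimately have "\<rho> (\<gamma> \<tau>) (\<gamma> t) \<le> L\<^sup>2 * (2 * D + 1)" by (simp add: power2_eq_square mult.assoc)
      moreover have "\<rho> (\<sigma> w) (\<gamma> t) \<le> \<rho> (\<sigma> w) (\<gamma> \<tau>) + \<rho> (\<gamma> \<tau>) (\<gamma> t)"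
        by (rule triangle) (use X mem \<sigma>X w in auto)
      ultimately have E: "\<rho> (\<sigma> w) (\<gamma> t) \<le> L\<^sup>2 * (2 * D + 1) + D" using \<tau>(2) by simp
      have "\<rho> (\<gamma> s) (\<gamma> t) \<le> \<rho> (\<gamma> s) (\<sigma> w) + \<rho> (\<sigma> w) (\<gamma> t)"
        by (rule triangle) (use X mem \<sigma>X w stu in auto)
      moreover have "\<rho> (\<gamma> t) (\<gamma> u) \<le> \<rho> (\<gamma> t) (\<sigma> w) + \<rho> (\<sigma> w) (\<gamma> u)"
        by (rule triangle) (use X mem \<sigma>X w stu in auto)
      moreover have "\<rho> (\<gamma> s) (\<sigma> w) + \<rho> (\<sigma> w) (\<gamma> u) = \<rho> (\<gamma> s) (\<gamma> u)"
        unfolding \<sigma>(4)[symmetric] \<sigma>(5)[symmetric] using w(1) \<sigma>(3) by (simp add: \<sigma>(2))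
      ultimately have F: "\<rho> (\<gamma> s) (\<gamma> t) + \<rho> (\<gamma> t) (\<gamma> u) - \<rho> (\<gamma> s) (\<gamma> u) \<le> 2 * (L\<^sup>2 * (2 * D + 1) + D)"
        using E commute[of "\<gamma> t" "\<sigma> w"] by simp
      have "L\<^sup>2 * (2 * D + 1) + D = (2 * L\<^sup>2 + 1) * D + L\<^sup>2" by (simp add: algebra_simps)
      also have "(2 * L\<^sup>2 + 1) * D = c * real k + (2 * L\<^sup>2 + 1) * L"
        by (simp add: D_def c_def algebra_simps)
      also have "c * real k \<le> c * (log 2 (N + 1) + 1)" using k(1) c by (intro mult_left_mono)
      also have "\<dots> \<le> \<eta> * N + G0 + c" using G0(2)[OF N] by (simp add: algebra_simps)
      finally have "L\<^sup>2 * (2 * D + 1) + D \<le> \<eta> * N + G" by (simp add: G_def c_def algebra_simps)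
      with F show "\<rho> (\<gamma> s) (\<gamma> t) + \<rho> (\<gamma> t) (\<gamma> u) - \<rho> (\<gamma> s) (\<gamma> u) \<le> 2 * (\<eta> * (u - s) + G)"
        by (simp add: N_def)
    qed
  qed
qed

section \<open>The length estimate\<close>

text \<open>For \<open>r \<le> 1\<close> lowering the exponent only increases the power; the factor
  \<open>D\<close> covers \<open>r\<close> up to \<open>D\<close>. It serves to pass from
  \<open>1 / (4 * m)\<close> to \<open>c2\<close>.\<close>

lemma powr_exponent_mono_bounded:
  fixes r D p q :: real
  assumes "0 \<le> r" "r \<le> D" "D \<ge> 1" "0 < q" "q \<le> p" "p \<le> 1"
  shows "r powr p \<le> D * r powr q"
proof -
  have "r powr p = r powr (p - q) * r powr q" by (simp flip: powr_add)
  also have "r powr (p - q) \<le> D powr (p - q)" using assms by (intro powr_mono2) auto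
  also have "D powr (p - q) \<le> D powr 1" using assms by (intro powr_mono) auto
  finally show ?thesis using assms by (simp add: mult_right_mono)
qed

lemma m_convex_distance_estimates:
  fixes \<Omega> :: "(complex ^ 'n) set"
  assumes m: "m \<ge> 1" and conv: "m_convex m \<Omega>" and C1: "C1_boundary \<Omega>"
  obtains C B h0 D where
    "distance_estimates \<Omega> (kobayashi_dist \<Omega>) (bdist \<Omega>) m C B h0 D (1 + 1 / (4 * m))"
proof -
  obtain C where \<Omega>: "open \<Omega>" "\<Omega> \<noteq> {}" "bounded \<Omega>" "convex \<Omega>" and C: "C > 0"
    "\<And>z v. z \<in> \<Omega> \<Longrightarrow> v \<noteq> 0 \<Longrightarrow> bdist_dir \<Omega> z v \<le> C * bdist \<Omega> z powr (1 / m)"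
    using conv by (auto simp: m_convex_def)
  interpret bounded_convex_domain \<Omega> by unfold_locales (use \<Omega> in auto)
  have "1 + 1 / (4 * m) > 1" using m by simp
  from kobayashi_dist_upper[OF C1 this \<Omega>(2)] obtain B h0 where K: "B \<ge> 0" "h0 > 0"
    "\<And>x y h. x \<in> \<Omega> \<Longrightarrow> y \<in> \<Omega> \<Longrightarrow> norm (x - y) \<le> h \<Longrightarrow> bdist \<Omega> x \<le> h \<Longrightarrow> bdist \<Omega> y \<le> h \<Longrightarrow> h \<le> h0 \<Longrightarrow>
       kobayashi_dist \<Omega> x y \<le> (1 + 1 / (4 * m)) / 2 * ((ln h - ln (bdist \<Omega> x)) + (ln h - ln (bdist \<Omega> y))) + B"
    "\<And>x y. x \<in> \<Omega> \<Longrightarrow> y \<in> \<Omega> \<Longrightarrow>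
       kobayashi_dist \<Omega> x y \<le> (1 + 1 / (4 * m)) / 2 * (- ln (bdist \<Omega> x) - ln (bdist \<Omega> y)) + B"
    by blast
  obtain D0 where D0: "D0 > 0" "\<And>x. x \<in> \<Omega> \<Longrightarrow> norm x \<le> D0"
    using bounded_pos[of \<Omega>] \<Omega>(3) by blast
  obtain o' where o': "o' \<in> \<Omega>" using \<Omega>(2) by blast
  define D where "D = bdist \<Omega> o' + 2 * D0 + 1"
  have bo: "bdist \<Omega> o' > 0" by (rule bdist_pos'[OF o'])
  have nD: "norm (x - y) \<le> D" if "x \<in> \<Omega>" "y \<in> \<Omega>" for x y
    using norm_triangle_ineq4[of x y] D0(2)[OF that(1)] D0(2)[OF that(2)] bo by (simp add: D_def)
  have bD: "bdist \<Omega> x \<le> D" if "x \<in> \<Omega>" for x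
    using bdist_triangle[of \<Omega> x o'] norm_triangle_ineq4[of x o'] D0(2)[OF that] D0(2)[OF o'] by (simp add: D_def)
  show ?thesis
  \<comment> \<open>The constant of the locale absorbs the factor \<open>2\<close> of
    \<open>norm_le_kobayashi_dist\<close>.\<close>
  proof (rule that[of "2 * C" B h0 D], unfold_locales)
    show "norm (y - x) \<le> 2 * C * exp (2 * \<tau> / m) * bdist \<Omega> z powr (1 / m) * \<tau>"
      if "x \<in> \<Omega>" "y \<in> \<Omega>" "kobayashi_dist \<Omega> x y < \<tau>" "z = x \<or> z = y" for x y z \<tau>
      by (rule norm_le_kobayashi_dist[OF C _ that]) (use m in auto)
    show "D \<ge> 1" using bo D0(1) by (simp add: D_def)
  qed (use m C K bdist_pos' bD nD bdist_triangle kobayashi_dist_ge_log kobayashi_dist_straight in auto)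
qed

theorem theorem1p2:
  fixes \<Omega> :: "(complex ^ 'n) set" and m c2 :: real
  assumes "CARD('n) \<ge> 2"
    and "m \<ge> 1"
    and "m_convex m \<Omega>"
    and "Dini_smooth_boundary \<Omega>"
    and "0 < c2" and "c2 < 1 / (12 * m\<^sup>2 - 8 * m)"
  shows "(\<exists>c1>0. \<forall>x\<in>\<Omega>. \<forall>y\<in>\<Omega>. \<forall>a b \<sigma>.
            kobayashi_geodesic \<Omega> {a..b} \<sigma> \<and> joins a b \<sigma> x y \<longrightarrow>
            euclidean_length a b \<sigma> \<le> ennreal (c1 * norm (x - y) powr c2)) \<and>
         (gromov_hyperbolic \<Omega> (kobayashi_dist \<Omega>) \<longrightarrow>
          (\<forall>L\<ge>1. \<exists>c1'>0. \<forall>x\<in>\<Omega>. \<forall>y\<in>\<Omega>. \<forall>a b \<gamma>.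
            kobayashi_quasi_geodesic L \<Omega> {a..b} \<gamma> \<and> joins a b \<gamma> x y \<longrightarrow>
            euclidean_length a b \<gamma> \<le> ennreal (c1' * norm (x - y) powr c2)))"
proof -
  let ?K = "kobayashi_dist \<Omega>"
  have "C1_boundary \<Omega>" using assms(4) by (simp add: Dini_smooth_boundary_def)
  then obtain C B h0 D where
    "distance_estimates \<Omega> ?K (bdist \<Omega>) m C B h0 D (1 + 1 / (4 * m))"
    using m_convex_distance_estimates[OF assms(2,3)] by blast
  then interpret distance_estimates \<Omega> ?K "bdist \<Omega>" m C B h0 D "1 + 1 / (4 * m)" .
  \<comment> \<open>\<open>12 * m\<^sup>2 - 8 * m \<ge> 4 * m\<close> because
    \<open>m\<^sup>2 \<ge> m\<close>.\<close>
  have c2: "c2 \<le> 1 / (4 * m)"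
  proof -
    have "m \<le> m\<^sup>2" using assms(2) by (simp add: power2_eq_square)
    then have "1 / (12 * m\<^sup>2 - 8 * m) \<le> 1 / (4 * m)" using assms(2) by (intro divide_left_mono mult_pos_pos) auto
    then show ?thesis using assms(6) by simp
  qed
  have final: "euclidean_length a b \<gamma> \<le> ennreal (c * D * norm (\<gamma> a - \<gamma> b) powr c2)"
    if "euclidean_length a b \<gamma> \<le> ennreal (c * norm (\<gamma> a - \<gamma> b) powr (1 / (4 * m)))" "c > 0"
      "\<gamma> a \<in> \<Omega>" "\<gamma> b \<in> \<Omega>" for a b \<gamma> c
  proof -
    have "norm (\<gamma> a - \<gamma> b) powr (1 / (4 * m)) \<le> D * norm (\<gamma> a - \<gamma> b) powr c2"
      by (rule powr_exponent_mono_bounded) (use diam[OF that(3,4)] D assms(2,5) c2 in auto)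
    from mult_left_mono[OF this, of c] that(2)
    have "c * norm (\<gamma> a - \<gamma> b) powr (1 / (4 * m)) \<le> c * D * norm (\<gamma> a - \<gamma> b) powr c2" by simp
    from order_trans[OF that(1) ennreal_leI[OF this]] show ?thesis .
  qed
  show ?thesis
  proof (intro conjI impI allI)
    \<comment> \<open>A geodesic is a quasi-geodesic with \<open>L = 1\<close> and is exactly
      additive, so \<open>G = 0\<close> serves.\<close>
    from quasi_geodesic_length_bound[OF order_refl order_refl] obtain c where c: "c > 0"
      "\<And>a b \<gamma>. quasi_geodesic \<Omega> ?K 1 a b \<gamma> \<Longrightarrow> almost_additive ?K (1 / (32 * 1 * m\<^sup>2)) 0 a b \<gamma> \<Longrightarrow>
       euclidean_length a b \<gamma> \<le> ennreal (c * norm (\<gamma> a - \<gamma> b) powr (1 / (4 * m)))"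
      by blast
    show "\<exists>c1>0. \<forall>x\<in>\<Omega>. \<forall>y\<in>\<Omega>. \<forall>a b \<sigma>.
            kobayashi_geodesic \<Omega> {a..b} \<sigma> \<and> joins a b \<sigma> x y \<longrightarrow>
            euclidean_length a b \<sigma> \<le> ennreal (c1 * norm (x - y) powr c2)"
    proof (intro exI[of _ "c * D"] conjI ballI allI impI)
      show "c * D > 0" using c(1) D by simp
      fix x y a b \<sigma> assume xy: "x \<in> \<Omega>" "y \<in> \<Omega>" and *: "kobayashi_geodesic \<Omega> {a..b} \<sigma> \<and> joins a b \<sigma> x y"
      then have \<sigma>: "a \<le> b" "\<sigma> a = x" "\<sigma> b = y" "\<sigma> ` {a..b} \<subseteq> \<Omega>"
        "\<And>s t. s \<in> {a..b} \<Longrightarrow> t \<in> {a..b} \<Longrightarrow> ?K (\<sigma> s) (\<sigma> t) = \<bar>t - s\<bar>"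
        by (auto simp: kobayashi_geodesic_def metric_geodesic_def joins_def)
      have "quasi_geodesic \<Omega> ?K 1 a b \<sigma>" using \<sigma> by (simp add: quasi_geodesic_def)
      then have "euclidean_length a b \<sigma> \<le> ennreal (c * norm (\<sigma> a - \<sigma> b) powr (1 / (4 * m)))"
        by (rule c(2)) (simp add: almost_additive_def \<sigma>(5))
      from final[OF this c(1)] show "euclidean_length a b \<sigma> \<le> ennreal (c * D * norm (x - y) powr c2)"
        using xy \<sigma>(2,3) by simp
    qed
  next
    fix L :: real assume hyp: "gromov_hyperbolic \<Omega> ?K" and L: "L \<ge> 1"
    have "1 / (32 * L * m\<^sup>2) > 0" using L assms(2) by simp
    from quasi_geodesic_gromov_product[OF hyp L this] obtain G where G: "G \<ge> 0"
      "\<And>\<gamma> a b. quasi_geodesic \<Omega> ?K L a b \<gamma> \<Longrightarrow> almost_additive ?K (1 / (32 * L * m\<^sup>2)) G a b \<gamma>"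
      by blast
    from quasi_geodesic_length_bound[OF L G(1)] obtain c where c: "c > 0"
      "\<And>a b \<gamma>. quasi_geodesic \<Omega> ?K L a b \<gamma> \<Longrightarrow> almost_additive ?K (1 / (32 * L * m\<^sup>2)) G a b \<gamma> \<Longrightarrow>
       euclidean_length a b \<gamma> \<le> ennreal (c * norm (\<gamma> a - \<gamma> b) powr (1 / (4 * m)))"
      by blast
    show "\<exists>c1'>0. \<forall>x\<in>\<Omega>. \<forall>y\<in>\<Omega>. \<forall>a b \<gamma>.
            kobayashi_quasi_geodesic L \<Omega> {a..b} \<gamma> \<and> joins a b \<gamma> x y \<longrightarrow>
            euclidean_length a b \<gamma> \<le> ennreal (c1' * norm (x - y) powr c2)"
    proof (intro exI[of _ "c * D"] conjI ballI allI impI)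
      show "c * D > 0" using c(1) D by simp
      fix x y a b \<gamma> assume xy: "x \<in> \<Omega>" "y \<in> \<Omega>" and *: "kobayashi_quasi_geodesic L \<Omega> {a..b} \<gamma> \<and> joins a b \<gamma> x y"
      then have \<gamma>: "\<gamma> a = x" "\<gamma> b = y" and qg: "quasi_geodesic \<Omega> ?K L a b \<gamma>"
        unfolding kobayashi_quasi_geodesic_def joins_def quasi_geodesic_def by blast+
      have "euclidean_length a b \<gamma> \<le> ennreal (c * norm (\<gamma> a - \<gamma> b) powr (1 / (4 * m)))"
        by (rule c(2)[OF qg G(2)[OF qg]])
      from final[OF this c(1)] show "euclidean_length a b \<gamma> \<le> ennreal (c * D * norm (x - y) powr c2)"
        using xy \<gamma> by simp
    qed
  qed
qed

end
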